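(* If the auxiliary Lagrangian $\lambda$ is continuous in $\mathbb R^n\times B_k^+$, where $B_k^+=\{(v,w)\in\mathbb R\times\mathbb R^k:v\ge0,\ v^2+|w|^2\le1\}$, then the problem of minimizing $\int_0^1L(x(t),u(t))\,dt$ subject to $\dot x=f(x)+G(x)u$, $x(0)=x^0$, $x(1)=x^1$ does not exhibit an $L_1^k[0,1]$-$\mathcal F_{k,1}^0$ Lavrentiev gap.
   Context: The vector fields $f,g_1,\dots,g_k$ on $\mathbb R^n$ are locally Lipschitz, $G=(g_1,\dots,g_k)$, $x^0,x^1\in\mathbb R^n$. $L:\mathbb R^{n+k}\to\mathbb R$ is continuous, and convex in $u$. The auxiliary Lagrangian $\lambda$ on $\mathbb R^n\times[0,+\infty[\times\mathbb R^k$ is $\lambda(y,v,w)=L(y,\frac wv)v$ for $v>0$, $\lambda(y,0,w)=\lim_{\eta\to0^+}L(y,\frac w\eta)\eta\in\,]-\infty,+\infty]$. Generalized controls: let $\mathcal T$ be the set of increasing locally absolutely continuous bijections of $[0,+\infty[$ with locally absolutely continuous inverse; locally absolutely continuous functions $g_1,g_2$ on $[0,+\infty[$ are equivalent if $\inf_{\alpha\in\mathcal T}\|g_1-g_2\circ\alpha\|_{L_\infty[0,+\infty[}=0$. $\mathcal F_{k,1}^0$ is the set of equivalence classes $[(V,W)]$ of locally absolutely continuous $(V,W):[0,+\infty[\to\mathbb R^{1+k}$ with $V(0)=0$, $W(0)=0$, $\dot V\ge0$ a.e., infinite total length, and $V(\infty)>1$. Put $(v,w)=(\dot V,\dot W)$,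 $V^{\#}(1)=\sup\{s\ge0:V(s)\le1\}$, let $y_{(v,w)}$ be the maximal solution of $\dot y=f(y)v+G(y)w$, $y(0)=x^0$, and, when it is defined on $[0,V^{\#}(1)]$, put $I([(V,W)])=\int_0^{V^{\#}(1)}\lambda(y_{(v,w)},v,w)\,d\tau$ (independent of the representative). For $u\in L_1^k[0,1]$, $U(t)=\int_0^tu\,ds$ and $x_u$ is the trajectory of $\dot x=f(x)+G(x)u$, $x(0)=x^0$; then $I([(t,U)])=\int_0^1L(x_u,u)\,dt$. Lavrentiev gap: the problem (the functional $I$) exhibits an $L_1^k[0,1]$-$\mathcal F_{k,1}^0$ Lavrentiev gap if $$\lim_{\varepsilon\to0^+}\ \inf_{u\in L_1^k[0,1],\ |x_u(1)-x^1|\le\varepsilon}I([(t,U)])\ >\ \inf_{[(V,W)]\in\mathcal F_{k,1}^0,\ y_{(v,w)}(V^{\#}(1))=x^1}I([(V,W)]),$$ where only controls whose trajectories are defined up to the final time are considered, and $\inf\emptyset=+\infty$. *)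

theory Defs
  imports "HOL-Analysis.Analysis" "HOL-Probability.Essential_Supremum"
begin

section \<open>Absolute continuity and Caratheodory solutions\<close>

text \<open>The usual \<open>\<epsilon>\<close>-\<open>\<delta>\<close> definition; a finite family of
  nonoverlapping compact intervals in \<open>S\<close> is a division of its union.\<close>

definition abs_continuous_on :: "real set \<Rightarrow> (real \<Rightarrow> 'a::real_normed_vector) \<Rightarrow> bool" where
  "abs_continuous_on S g \<longleftrightarrow>
     (\<forall>\<epsilon>>0. \<exists>\<delta>>0. \<forall>D. D division_of (\<Union>D) \<and> \<Union>D \<subseteq> S \<and> (\<Sum>K\<in>D. measure lborel K) < \<delta> \<longrightarrow>
        (\<Sum>K\<in>D. norm (g (Sup K) - g (Inf K))) < \<epsilon>)"

text \<open>Functions on \<open>[0,\<infinity>[\<close> are total functions of which only the values on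
  \<open>{0..}\<close> matter.\<close>

definition loc_abs_continuous :: "(real \<Rightarrow> 'a::real_normed_vector) \<Rightarrow> bool" where
  "loc_abs_continuous g \<longleftrightarrow> (\<forall>T\<ge>0. abs_continuous_on {0..T} g)"

definition caratheodory_solution ::
  "(real \<Rightarrow> 'a::real_normed_vector \<Rightarrow> 'a) \<Rightarrow> 'a \<Rightarrow> real \<Rightarrow> (real \<Rightarrow> 'a) \<Rightarrow> bool" where
  "caratheodory_solution F x0 T y \<longleftrightarrow>
     abs_continuous_on {0..T} y \<and> y 0 = x0 \<and>
     (AE t in lebesgue_on {0..T}. (y has_vector_derivative F t (y t)) (at t within {0..T}))"

definition control_field :: "('k::finite \<Rightarrow> real^'n \<Rightarrow> real^'n) \<Rightarrow> real^'n \<Rightarrow> real^'k \<Rightarrow> real^'n" where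
  "control_field g x u = (\<Sum>i\<in>UNIV. (u $ i) *\<^sub>R g i x)"


section \<open>The auxiliary Lagrangian and the cost functionals\<close>

text \<open>Only arguments \<open>v \<ge> 0\<close> are meaningful. If \<open>L\<close> is convex in \<open>u\<close>,
  the limit exists in \<open>]-\<infinity>,\<infinity>]\<close>.\<close>

definition aux_lagrangian ::
  "('a \<Rightarrow> 'b::real_vector \<Rightarrow> real) \<Rightarrow> 'a \<Rightarrow> real \<Rightarrow> 'b \<Rightarrow> ereal" where
  "aux_lagrangian L y v w =
     (if v > 0 then ereal (L y (w /\<^sub>R v) * v)
      else Lim (at_right 0) (\<lambda>\<eta>. ereal (L y (w /\<^sub>R \<eta>) * \<eta>)))"

definition half_ball :: "(real \<times> 'b::real_normed_vector) set" where
  "half_ball = {(v, w). v \<ge> 0 \<and> v\<^sup>2 + (norm w)\<^sup>2 \<le> 1}"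

text \<open>Integral of an extended-real function as the difference of the integrals of its positive
  and negative parts (\<open>e2ennreal\<close> sends negative numbers to 0). For the integrands below the
  negative part has a finite integral, by convexity of \<open>L\<close> in \<open>u\<close>.\<close>

definition ereal_integral :: "'a measure \<Rightarrow> ('a \<Rightarrow> ereal) \<Rightarrow> ereal" where
  "ereal_integral M h =
     enn2ereal (\<integral>\<^sup>+x. e2ennreal (h x) \<partial>M) - enn2ereal (\<integral>\<^sup>+x. e2ennreal (- h x) \<partial>M)"

definition ordinary_cost ::
  "('a \<Rightarrow> 'b \<Rightarrow> real) \<Rightarrow> (real \<Rightarrow> 'a) \<Rightarrow> (real \<Rightarrow> 'b) \<Rightarrow> ereal" where
  "ordinary_cost L x u = ereal_integral (lebesgue_on {0..1}) (\<lambda>t. ereal (L (x t) (u t)))"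


section \<open>Generalized controls\<close>

text \<open>A representative is a curve \<open>Z = (V, W)\<close>; the product norm is the Euclidean norm of
  \<open>\<real>\<^sup>1\<^sup>+\<^sup>k\<close>.\<close>

definition dot_v :: "(real \<Rightarrow> real \<times> 'b::real_normed_vector) \<Rightarrow> real \<Rightarrow> real" where
  "dot_v Z t = fst (vector_derivative Z (at t))"

definition dot_w :: "(real \<Rightarrow> real \<times> 'b::real_normed_vector) \<Rightarrow> real \<Rightarrow> 'b" where
  "dot_w Z t = snd (vector_derivative Z (at t))"

definition time_changes :: "(real \<Rightarrow> real) set" where
  "time_changes = {\<alpha>. bij_betw \<alpha> {0..} {0..} \<and> strict_mono_on {0..} \<alpha> \<and>
     loc_abs_continuous \<alpha> \<and> loc_abs_continuous (inv_into {0..} \<alpha>)}"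

definition frechet_equiv :: "(real \<Rightarrow> 'a::real_normed_vector) \<Rightarrow> (real \<Rightarrow> 'a) \<Rightarrow> bool" where
  "frechet_equiv g1 g2 \<longleftrightarrow>
     (INF \<alpha>\<in>time_changes. esssup (lebesgue_on {0..}) (\<lambda>t. ereal (norm (g1 t - g2 (\<alpha> t))))) = 0"

definition gen_control_curves :: "(real \<Rightarrow> real \<times> 'b::real_normed_vector) set" where
  "gen_control_curves = {Z. loc_abs_continuous Z \<and> Z 0 = (0, 0) \<and>
     (AE t in lebesgue_on {0..}. dot_v Z t \<ge> 0) \<and>
     (\<integral>\<^sup>+t. ennreal (norm (vector_derivative Z (at t))) \<partial>lebesgue_on {0..}) = \<infinity> \<and>
     Lim at_top (\<lambda>t. ereal (fst (Z t))) > 1}"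

definition gen_controls :: "(real \<Rightarrow> real \<times> 'b::real_normed_vector) set set" where
  "gen_controls = gen_control_curves //
     {(Z, Z'). Z \<in> gen_control_curves \<and> Z' \<in> gen_control_curves \<and> frechet_equiv Z Z'}"

definition final_param :: "(real \<Rightarrow> real \<times> 'b) \<Rightarrow> real" where
  "final_param Z = Sup {s. s \<ge> 0 \<and> fst (Z s) \<le> 1}"

definition gen_cost ::
  "('a \<Rightarrow> 'b::real_normed_vector \<Rightarrow> real) \<Rightarrow> (real \<Rightarrow> 'a) \<Rightarrow> (real \<Rightarrow> real \<times> 'b) \<Rightarrow> ereal" where
  "gen_cost L y Z =
     ereal_integral (lebesgue_on {0..final_param Z}) (\<lambda>t. aux_lagrangian L (y t) (dot_v Z t) (dot_w Z t))"


section \<open>The Lavrentiev gap\<close>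

text \<open>Trajectories are unique because the vector fields are locally Lipschitz, so a control whose
  trajectory is defined up to the final time is one for which a solution on the whole interval
  exists.\<close>

definition ordinary_inf ::
  "(real^'n \<Rightarrow> real^'n) \<Rightarrow> ('k::finite \<Rightarrow> real^'n \<Rightarrow> real^'n) \<Rightarrow> (real^'n \<Rightarrow> real^'k \<Rightarrow> real) \<Rightarrow>
   real^'n \<Rightarrow> real^'n \<Rightarrow> real \<Rightarrow> ereal" where
  "ordinary_inf f g L x0 x1 \<epsilon> =
     Inf {ordinary_cost L x u | x u. u absolutely_integrable_on {0..1} \<and>
        caratheodory_solution (\<lambda>t x. f x + control_field g x (u t)) x0 1 x \<and>
        norm (x 1 - x1) \<le> \<epsilon>}"

text \<open>The infimum over classes: cost and endpoint do not depend on the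
  representative, which therefore ranges over the whole class.\<close>

definition generalized_inf ::
  "(real^'n \<Rightarrow> real^'n) \<Rightarrow> ('k::finite \<Rightarrow> real^'n \<Rightarrow> real^'n) \<Rightarrow> (real^'n \<Rightarrow> real^'k \<Rightarrow> real) \<Rightarrow>
   real^'n \<Rightarrow> real^'n \<Rightarrow> ereal" where
  "generalized_inf f g L x0 x1 =
     Inf {gen_cost L y Z | y Z C. C \<in> gen_controls \<and> Z \<in> C \<and>
        caratheodory_solution
          (\<lambda>t y. dot_v Z t *\<^sub>R f y + control_field g y (dot_w Z t)) x0 (final_param Z) y \<and>
        y (final_param Z) = x1}"

definition lavrentiev_gap ::
  "(real^'n \<Rightarrow> real^'n) \<Rightarrow> ('k::finite \<Rightarrow> real^'n \<Rightarrow> real^'n) \<Rightarrow> (real^'n \<Rightarrow> real^'k \<Rightarrow> real) \<Rightarrow>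
   real^'n \<Rightarrow> real^'n \<Rightarrow> bool" where
  "lavrentiev_gap f g L x0 x1 \<longleftrightarrow>
     Lim (at_right 0) (ordinary_inf f g L x0 x1) > generalized_inf f g L x0 x1"

end

theory Submission
  imports Defs
begin

text \<open>By homogeneity, continuity of \<open>\<lambda>\<close> at the origin makes \<open>\<lambda>\<close> finite, continuous for all
  \<open>v \<ge> 0\<close>, and bounded by a multiple of \<open>|(v, w)|\<close> on compact sets of states. Given a generalized
  control with derivative \<open>(v, w)\<close> on \<open>[0, S]\<close>, approximate \<open>(v, w)\<close> almost everywhere, and dominated
  by an integrable function, by continuous \<open>(v\<^sub>j, w\<^sub>j)\<close> with \<open>v\<^sub>j > 0\<close> and \<open>\<integral> v\<^sub>j = 1\<close>. The
  trajectories \<open>y\<^sub>j\<close> converge uniformly and the costs converge by dominated convergence. Since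
  \<open>V\<^sub>j\<close> is a diffeomorphism from \<open>[0, S]\<close> to \<open>[0, 1]\<close>, the continuous control
  \<open>u\<^sub>j = (w\<^sub>j / v\<^sub>j) \<circ> V\<^sub>j\<^sup>-\<^sup>1\<close> has the trajectory \<open>y\<^sub>j \<circ> V\<^sub>j\<^sup>-\<^sup>1\<close> and the same cost. That
  \<open>V\<close> is differentiable almost everywhere with \<open>\<integral> v = 1\<close> is Lebesgue's fundamental theorem of
  calculus for absolutely continuous functions.\<close>

section \<open>Absolutely continuous functions\<close>

text \<open>A generalized control may have \<open>v = 0\<close> on whole intervals, where
  \<open>W\<close> moves while the original time stands still. There \<open>V\<close> has no
  inverse, and the cost is only a limit of ordinary ones; continuity of \<lambda> up to the face
  \<open>v = 0\<close> is what lets the cost survive the passage from speed zero to small positive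
  speed. The integrable dominating function serves twice: it bounds the L1 norms of all
  approximating controls, hence the constant in the comparison of trajectories, and through the
  linear growth of \<lambda> it dominates the cost integrands. Continuous approximants keep the
  change of time classical, and the exact normalisation of the speed makes the new time interval
  [0, 1]. The approximating trajectories end only near the target, which the tolerance \<epsilon> in
  the definition of the gap absorbs. Almost everywhere differentiability is derived from Vitali's
  covering theorem directly, without a decomposition into monotone functions.\<close>

text \<open>Vitali's theorem gives a countable disjoint subfamily covering \<open>E\<close> up to a
  null set. Its tails decrease to the empty set, since disjointness keeps a point out of two
  members, so finitely many members leave only measure below \<epsilon>. \<open>E\<close> need not
  be measurable; \<open>T\<close> is a measurable set containing what is left of it.
  \<open>P\<close> depends on both endpoints so that it can express a condition on the slope of a
  function.\<close>

lemma Vitali_finite_subcover: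
  fixes E U :: "real set"
  assumes U: "open U" "U \<in> lmeasurable" "E \<subseteq> U" and "\<epsilon> > 0"
    and P: "\<And>x d. x \<in> E \<Longrightarrow> 0 < d \<Longrightarrow> \<exists>u v. u < v \<and> x \<in> {u..v} \<and> v - u < d \<and> P u v"
  obtains D T where "D division_of \<Union>D" "\<Union>D \<subseteq> U"
    "\<forall>K\<in>D. \<exists>u v. u < v \<and> K = {u..v} \<and> P u v"
    "T \<in> lmeasurable" "measure lebesgue T < \<epsilon>" "E \<subseteq> \<Union>D \<union> T"
proof -
  \<comment> \<open>Intervals are handled as endpoint pairs and turned into balls by midpoint
    \<open>a\<close> and half-length \<open>r\<close>, the form in which the covering theorem is
    stated.\<close>
  define I where "I = {(u::real, v). u < v \<and> {u..v} \<subseteq> U \<and> P u v}"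
  define a r where "a = (\<lambda>(u::real, v). (u + v) / 2)" and "r = (\<lambda>(u::real, v). (v - u) / 2)"
  have cb: "cball (a i) (r i) = {fst i..snd i}" for i
    by (cases i) (auto simp: a_def r_def cball_eq_atLeastAtMost field_simps)
  have rpos: "0 < r i" if "i \<in> I" for i
    using that by (auto simp: I_def r_def)
  have cover: "\<exists>i. i \<in> I \<and> x \<in> cball (a i) (r i) \<and> r i < d" if x: "x \<in> E" and d: "0 < d" for x d
  proof -
    obtain e where e: "e > 0" "ball x e \<subseteq> U"
      using U x by (meson openE subsetD)
    obtain u v where uv: "u < v" "x \<in> {u..v}" "v - u < min d e" "P u v"
      using P[OF x, of "min d e"] d e by auto
    have "{u..v} \<subseteq> ball x e"
      using uv by (auto simp: dist_real_def)
    then have "(u, v) \<in> I"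
      using uv e by (auto simp: I_def)
    moreover have "r (u, v) < d"
      using uv d by (auto simp: r_def)
    ultimately show ?thesis
      using uv unfolding cb by (intro exI[of _ "(u, v)"]) auto
  qed
  obtain C where C: "countable C" "C \<subseteq> I"
    "pairwise (\<lambda>i j. disjnt (cball (a i) (r i)) (cball (a j) (r j))) C"
    "negligible (E - (\<Union>i\<in>C. cball (a i) (r i)))"
    by (rule Vitali_covering_theorem_cballs[of I r E a, OF rpos cover])
  define A where "A n = (\<Union>i\<in>{i\<in>C. n \<le> to_nat_on C i}. cball (a i) (r i))" for n
  have Am: "A n \<in> sets lebesgue" for n
    unfolding A_def by (intro sets.countable_UN'') (use C(1) in auto)
  have IU: "cball (a i) (r i) \<subseteq> U" if "i \<in> C" for i
    using that C(2) unfolding cb by (cases i) (auto simp: I_def)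
  have AU: "A n \<subseteq> U" for n
    using IU unfolding A_def by blast
  have Alm: "A n \<in> lmeasurable" for n
    using AU Am U(2) by (metis fmeasurableI2)
  have fin: "emeasure lebesgue (A n) \<noteq> \<infinity>" for n
    using fmeasurableD2[OF Alm] by simp
  have dec: "decseq A"
    unfolding decseq_def A_def by (auto intro: order_trans)
  have int: "(\<Inter>n. A n) = {}"
  proof -
    have False if x: "\<And>n. x \<in> A n" for x
    proof -
      obtain i where i: "i \<in> C" "x \<in> cball (a i) (r i)"
        using x[of 0] by (auto simp: A_def)
      obtain j where j: "j \<in> C" "Suc (to_nat_on C i) \<le> to_nat_on C j" "x \<in> cball (a j) (r j)"
        using x[of "Suc (to_nat_on C i)"] by (auto simp: A_def)
      then have "i \<noteq> j" by auto
      then show False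
        using pairwiseD[OF C(3) i(1) j(1)] i(2) j(3) unfolding disjnt_iff by blast
    qed
    then show ?thesis by blast
  qed
  have "(\<lambda>n. measure lebesgue (A n)) \<longlonglongrightarrow> measure lebesgue (\<Inter>n. A n)"
    by (rule Lim_measure_decseq[OF _ dec fin]) (use Am in blast)
  then have "(\<lambda>n. measure lebesgue (A n)) \<longlonglongrightarrow> 0"
    unfolding int by simp
  then obtain n where n: "measure lebesgue (A n) < \<epsilon>"
    using \<open>\<epsilon> > 0\<close> eventually_happens'[OF sequentially_bot order_tendstoD(2)] by blast
  define D where "D = (\<lambda>i. cball (a i) (r i)) ` {i\<in>C. to_nat_on C i < n}"
  define T where "T = A n \<union> (E - (\<Union>i\<in>C. cball (a i) (r i)))"
  have "finite {i\<in>C. to_nat_on C i < n}"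
    by (rule finite_imageD[of "to_nat_on C", OF finite_subset[of _ "{..<n}"]])
      (auto intro: inj_on_subset[OF inj_on_to_nat_on[OF C(1)]])
  then have fD: "finite D" by (simp add: D_def)
  show thesis
  proof
    show "D division_of \<Union>D"
    proof (rule division_ofI)
      show "\<exists>a b. K = cbox a b" if "K \<in> D" for K
        using that unfolding D_def cb box_real(2) by blast
      show "K \<noteq> {}" if K: "K \<in> D" for K
      proof -
        obtain i where i: "i \<in> C" "K = cball (a i) (r i)"
          using K unfolding D_def by blast
        then have "0 \<le> r i"
          using rpos C(2) by (simp add: less_imp_le subsetD)
        then show ?thesis
          unfolding i(2) by simp
      qed
      show "interior K1 \<inter> interior K2 = {}" if K: "K1 \<in> D" "K2 \<in> D" "K1 \<noteq> K2" for K1 K2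
      proof -
        obtain i j where ij: "i \<in> C" "j \<in> C" "K1 = cball (a i) (r i)" "K2 = cball (a j) (r j)"
          using K unfolding D_def by blast
        then have "disjnt K1 K2"
          using pairwiseD[OF C(3), of i j] K(3) by blast
        then show ?thesis
          using interior_subset[of K1] interior_subset[of K2] unfolding disjnt_iff by blast
      qed
    qed (use fD in auto)
    show "\<Union>D \<subseteq> U"
      using IU unfolding D_def by blast
    show "\<forall>K\<in>D. \<exists>u v. u < v \<and> K = {u..v} \<and> P u v"
    proof
      fix K assume K: "K \<in> D"
      obtain i where "i \<in> I" "K = {fst i..snd i}"
        using K C(2) unfolding D_def cb by blast
      then show "\<exists>u v. u < v \<and> K = {u..v} \<and> P u v"
        unfolding I_def by (intro exI[of _ "fst i"] exI[of _ "snd i"]) auto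
    qed
    have neg: "E - (\<Union>i\<in>C. cball (a i) (r i)) \<in> null_sets lebesgue"
      using C(4) negligible_iff_null_sets by blast
    then show "T \<in> lmeasurable"
      unfolding T_def using Alm by (simp add: fmeasurable.Un negligible_iff_null_sets negligible_imp_measurable)
    show "measure lebesgue T < \<epsilon>"
      unfolding T_def using n Am neg by (simp add: measure_Un_null_set)
    show "E \<subseteq> \<Union>D \<union> T"
    proof
      fix x assume "x \<in> E"
      then consider "x \<in> T" | i where "i \<in> C" "x \<in> cball (a i) (r i)"
        unfolding T_def by blast
      then show "x \<in> \<Union>D \<union> T"
      proof cases
        case 2
        then show ?thesis
          unfolding D_def T_def A_def using leI by blast
      qed simp
    qed
  qed
qed

section \<open>Sums of increments over divisions\<close>

lemma sum_increments_division:
  fixes F :: "real \<Rightarrow> 'a::real_vector"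
  assumes "D division_of {a..b}" "a \<le> b"
  shows "(\<Sum>K\<in>D. F (Sup K) - F (Inf K)) = F b - F a"
proof -
  \<comment> \<open>Operative set functions are also evaluated on the empty interval, where
    \<open>Sup\<close> and \<open>Inf\<close> carry no information; hence the value 0 there.\<close>
  define g where "g K = (if K = {} then 0 else F (Sup K) - F (Inf K))" for K :: "real set"
  interpret operative_real "(+)" "0::'a" g
    rewrites "comm_monoid_set.F (+) (0::'a) = sum"
    by standard[1] (auto simp add: g_def sum_def)
  have "(\<Sum>K\<in>D. F (Sup K) - F (Inf K)) = sum g D"
    using assms by (intro sum.cong) (auto simp: g_def)
  also have "\<dots> = g (cbox a b)"
    using division[of D a b] assms by simp
  finally show ?thesis
    using assms by (simp add: g_def)
qed

text \<open>Both divisions are completed by the same intervals \<open>q - p\<close> to divisions of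
  one large interval, where increments telescope; the common part cancels.\<close>

lemma sum_increments_division_unique:
  fixes F :: "real \<Rightarrow> 'a::real_vector"
  assumes p: "p division_of S" and r: "r division_of S"
  shows "(\<Sum>K\<in>p. F (Sup K) - F (Inf K)) = (\<Sum>K\<in>r. F (Sup K) - F (Inf K))"
proof -
  let ?g = "\<lambda>K. F (Sup K) - F (Inf K)"
  obtain a b where ab: "S \<subseteq> cbox a b"
    using elementary_subset_cbox[OF p] by auto
  \<comment> \<open>\<open>S\<close> may be empty, and \<open>cbox a b\<close> with it;
    \<open>max a b\<close> keeps the enclosing interval nonempty.\<close>
  have ab': "S \<subseteq> {a..max a b}"
    using ab by auto
  obtain q where q: "p \<subseteq> q" "q division_of {a..max a b}"
    using partial_division_extend_interval[of p a "max a b"] p ab'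
    by (metis box_real(2) division_ofD(6))
  note fin = division_of_finite[OF p] division_of_finite[OF q(2)] division_of_finite[OF r]
  have d1: "(q - p) division_of \<Union>(q - p)"
    using q by (meson Diff_subset division_of_subset division_of_union_self)
  have disj: "interior S \<inter> interior (\<Union>(q - p)) = {}"
  proof -
    have pq: "interior K \<inter> interior K' = {}" if "K \<in> p" "K' \<in> q - p" for K K'
      using that q division_ofD(5)[OF q(2), of K K'] by auto
    have box: "\<exists>a b. K = cbox a b" if "K \<in> q" for K
      using that division_ofD(4)[OF q(2)] by blast
    have "interior K' \<inter> interior (\<Union>p) = {}" if "K' \<in> q - p" for K'
      using pq that q box fin by (intro Int_interior_Union_intervals) auto
    then have "interior (\<Union>p) \<inter> interior (\<Union>(q - p)) = {}"
      using q box fin by (intro Int_interior_Union_intervals) (auto simp: Int_commute)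
    then show ?thesis using division_ofD(6)[OF p] by simp
  qed
  have d2: "(r \<union> (q - p)) division_of (S \<union> \<Union>(q - p))"
    by (rule division_disjoint_union[OF r d1 disj])
  have "S \<union> \<Union>(q - p) = {a..max a b}"
    using p q division_ofD(6)[OF p] division_ofD(6)[OF q(2)] by blast
  then have "sum ?g (r \<union> (q - p)) = sum ?g q"
    using d2 q by (simp add: sum_increments_division)
  \<comment> \<open>A member of \<open>r\<close> can recur in \<open>q - p\<close> only as a single
    point, whose increment is zero.\<close>
  moreover have "sum ?g (r \<inter> (q - p)) = 0"
  proof (rule sum.neutral, rule ballI)
    fix K assume K: "K \<in> r \<inter> (q - p)"
    then obtain u v where uv: "K = cbox u v" "K \<noteq> {}"
      using r by blast
    have "interior K \<subseteq> interior S" "interior K \<subseteq> interior (\<Union>(q - p))"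
      using K r by (auto intro!: interior_mono)
    then have "box u v = {}"
      using disj uv interior_cbox by fastforce
    then show "?g K = 0"
      using uv by (cases "u = v") auto
  qed
  ultimately have "sum ?g r + sum ?g (q - p) = sum ?g q"
    using sum.union_inter[OF fin(3), of "q - p" ?g] fin by simp
  also have "\<dots> = sum ?g p + sum ?g (q - p)"
    unfolding sum.subset_diff[OF q(1) fin(2)] by (rule add.commute)
  finally show ?thesis by simp
qed

lemma measure_division:
  assumes "D division_of (S::real set)"
  shows "measure lebesgue S = (\<Sum>K\<in>D. measure lborel K)"
proof -
  have "(\<Sum>K\<in>D. measure lborel K) = (\<Sum>K\<in>D. measure lebesgue K)"
    using assms by (intro sum.cong) (auto simp: measure_completion)
  then show ?thesis
    using content_division assms by metis
qed

lemma abs_continuous_on_subset: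
  "abs_continuous_on S F \<Longrightarrow> T \<subseteq> S \<Longrightarrow> abs_continuous_on T F"
  unfolding abs_continuous_on_def by (meson subset_trans)

lemma abs_continuous_onE:
  assumes "abs_continuous_on S F" "\<epsilon> > 0"
  obtains \<delta> where "\<delta> > 0"
    "\<And>D. D division_of \<Union>D \<Longrightarrow> \<Union>D \<subseteq> S \<Longrightarrow> measure lebesgue (\<Union>D) < \<delta> \<Longrightarrow>
       (\<Sum>K\<in>D. norm (F (Sup K) - F (Inf K))) < \<epsilon>"
  using assms unfolding abs_continuous_on_def by (metis measure_division)

text \<open>Extending \<open>D\<close> to a division of the larger union adds intervals of total
  length below \<delta>, so absolute continuity bounds their increments. Nested sets of nearly equal
  measure thus have nearly equal total increments, whatever divisions are chosen.\<close>

lemma abs_continuous_on_nested_divisions: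
  fixes F :: "real \<Rightarrow> 'a::real_normed_vector"
  assumes "abs_continuous_on S F" "\<epsilon> > 0"
  obtains \<delta> where "\<delta> > 0"
    "\<And>C D. C division_of \<Union>C \<Longrightarrow> D division_of \<Union>D \<Longrightarrow> \<Union>D \<subseteq> \<Union>C \<Longrightarrow> \<Union>C \<subseteq> S \<Longrightarrow>
       measure lebesgue (\<Union>C) - measure lebesgue (\<Union>D) < \<delta> \<Longrightarrow>
       norm ((\<Sum>K\<in>C. F (Sup K) - F (Inf K)) - (\<Sum>K\<in>D. F (Sup K) - F (Inf K))) < \<epsilon>"
proof -
  obtain \<delta> where \<delta>: "\<delta> > 0"
    "\<And>D. D division_of \<Union>D \<Longrightarrow> \<Union>D \<subseteq> S \<Longrightarrow> measure lebesgue (\<Union>D) < \<delta> \<Longrightarrow>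
       (\<Sum>K\<in>D. norm (F (Sup K) - F (Inf K))) < \<epsilon>"
    using abs_continuous_onE[OF assms] by blast
  let ?g = "\<lambda>K. F (Sup K) - F (Inf K)"
  show thesis
  proof (rule that[OF \<delta>(1)])
    fix C D :: "real set set"
    assume C: "C division_of \<Union>C" and D: "D division_of \<Union>D" and sub: "\<Union>D \<subseteq> \<Union>C" "\<Union>C \<subseteq> S"
      and m: "measure lebesgue (\<Union>C) - measure lebesgue (\<Union>D) < \<delta>"
    obtain r where r: "D \<subseteq> r" "r division_of \<Union>C"
      using partial_division_extend[OF D C sub(1)] by blast
    note fin = division_of_finite[OF r(2)]
    have rD: "(r - D) division_of \<Union>(r - D)"
      using division_of_subset[of r "r - D"] r(2) by blast
    have "measure lebesgue (\<Union>(r - D)) = (\<Sum>K\<in>r. measure lborel K) - (\<Sum>K\<in>D. measure lborel K)"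
      unfolding measure_division[OF rD] by (rule sum_diff[OF fin r(1)])
    also have "\<dots> < \<delta>"
      using m unfolding measure_division[OF r(2)] measure_division[OF D] .
    finally have less: "measure lebesgue (\<Union>(r - D)) < \<delta>" .
    have "\<Union>(r - D) \<subseteq> S"
      using division_ofD(6)[OF r(2)] sub(2) by blast
    then have "(\<Sum>K\<in>r - D. norm (?g K)) < \<epsilon>"
      using \<delta>(2)[OF rD _ less] by blast
    moreover have "sum ?g C - sum ?g D = sum ?g (r - D)"
      unfolding sum_increments_division_unique[OF C r(2), of F] by (rule sum_diff[OF fin r(1), symmetric])
    ultimately show "norm (sum ?g C - sum ?g D) < \<epsilon>"
      using norm_sum[of ?g "r - D"] by simp
  qed
qed

section \<open>Differentiability almost everywhere\<close>

text \<open>The set of points where derivates cross is not known to be measurable. The hull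
  \<open>M\<close> stands in for its outer measure: a measurable cover of \<open>E\<close> cannot
  have smaller measure than \<open>M\<close>.\<close>

lemma lmeasurable_hull:
  assumes "bounded (E :: real set)"
  obtains M where "M \<in> lmeasurable" "E \<subseteq> M"
    "\<And>T. T \<in> lmeasurable \<Longrightarrow> E \<subseteq> T \<Longrightarrow> measure lebesgue M \<le> measure lebesgue T"
proof -
  obtain M where M: "M \<in> sets lebesgue" "E \<subseteq> M" "outer_measure_of lebesgue E = emeasure lebesgue M"
    using outer_measure_of_attain[of E lebesgue] by auto
  obtain a b where ab: "E \<subseteq> cbox a b"
    using assms bounded_subset_cbox_symmetric by blast
  have le: "emeasure lebesgue M \<le> emeasure lebesgue T" if "T \<in> lmeasurable" "E \<subseteq> T" for T
    using outer_measure_of_mono[OF that(2), of lebesgue] M(3) that(1) by simp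
  have "emeasure lebesgue M < \<infinity>"
    using le[OF lmeasurable_cbox ab] fmeasurableD2[OF lmeasurable_cbox, of a b]
    by (metis infinity_ennreal_def leD less_top)
  then have "M \<in> lmeasurable"
    using M(1) by (auto simp: fmeasurable_def)
  moreover have "measure lebesgue M \<le> measure lebesgue T" if "T \<in> lmeasurable" "E \<subseteq> T" for T
    using le[OF that] \<open>M \<in> lmeasurable\<close> that(1) by (simp add: emeasure_eq_measure2)
  ultimately show thesis
    using that M(2) by blast
qed

text \<open>Cover the set by intervals with slope below \<open>p\<close>, then, inside these, by intervals with slope
  above \<open>q\<close>. Both families have nearly the measure of the set, so by absolute continuity their
  total increments nearly agree, although they differ by about \<open>q - p\<close> times that measure.\<close>

lemma negligible_crossing_derivates:
  fixes F :: "real \<Rightarrow> real"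
  assumes F: "abs_continuous_on {a..b} F" and pq: "p < q"
  shows "negligible {x\<in>{a<..<b}.
    (\<forall>d>0. \<exists>u v. u < v \<and> x \<in> {u..v} \<and> v - u < d \<and> F v - F u < p * (v - u)) \<and>
    (\<forall>d>0. \<exists>u v. u < v \<and> x \<in> {u..v} \<and> v - u < d \<and> F v - F u > q * (v - u))}" (is "negligible ?E")
proof (rule ccontr)
  define E where "E = ?E"
  have Ep: "\<exists>u v. u < v \<and> x \<in> {u..v} \<and> v - u < d \<and> F v - F u < p * (v - u)"
    and Eq: "\<exists>u v. u < v \<and> x \<in> {u..v} \<and> v - u < d \<and> F v - F u > q * (v - u)"
    if "x \<in> E" "0 < d" for x d
    using that by (auto simp: E_def)
  have Eab: "E \<subseteq> {a<..<b}"
    by (auto simp: E_def)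
  let ?\<mu> = "measure lebesgue"
  let ?g = "\<lambda>K. F (Sup K) - F (Inf K)"
  assume "\<not> negligible ?E"
  then have nonneg: "\<not> negligible E"
    by (simp add: E_def)
  have bE: "bounded E"
    by (rule bounded_subset[OF bounded_box Eab[folded box_real(1)]])
  obtain M where M: "M \<in> lmeasurable" "E \<subseteq> M"
    "\<And>T. T \<in> lmeasurable \<Longrightarrow> E \<subseteq> T \<Longrightarrow> ?\<mu> M \<le> ?\<mu> T"
    using lmeasurable_hull[OF bE] by blast
  have "?\<mu> M \<noteq> 0"
    using nonneg M(1) negligible_subset[OF _ M(2)] by (auto simp: negligible_iff_measure)
  then have m: "?\<mu> M > 0"
    using measure_nonneg[of lebesgue M] by linarith
  \<comment> \<open>A quarter of the difference forced between the two total increments; the final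
    contradiction reads
    \<open>4 * \<eta> < \<eta> + c * \<epsilon> \<le> 3 * \<eta>\<close>.\<close>
  define \<eta> where "\<eta> = (q - p) * ?\<mu> M / 4"
  have \<eta>: "\<eta> > 0"
    using pq m by (simp add: \<eta>_def)
  obtain \<delta> where \<delta>: "\<delta> > 0"
    "\<And>C D. C division_of \<Union>C \<Longrightarrow> D division_of \<Union>D \<Longrightarrow> \<Union>D \<subseteq> \<Union>C \<Longrightarrow> \<Union>C \<subseteq> {a..b} \<Longrightarrow>
       ?\<mu> (\<Union>C) - ?\<mu> (\<Union>D) < \<delta> \<Longrightarrow> norm (sum ?g C - sum ?g D) < \<eta>"
    using abs_continuous_on_nested_divisions[OF F \<eta>] by blast
  \<comment> \<open>\<open>c * \<epsilon>\<close> collects the losses: \<open>\<Union>D\<close> may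
    fall short of \<open>M\<close> by \<open>2 * \<epsilon>\<close>, weighted with
    \<open>q - p\<close>, and \<open>\<Union>C\<close> may exceed \<open>\<Union>D\<close> by
    \<open>3 * \<epsilon>\<close>, weighted with \<open>\<bar>p\<bar>\<close>.\<close>
  define c where "c = 2 * (q - p) + 3 * \<bar>p\<bar>"
  have c: "c > 0"
    using pq by (simp add: c_def)
  define \<epsilon> where "\<epsilon> = min (2 * \<eta> / c) (\<delta> / 3)"
  have \<epsilon>: "\<epsilon> > 0" "c * \<epsilon> \<le> 2 * \<eta>" "3 * \<epsilon> \<le> \<delta>"
    using \<eta> \<delta>(1) c by (auto simp: \<epsilon>_def min_def field_simps)
  obtain U0 where U0: "open U0" "M \<subseteq> U0" "U0 \<in> lmeasurable" "?\<mu> U0 < ?\<mu> M + \<epsilon>"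
  proof -
    obtain U0 where U0: "open U0" "M \<subseteq> U0" "U0 - M \<in> lmeasurable" "emeasure lebesgue (U0 - M) < ennreal \<epsilon>"
      using sets_lebesgue_outer_open[OF fmeasurableD[OF M(1)] \<epsilon>(1)] by blast
    have eq: "U0 = M \<union> (U0 - M)"
      using U0(2) by blast
    have "U0 \<in> lmeasurable"
      by (subst eq) (intro fmeasurable.Un M(1) U0(3))
    moreover have "?\<mu> U0 \<le> ?\<mu> M + ?\<mu> (U0 - M)"
      using measure_Un_le[of M lebesgue "U0 - M"] M(1) U0(3) eq by auto
    moreover have "?\<mu> (U0 - M) < \<epsilon>"
      using U0(3,4) \<epsilon>(1) by (simp add: emeasure_eq_measure2 ennreal_less_iff)
    ultimately show ?thesis
      using that U0(1,2) by simp
  qed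
  define U where "U = U0 \<inter> {a<..<b}"
  have U: "open U" "U \<in> lmeasurable" "E \<subseteq> U" "U \<subseteq> {a..b}"
    using U0 M(2) Eab unfolding U_def by (auto intro!: fmeasurable.Int)
  have U\<mu>: "?\<mu> U < ?\<mu> M + \<epsilon>"
    using measure_mono_fmeasurable[of U U0 lebesgue] U0 U by (auto simp: U_def)
  obtain C T1 where C: "C division_of \<Union>C" "\<Union>C \<subseteq> U"
    "\<forall>K\<in>C. \<exists>u v. u < v \<and> K = {u..v} \<and> F v - F u < p * (v - u)"
    "T1 \<in> lmeasurable" "?\<mu> T1 < \<epsilon>" "E \<subseteq> \<Union>C \<union> T1"
    by (rule Vitali_finite_subcover[OF U(1-3) \<epsilon>(1) Ep])
  \<comment> \<open>The second cover must live in an open set, so the interior of the first union is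
    used; it loses only the finitely many endpoints \<open>N\<close>.\<close>
  define V where "V = interior (\<Union>C)"
  have V: "open V" "V \<in> lmeasurable"
    unfolding V_def using C(1) by (auto intro!: lmeasurable_interior elementary_bounded)
  obtain D T2 where D: "D division_of \<Union>D" "\<Union>D \<subseteq> V"
    "\<forall>K\<in>D. \<exists>u v. u < v \<and> K = {u..v} \<and> F v - F u > q * (v - u)"
    "T2 \<in> lmeasurable" "?\<mu> T2 < \<epsilon>" "E \<inter> V \<subseteq> \<Union>D \<union> T2"
    by (rule Vitali_finite_subcover[OF V Int_lower2 \<epsilon>(1) Eq[OF IntD1]])
  have meas: "\<Union>C \<in> lmeasurable" "\<Union>D \<in> lmeasurable"
    using C(1) D(1) lmeasurable_division by blast+
  define N where "N = Inf ` C \<union> Sup ` C"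
  have N: "N \<in> lmeasurable" "?\<mu> N = 0"
    using C(1) negligible_finite[of N] negligible_imp_measurable negligible_imp_measure0
    unfolding N_def by blast+
  have "\<Union>C \<subseteq> V \<union> N"
  proof
    fix x assume "x \<in> \<Union>C"
    then obtain K u v where K: "x \<in> K" "K \<in> C" "u < v" "K = {u..v}"
      using C(3) by blast
    have "{u<..<v} \<subseteq> V"
      unfolding V_def using K by (intro interior_maximal) auto
    moreover have "u \<in> N" "v \<in> N"
      unfolding N_def using K by force+
    ultimately show "x \<in> V \<union> N"
      using K by (cases "x = u"; cases "x = v") auto
  qed
  then have "E \<subseteq> \<Union>D \<union> (T1 \<union> (T2 \<union> N))"
    using C(6) D(6) by blast
  then have "?\<mu> M \<le> ?\<mu> (\<Union>D \<union> (T1 \<union> (T2 \<union> N)))"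
    using meas C(4) D(4) N by (intro M(3)) auto
  also have "\<dots> \<le> ?\<mu> (\<Union>D) + ?\<mu> (T1 \<union> (T2 \<union> N))"
    using meas C(4) D(4) N by (intro measure_Un_le) auto
  also have "?\<mu> (T1 \<union> (T2 \<union> N)) \<le> ?\<mu> T1 + ?\<mu> (T2 \<union> N)"
    using C(4) D(4) N by (intro measure_Un_le) auto
  also have "?\<mu> (T2 \<union> N) \<le> ?\<mu> T2 + ?\<mu> N"
    using D(4) N by (intro measure_Un_le) auto
  finally have mD: "?\<mu> M - 2 * \<epsilon> < ?\<mu> (\<Union>D)"
    using C(5) D(5) N by simp
  have mC: "?\<mu> (\<Union>C) < ?\<mu> M + \<epsilon>"
    using measure_mono_fmeasurable[OF C(2) _ U(2)] meas U\<mu> by auto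
  have DC: "\<Union>D \<subseteq> \<Union>C"
    using D(2) interior_subset unfolding V_def by blast
  then have mDC: "?\<mu> (\<Union>D) \<le> ?\<mu> (\<Union>C)"
    using meas by (intro measure_mono_fmeasurable) auto
  have "norm (sum ?g C - sum ?g D) < \<eta>"
    using \<delta>(2)[OF C(1) D(1) DC] C(2) U(4) mD mC \<epsilon>(3) by auto
  moreover have "sum ?g C \<le> p * ?\<mu> (\<Union>C)"
    unfolding measure_division[OF C(1)] sum_distrib_left
    using C(3) by (intro sum_mono) (fastforce intro: less_imp_le)
  moreover have "q * ?\<mu> (\<Union>D) \<le> sum ?g D"
    unfolding measure_division[OF D(1)] sum_distrib_left
    using D(3) by (intro sum_mono) (fastforce intro: less_imp_le)
  ultimately have "q * ?\<mu> (\<Union>D) - p * ?\<mu> (\<Union>C) < \<eta>"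
    by (simp add: abs_less_iff)
  moreover have "(q - p) * (?\<mu> M - 2 * \<epsilon>) \<le> (q - p) * ?\<mu> (\<Union>D)"
    using mD pq by (intro mult_left_mono) auto
  moreover have "p * (?\<mu> (\<Union>C) - ?\<mu> (\<Union>D)) \<le> \<bar>p\<bar> * (3 * \<epsilon>)"
    using mD mC mDC by (intro mult_mono) auto
  ultimately have "(q - p) * ?\<mu> M < \<eta> + c * \<epsilon>"
    unfolding c_def by (simp add: algebra_simps)
  then show False
    using \<epsilon>(2) \<eta> unfolding \<eta>_def by linarith
qed

text \<open>Where slopes are unbounded, cover by intervals with absolute slope above
  \<open>2 / e\<close>. If they have total length below \<delta>, their increments sum to less than
  1, so the total length is in fact at most \<open>e / 2\<close>; the remainder of the cover
  contributes the other half.\<close>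

lemma negligible_unbounded_derivates:
  fixes F :: "real \<Rightarrow> real"
  assumes F: "abs_continuous_on {a..b} F"
  shows "negligible {x\<in>{a<..<b}.
    \<forall>M. \<forall>d>0. \<exists>u v. u < v \<and> x \<in> {u..v} \<and> v - u < d \<and> \<bar>F v - F u\<bar> > M * (v - u)}" (is "negligible ?E")
proof -
  let ?\<mu> = "measure lebesgue"
  define E where "E = ?E"
  have EM: "\<exists>u v. u < v \<and> x \<in> {u..v} \<and> v - u < d \<and> \<bar>F v - F u\<bar> > M * (v - u)"
    if "x \<in> E" "0 < d" for x d M
    using that unfolding E_def by blast
  have Eab: "E \<subseteq> {a<..<b}"
    by (auto simp: E_def)
  obtain \<delta> where \<delta>: "\<delta> > 0"
    "\<And>D. D division_of \<Union>D \<Longrightarrow> \<Union>D \<subseteq> {a..b} \<Longrightarrow> ?\<mu> (\<Union>D) < \<delta> \<Longrightarrow>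
       (\<Sum>K\<in>D. norm (F (Sup K) - F (Inf K))) < 1"
    using abs_continuous_onE[OF F zero_less_one] by blast
  \<comment> \<open>A ball of radius \<open>\<delta> / 3\<close> has length below \<delta>, as
    absolute continuity requires of the union of the intervals. Negligibility is a local property,
    so small balls suffice.\<close>
  have "negligible (E \<inter> ball x (\<delta> / 3))" for x
    unfolding negligible_outer_le
  proof (intro allI impI)
    fix e :: real assume "e > 0"
    define U where "U = {a<..<b} \<inter> ball x (\<delta> / 3)"
    have U: "open U" "U \<in> lmeasurable" "E \<inter> ball x (\<delta> / 3) \<subseteq> U" "U \<subseteq> {a..b}"
      using Eab unfolding U_def by (auto intro!: fmeasurable.Int)
    obtain D T where D: "D division_of \<Union>D" "\<Union>D \<subseteq> U"
      "\<forall>K\<in>D. \<exists>u v. u < v \<and> K = {u..v} \<and> \<bar>F v - F u\<bar> > (2 / e) * (v - u)"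
      "T \<in> lmeasurable" "?\<mu> T < e / 2" "E \<inter> ball x (\<delta> / 3) \<subseteq> \<Union>D \<union> T"
      by (rule Vitali_finite_subcover[OF U(1-3) half_gt_zero[OF \<open>e > 0\<close>] EM[of _ _ "2 / e", OF IntD1]])
    have Dm: "\<Union>D \<in> lmeasurable"
      using D(1) lmeasurable_division by blast
    have "?\<mu> (\<Union>D) \<le> ?\<mu> (ball x (\<delta> / 3))"
      using D(2) Dm unfolding U_def by (intro measure_mono_fmeasurable) auto
    also have "\<dots> < \<delta>"
      using \<delta>(1) by (simp add: ball_eq_greaterThanLessThan)
    finally have "(\<Sum>K\<in>D. norm (F (Sup K) - F (Inf K))) < 1"
      using \<delta>(2)[OF D(1)] D(2) U(4) by auto
    moreover have "(2 / e) * ?\<mu> (\<Union>D) \<le> (\<Sum>K\<in>D. norm (F (Sup K) - F (Inf K)))"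
      unfolding measure_division[OF D(1)] sum_distrib_left
      using D(3) by (intro sum_mono) (fastforce intro: less_imp_le)
    ultimately have "(2 / e) * ?\<mu> (\<Union>D) \<le> 1"
      by linarith
    then have "?\<mu> (\<Union>D) \<le> e / 2"
      using \<open>e > 0\<close> by (simp add: field_simps)
    then have "?\<mu> (\<Union>D \<union> T) \<le> e"
      using measure_Un_le[of "\<Union>D" lebesgue T] Dm D(4,5) by auto
    then show "\<exists>T. E \<inter> ball x (\<delta> / 3) \<subseteq> T \<and> T \<in> lmeasurable \<and> ?\<mu> T \<le> e"
      using D(4,6) Dm by blast
  qed
  moreover have "x \<in> ball x (\<delta> / 3)" for x
    using \<delta>(1) by simp
  ultimately have "negligible E"
    unfolding locally_negligible_alt[of E] by (meson IntI Int_commute openin_open open_ball)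
  then show ?thesis
    unfolding E_def .
qed

text \<open>Derivates are taken over short intervals containing \<open>x\<close>. Off the two
  exceptional sets they are finite and no pair of rationals separates the lower from the upper one;
  their common value is the derivative.\<close>

lemma abs_continuous_differentiable_real:
  fixes F :: "real \<Rightarrow> real"
  assumes F: "abs_continuous_on {a..b} F"
  shows "negligible {x\<in>{a<..<b}. \<not> F differentiable (at x)}"
proof -
  \<comment> \<open>\<open>lo p x\<close> holds when the lower derivate at \<open>x\<close> is below
    \<open>p\<close> and fails when it is above \<open>p\<close>; \<open>hi q x\<close> mirrors this
    for the upper derivate. An endpoint of the interval may be \<open>x\<close> itself, so ordinary
    difference quotients are included.\<close>
  define W where "W P x \<longleftrightarrow> (\<forall>d>0. \<exists>u v. u < v \<and> x \<in> {u..v} \<and> v - u < d \<and> P u v)"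
    for P :: "real \<Rightarrow> real \<Rightarrow> bool" and x
  define lo where "lo p = W (\<lambda>u v. F v - F u < p * (v - u))" for p
  define hi where "hi q = W (\<lambda>u v. F v - F u > q * (v - u))" for q
  define X where "X = {x\<in>{a<..<b}. \<forall>M. W (\<lambda>u v. \<bar>F v - F u\<bar> > M * (v - u)) x}"
  define Y where "Y = (\<lambda>(p, q). {x\<in>{a<..<b}. lo p x \<and> hi q x}) ` {(p, q). p \<in> \<rat> \<and> q \<in> \<rat> \<and> p < q}"
  have negX: "negligible X"
    using negligible_unbounded_derivates[OF F] unfolding X_def W_def .
  have negY: "negligible (\<Union>Y)"
  proof (rule negligible_countable_Union)
    have "countable (\<rat> \<times> \<rat> :: (real \<times> real) set)"
      by (intro countable_SIGMA countable_rat)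
    then have "countable {(p, q). p \<in> \<rat> \<and> q \<in> \<rat> \<and> p < (q::real)}"
      by (rule countable_subset[rotated]) auto
    then show "countable Y"
      unfolding Y_def by (rule countable_image)
    fix S assume "S \<in> Y"
    then obtain p q where "p < q" "S = {x\<in>{a<..<b}. lo p x \<and> hi q x}"
      unfolding Y_def by blast
    then show "negligible S"
      using negligible_crossing_derivates[OF F, of p q] unfolding lo_def hi_def W_def by simp
  qed
  have diff: "F differentiable (at x)" if x: "x \<in> {a<..<b}" "x \<notin> X" "x \<notin> \<Union>Y" for x
  proof -
    obtain M where "\<not> W (\<lambda>u v. \<bar>F v - F u\<bar> > M * (v - u)) x"
      using x(1,2) unfolding X_def mem_Collect_eq by auto
    then obtain d where d: "d > 0"
      "\<And>u v. u < v \<Longrightarrow> x \<in> {u..v} \<Longrightarrow> v - u < d \<Longrightarrow> \<bar>F v - F u\<bar> \<le> M * (v - u)"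
      unfolding W_def by (meson not_less)
    have lo_mono: "lo p' x" if lop: "lo p x" and pp: "p \<le> p'" for p p'
      unfolding lo_def W_def
    proof (intro allI impI)
      fix d :: real assume "d > 0"
      then obtain u v where "u < v" "x \<in> {u..v}" "v - u < d" "F v - F u < p * (v - u)"
        using lop unfolding lo_def W_def by blast
      moreover have "p * (v - u) \<le> p' * (v - u)" if "u < v"
        using that pp by (intro mult_right_mono) auto
      ultimately show "\<exists>u v. u < v \<and> x \<in> {u..v} \<and> v - u < d \<and> F v - F u < p' * (v - u)"
        by (meson less_le_trans)
    qed
    have lo_big: "lo p x" if "p > M" for p
      unfolding lo_def W_def
    proof (intro allI impI)
      fix e :: real assume "e > 0"
      define v where "v = x + min d e / 2"
      have v: "x < v" "v - x < d" "v - x < e"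
        using \<open>e > 0\<close> \<open>d > 0\<close> by (auto simp: v_def min_def)
      have "F v - F x \<le> M * (v - x)"
        using d(2)[of x v] v by auto
      also have "\<dots> < p * (v - x)"
        using v that by simp
      finally show "\<exists>u v. u < v \<and> x \<in> {u..v} \<and> v - u < e \<and> F v - F u < p * (v - u)"
        using v by (intro exI[of _ x] exI[of _ v]) auto
    qed
    have lo_small: "p \<ge> - M" if "lo p x" for p
    proof -
      obtain u v where uv: "u < v" "x \<in> {u..v}" "v - u < d" "F v - F u < p * (v - u)"
        using \<open>lo p x\<close> d(1) unfolding lo_def W_def by blast
      then have "- M * (v - u) < p * (v - u)"
        using d(2)[of u v] by auto
      then show ?thesis
        using uv(1) mult_right_less_imp_less[of "- M" "v - u" p] by simp
    qed
    \<comment> \<open>The lower derivate at \<open>x\<close>, finite because slopes over short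
      intervals containing \<open>x\<close> lie between \<open>- M\<close> and
      \<open>M\<close>.\<close>
    define c where "c = Inf {p. lo p x}"
    have ne: "{p. lo p x} \<noteq> {}"
      using lo_big[of "M + 1"] by auto
    have bdd: "bdd_below {p. lo p x}"
      using lo_small by (auto simp: bdd_below_def)
    have up: "\<exists>d>0. \<forall>u v. u < v \<longrightarrow> x \<in> {u..v} \<longrightarrow> v - u < d \<longrightarrow> F v - F u \<le> (c + e) * (v - u)"
      if e: "e > 0" for e
    proof -
      \<comment> \<open>A rational \<open>p\<close> slightly above \<open>c\<close> satisfies
        \<open>lo p x\<close>; as \<open>x\<close> avoids the crossing sets, \<open>hi q x\<close>
        must fail for a rational \<open>q\<close> between \<open>p\<close> and \<open>c + e\<close>,
        which bounds the slopes from above.\<close>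
      obtain p where p: "p \<in> \<rat>" "c < p" "p < c + e / 2"
        using Rats_dense_in_real[of c "c + e / 2"] e by auto
      obtain q where q: "q \<in> \<rat>" "p < q" "q < c + e"
        using Rats_dense_in_real[of p "c + e"] p e by auto
      obtain p0 where "lo p0 x" "p0 < p"
        using p(2) cInf_less_iff[OF ne bdd] unfolding c_def by auto
      then have "lo p x"
        using lo_mono by auto
      then have "\<not> hi q x"
        using x(1,3) p(1) q(1,2) unfolding Y_def by blast
      then obtain d where d: "d > 0"
        "\<And>u v. u < v \<Longrightarrow> x \<in> {u..v} \<Longrightarrow> v - u < d \<Longrightarrow> F v - F u \<le> q * (v - u)"
        unfolding hi_def W_def by (meson not_less)
      have "F v - F u \<le> (c + e) * (v - u)" if "u < v" "x \<in> {u..v}" "v - u < d" for u v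
      proof -
        have "q * (v - u) \<le> (c + e) * (v - u)"
          using q(3) that(1) by (intro mult_right_mono) auto
        then show ?thesis
          using d(2)[OF that] by linarith
      qed
      then show ?thesis
        using d(1) by blast
    qed
    have down: "\<exists>d>0. \<forall>u v. u < v \<longrightarrow> x \<in> {u..v} \<longrightarrow> v - u < d \<longrightarrow> (c - e) * (v - u) \<le> F v - F u"
      if "e > 0" for e
    proof -
      have "\<not> lo (c - e) x"
        using cInf_lower[OF _ bdd, of "c - e"] that unfolding c_def by auto
      then show ?thesis
        unfolding lo_def W_def by (meson not_less)
    qed
    have "(F has_derivative (\<lambda>h. h * c)) (at x)"
      unfolding has_derivative_within_alt
    proof (intro conjI allI impI)
      fix e :: real assume e: "0 < e"
      obtain d1 where d1: "d1 > 0"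
        "\<And>u v. u < v \<Longrightarrow> x \<in> {u..v} \<Longrightarrow> v - u < d1 \<Longrightarrow> F v - F u \<le> (c + e) * (v - u)"
        using up[OF e] by blast
      obtain d2 where d2: "d2 > 0"
        "\<And>u v. u < v \<Longrightarrow> x \<in> {u..v} \<Longrightarrow> v - u < d2 \<Longrightarrow> (c - e) * (v - u) \<le> F v - F u"
        using down[OF e] by blast
      have key: "\<bar>F v - F u - (v - u) * c\<bar> \<le> e * (v - u)"
        if "u < v" "x \<in> {u..v}" "v - u < min d1 d2" for u v
        using d1(2)[of u v] d2(2)[of u v] that by (simp add: abs_le_iff algebra_simps)
      have "norm (F y - F x - (y - x) * c) \<le> e * norm (y - x)" if y: "norm (y - x) < min d1 d2" for y
      proof (cases x y rule: linorder_cases)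
        case less
        then show ?thesis
          using key[of x y] y by auto
      next
        case greater
        have "\<bar>F y - F x - (y - x) * c\<bar> = \<bar>F x - F y - (x - y) * c\<bar>"
          by (simp add: abs_if algebra_simps)
        then show ?thesis
          using key[of y x] y greater by auto
      qed simp
      then show "\<exists>d>0. \<forall>y\<in>UNIV. norm (y - x) < d \<longrightarrow> norm (F y - F x - (y - x) * c) \<le> e * norm (y - x)"
        using d1(1) d2(1) by (intro exI[of _ "min d1 d2"]) auto
    qed (rule bounded_linear_mult_left)
    then show ?thesis
      unfolding differentiable_def by blast
  qed
  show ?thesis
    using diff by (intro negligible_subset[OF negligible_Un[OF negX negY]] subsetI) auto
qed

lemma abs_continuous_on_bounded_linear:
  assumes "abs_continuous_on S F" "bounded_linear T"
  shows "abs_continuous_on S (\<lambda>x. T (F x))"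
  unfolding abs_continuous_on_def
proof (intro allI impI)
  fix \<epsilon> :: real assume "\<epsilon> > 0"
  obtain B where B: "B > 0" "\<And>x. norm (T x) \<le> norm x * B"
    using bounded_linear.pos_bounded[OF assms(2)] by blast
  obtain \<delta> where \<delta>: "\<delta> > 0"
    "\<And>D. D division_of \<Union>D \<Longrightarrow> \<Union>D \<subseteq> S \<Longrightarrow> measure lebesgue (\<Union>D) < \<delta> \<Longrightarrow>
        (\<Sum>K\<in>D. norm (F (Sup K) - F (Inf K))) < \<epsilon> / B"
    using abs_continuous_onE[OF assms(1) divide_pos_pos[OF \<open>\<epsilon> > 0\<close> B(1)]] by blast
  have "(\<Sum>K\<in>D. norm (T (F (Sup K)) - T (F (Inf K)))) < \<epsilon>"
    if D: "D division_of \<Union>D \<and> \<Union>D \<subseteq> S \<and> (\<Sum>K\<in>D. measure lborel K) < \<delta>" for D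
  proof -
    have "(\<Sum>K\<in>D. norm (T (F (Sup K)) - T (F (Inf K)))) \<le> (\<Sum>K\<in>D. norm (F (Sup K) - F (Inf K)) * B)"
      using B(2) by (intro sum_mono) (simp add: bounded_linear.linear[OF assms(2)] flip: linear_diff)
    also have "\<dots> < \<epsilon>"
      using \<delta>(2)[of D] D B(1) measure_division[of D "\<Union>D"] by (simp add: pos_less_divide_eq flip: sum_distrib_right)
    finally show ?thesis .
  qed
  then show "\<exists>\<delta>>0. \<forall>D. D division_of \<Union>D \<and> \<Union>D \<subseteq> S \<and> (\<Sum>K\<in>D. measure lborel K) < \<delta> \<longrightarrow>
      (\<Sum>K\<in>D. norm (T (F (Sup K)) - T (F (Inf K)))) < \<epsilon>"
    using \<delta>(1) by blast
qed

theorem abs_continuous_differentiable: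
  fixes F :: "real \<Rightarrow> 'a::euclidean_space"
  assumes "abs_continuous_on {a..b} F"
  shows "negligible {x\<in>{a<..<b}. \<not> F differentiable (at x)}"
proof (rule negligible_subset)
  show "negligible (\<Union>i\<in>Basis. {x\<in>{a<..<b}. \<not> (\<lambda>x. F x \<bullet> i) differentiable (at x)})"
    using abs_continuous_differentiable_real[OF abs_continuous_on_bounded_linear[OF assms bounded_linear_inner_left]]
    by (intro negligible_Union finite_imageI finite_Basis) blast
qed (auto simp: differentiable_componentwise_within[of F])

section \<open>Fundamental theorem of calculus\<close>

text \<open>A gauge argument. Outside \<open>N\<close> the derivative controls each increment. A tag
  in \<open>N\<close> forces its interval into an open set of measure below \<delta>, where absolute
  continuity bounds the sum of the increments, while \<open>G\<close> makes the Riemann terms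
  vanish.\<close>

theorem fundamental_theorem_of_calculus_abs_continuous:
  fixes F :: "real \<Rightarrow> 'a::banach"
  assumes F: "abs_continuous_on {a..b} F" and "a \<le> b" and N: "negligible N"
    and F': "\<And>x. x \<in> {a..b} - N \<Longrightarrow> (F has_vector_derivative F' x) (at x within {a..b})"
  shows "(F' has_integral (F b - F a)) {a..b}"
proof -
  define G where "G x = (if x \<in> N then 0 else F' x)" for x
  let ?g = "\<lambda>K. F (Sup K) - F (Inf K)"
  have "(G has_integral (F b - F a)) {a..b}"
    unfolding has_integral_real
  proof (intro allI impI)
    fix e :: real assume e: "e > 0"
    \<comment> \<open>\<open>b - a + 1\<close> instead of \<open>b - a\<close> avoids a division by
      zero when \<open>a = b\<close>.\<close>
    define e1 where "e1 = e / (2 * (b - a + 1))"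
    have e1: "e1 > 0" "e1 * (b - a) < e / 2"
      using e \<open>a \<le> b\<close> by (auto simp: e1_def field_simps)
    obtain \<delta> where \<delta>: "\<delta> > 0"
      "\<And>D. D division_of \<Union>D \<Longrightarrow> \<Union>D \<subseteq> {a..b} \<Longrightarrow> measure lebesgue (\<Union>D) < \<delta> \<Longrightarrow>
         (\<Sum>K\<in>D. norm (?g K)) < e / 2"
      using abs_continuous_onE[OF F half_gt_zero[OF e]] by blast
    obtain U where U: "open U" "N \<subseteq> U" "U - N \<in> lmeasurable" "emeasure lebesgue (U - N) < ennreal \<delta>"
      using sets_lebesgue_outer_open[OF negligible_imp_sets[OF N] \<delta>(1)] by blast
    have Um: "U \<in> lmeasurable" "measure lebesgue U < \<delta>"
    proof -
      have U_eq: "U = (U - N) \<union> N"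
        using U(2) by blast
      have N0: "N \<in> null_sets lebesgue"
        using N negligible_iff_null_sets by blast
      show "U \<in> lmeasurable"
        by (subst U_eq) (intro fmeasurable.Un U(3) negligible_imp_measurable N)
      have "measure lebesgue U = measure lebesgue (U - N)"
        using measure_Un_null_set[OF fmeasurableD[OF U(3)] N0] U_eq by simp
      also have "\<dots> < \<delta>"
        using U(3,4) \<delta>(1) by (simp add: emeasure_eq_measure2 ennreal_less_iff)
      finally show "measure lebesgue U < \<delta>" .
    qed
    have "\<exists>d>0. x \<in> {a..b} - N \<longrightarrow>
        (\<forall>y\<in>{a..b}. norm (y - x) < d \<longrightarrow> norm (F y - F x - (y - x) *\<^sub>R F' x) \<le> e1 * norm (y - x))" for x
      using F'[of x] e1(1) unfolding has_vector_derivative_def has_derivative_within_alt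
      by (cases "x \<in> {a..b} - N") (auto intro: exI[of _ 1])
    then obtain d where d: "\<And>x. d x > 0"
      "\<And>x y. x \<in> {a..b} - N \<Longrightarrow> y \<in> {a..b} \<Longrightarrow> norm (y - x) < d x \<Longrightarrow>
         norm (F y - F x - (y - x) *\<^sub>R F' x) \<le> e1 * norm (y - x)"
      by metis
    define \<gamma> where "\<gamma> x = (if x \<in> N then U else ball x (d x))" for x
    have "gauge \<gamma>"
      unfolding gauge_def \<gamma>_def using U(1,2) d(1) by auto
    moreover have "norm ((\<Sum>(x, K)\<in>p. measure lborel K *\<^sub>R G x) - (F b - F a)) < e"
      if p: "p tagged_division_of {a..b}" "\<gamma> fine p" for p
    proof -
      define pN where "pN = {z\<in>p. fst z \<in> N}"
      have fin: "finite p"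
        using p(1) by blast
      have eq: "(\<Sum>(x, K)\<in>p. measure lborel K *\<^sub>R G x) - (F b - F a) = (\<Sum>(x, K)\<in>p. measure lborel K *\<^sub>R G x - ?g K)"
        unfolding additive_tagged_division_1[OF \<open>a \<le> b\<close> p(1), of F, symmetric]
        by (simp add: sum_subtractf case_prod_unfold)
      have good: "norm (measure lborel K *\<^sub>R G x - ?g K) \<le> e1 * measure lborel K" if xp: "(x, K) \<in> p" "x \<notin> N" for x K
      proof -
        obtain u v where K: "K = cbox u v"
          using tagged_division_ofD(4)[OF p(1) xp(1)] by blast
        have xK: "x \<in> K" "K \<subseteq> {a..b}"
          using tagged_division_ofD(2,3)[OF p(1) xp(1)] by auto
        have uv: "u \<le> x" "x \<le> v" "u \<in> {a..b}" "v \<in> {a..b}" "x \<in> {a..b} - N"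
          using xK K xp(2) by auto
        have Kb: "K \<subseteq> ball x (d x)"
          using fineD[OF p(2) xp(1)] xp(2) by (simp add: \<gamma>_def)
        have "u \<in> K" "v \<in> K"
          using K uv by auto
        then have "norm (u - x) < d x" "norm (v - x) < d x"
          using Kb by (auto simp: dist_norm norm_minus_commute)
        then have "norm (F v - F x - (v - x) *\<^sub>R F' x) \<le> e1 * (v - x)"
            "norm (F u - F x - (u - x) *\<^sub>R F' x) \<le> e1 * (x - u)"
          using d(2)[of x v] d(2)[of x u] uv by auto
        moreover have "measure lborel K *\<^sub>R G x - ?g K = (F u - F x - (u - x) *\<^sub>R F' x) - (F v - F x - (v - x) *\<^sub>R F' x)"
          using uv xp(2) unfolding K G_def by (simp add: algebra_simps)
        ultimately have "norm (measure lborel K *\<^sub>R G x - ?g K) \<le> e1 * (x - u) + e1 * (v - x)"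
          using norm_triangle_ineq4[of "F u - F x - (u - x) *\<^sub>R F' x" "F v - F x - (v - x) *\<^sub>R F' x"] by simp
        also have "\<dots> = e1 * measure lborel K"
          using uv unfolding K by (simp add: algebra_simps)
        finally show ?thesis .
      qed
      have "p tagged_partial_division_of {a..b}"
        using p(1) unfolding tagged_division_of_def by blast
      then have "pN tagged_partial_division_of {a..b}"
        by (rule tagged_partial_division_subset) (auto simp: pN_def)
      then have pNp: "pN tagged_division_of \<Union>(snd ` pN)"
        by (rule tagged_partial_division_of_Union_self)
      have pN_div: "snd ` pN division_of \<Union>(snd ` pN)"
        using division_of_tagged_division[OF pNp] .
      have "\<Union>(snd ` pN) \<subseteq> {a..b}"
        using tagged_division_ofD(3)[OF p(1)] by (fastforce simp: pN_def)
      moreover have "\<Union>(snd ` pN) \<subseteq> U"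
        using fineD[OF p(2)] by (fastforce simp: pN_def \<gamma>_def)
      then have "measure lebesgue (\<Union>(snd ` pN)) < \<delta>"
        using measure_mono_fmeasurable[of "\<Union>(snd ` pN)" U lebesgue] Um lmeasurable_division[OF pN_div] by auto
      ultimately have "(\<Sum>K\<in>snd ` pN. norm (?g K)) < e / 2"
        using \<delta>(2) pN_div by blast
      \<comment> \<open>Distinct tagged members have disjoint interiors, so an interval of positive
        length occurs once; degenerate ones contribute zero.\<close>
      moreover have "(\<Sum>(x, K)\<in>pN. norm (?g K)) = (\<Sum>K\<in>snd ` pN. norm (?g K))"
      proof -
        let ?d = "\<lambda>K. if K = {} then 0 else norm (?g K)"
        have ne: "K \<noteq> {}" if "(x, K) \<in> pN" for x K
          using tagged_division_ofD(2)[OF pNp that] by blast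
        have "(\<Sum>(x, K)\<in>pN. norm (?g K)) = (\<Sum>(x, K)\<in>pN. ?d K)"
          using ne by (intro sum.cong) auto
        also have "\<dots> = sum ?d (snd ` pN)"
          by (rule sum.over_tagged_division_lemma[OF pNp]) (auto simp: box_real antisym)
        also have "\<dots> = (\<Sum>K\<in>snd ` pN. norm (?g K))"
          using ne by (intro sum.cong) auto
        finally show ?thesis .
      qed
      ultimately have bad: "(\<Sum>(x, K)\<in>pN. norm (?g K)) < e / 2"
        by simp
      have "norm (\<Sum>(x, K)\<in>p. measure lborel K *\<^sub>R G x - ?g K) \<le> (\<Sum>(x, K)\<in>p. norm (measure lborel K *\<^sub>R G x - ?g K))"
        by (rule order_trans[OF norm_sum]) (simp add: case_prod_unfold)
      also have "\<dots> = (\<Sum>(x, K)\<in>p - pN. norm (measure lborel K *\<^sub>R G x - ?g K)) + (\<Sum>(x, K)\<in>pN. norm (measure lborel K *\<^sub>R G x - ?g K))"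
        by (rule sum.subset_diff) (auto simp: pN_def fin)
      also have "(\<Sum>(x, K)\<in>pN. norm (measure lborel K *\<^sub>R G x - ?g K)) = (\<Sum>(x, K)\<in>pN. norm (?g K))"
        by (intro sum.cong) (auto simp: pN_def G_def norm_minus_commute)
      also have "(\<Sum>(x, K)\<in>p - pN. norm (measure lborel K *\<^sub>R G x - ?g K)) \<le> (\<Sum>(x, K)\<in>p - pN. e1 * measure lborel K)"
        using good by (intro sum_mono) (auto simp: pN_def)
      also have "\<dots> \<le> (\<Sum>(x, K)\<in>p. e1 * measure lborel K)"
        using fin e1(1) by (intro sum_mono2) auto
      also have "\<dots> = e1 * (b - a)"
        using additive_content_tagged_division[of p a b] p(1) \<open>a \<le> b\<close>
        by (simp add: case_prod_unfold flip: sum_distrib_left)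
      finally show ?thesis
        unfolding eq using bad e1(2) by linarith
    qed
    ultimately show "\<exists>\<gamma>. gauge \<gamma> \<and> (\<forall>p. p tagged_division_of {a..b} \<and> \<gamma> fine p \<longrightarrow>
        norm ((\<Sum>(x, K)\<in>p. measure lborel K *\<^sub>R G x) - (F b - F a)) < e)"
      by (intro exI[of _ \<gamma>] conjI allI impI) auto
  qed
  then show ?thesis
    by (rule has_integral_spike[OF N, rotated]) (auto simp: G_def)
qed

text \<open>By the fundamental theorem \<open>F\<close> is the indefinite integral. Over an interval
  shorter than \<delta> its variation is at most 1, which makes the derivative absolutely integrable
  there; finitely many such intervals make up \<open>{a..b}\<close>.\<close>

theorem absolutely_integrable_abs_continuous_derivative:
  fixes F :: "real \<Rightarrow> 'a::euclidean_space"
  assumes F: "abs_continuous_on {a..b} F" and N: "negligible N"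
    and F': "\<And>x. x \<in> {a..b} - N \<Longrightarrow> (F has_vector_derivative F' x) (at x within {a..b})"
  shows "F' absolutely_integrable_on {a..b}"
proof -
  have ftc: "(F' has_integral (F d - F c)) {c..d}" if "a \<le> c" "c \<le> d" "d \<le> b" for c d
    using that F' abs_continuous_on_subset[OF F, of "{c..d}"]
    by (intro fundamental_theorem_of_calculus_abs_continuous[OF _ _ N])
      (auto intro!: has_vector_derivative_within_subset[of F _ _ "{a..b}" "{c..d}"])
  obtain \<delta> where \<delta>: "\<delta> > 0"
    "\<And>D. D division_of \<Union>D \<Longrightarrow> \<Union>D \<subseteq> {a..b} \<Longrightarrow> measure lebesgue (\<Union>D) < \<delta> \<Longrightarrow>
       (\<Sum>K\<in>D. norm (F (Sup K) - F (Inf K))) < 1"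
    using abs_continuous_onE[OF F zero_less_one] by blast
  have short: "F' absolutely_integrable_on {c..d}" if cd: "a \<le> c" "c \<le> d" "d \<le> b" "d - c < \<delta>" for c d
  proof -
    have "(\<Sum>K\<in>D. norm (integral K F')) \<le> 1" if D: "D division_of (cbox c d)" for D
    proof -
      have "(\<Sum>K\<in>D. norm (integral K F')) = (\<Sum>K\<in>D. norm (F (Sup K) - F (Inf K)))"
      proof (intro sum.cong refl)
        fix K assume K: "K \<in> D"
        obtain u v where uv: "K = cbox u v" "K \<noteq> {}" "K \<subseteq> cbox c d"
          using cbox_division_memE[OF K D] by metis
        then have "integral K F' = F v - F u"
          using cd by (auto intro!: integral_unique ftc)
        then show "norm (integral K F') = norm (F (Sup K) - F (Inf K))"
          using uv by auto
      qed
      moreover have "D division_of \<Union>D" "\<Union>D = {c..d}"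
        using D by auto
      ultimately show ?thesis
        using \<delta>(2)[of D] cd by auto
    qed
    then show ?thesis
      using bounded_variation_absolutely_integrable_interval[of F' c d 1] ftc[OF cd(1-3)] by auto
  qed
  show ?thesis
  proof (cases "a \<le> b")
    case True
    obtain n :: nat where n: "n > 0" "(b - a) / n < \<delta>"
      using \<delta>(1) True by (metis diff_ge_0_iff_ge divide_less_eq ex_less_of_nat_mult gr0I mult.commute mult_zero_left not_less of_nat_0 of_nat_0_less_iff)
    define h where "h = (b - a) / n"
    have "F' absolutely_integrable_on {a..a + real k * h}" if "k \<le> n" for k
      using that
    proof (induction k)
      case 0
      then show ?case
        using short[of a a] True \<delta>(1) by simp
    next
      case (Suc k)
      have le: "real (Suc k) * h \<le> b - a" "0 \<le> h"
      proof -
        show h0: "0 \<le> h"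
          using True by (simp add: h_def)
        have "real (Suc k) * h \<le> real n * h"
          using Suc.prems h0 by (intro mult_right_mono) simp_all
        then show "real (Suc k) * h \<le> b - a"
          using n(1) by (simp add: h_def)
      qed
      have eq: "{a..a + real (Suc k) * h} = {a..a + real k * h} \<union> {a + real k * h..a + real (Suc k) * h}"
        using le by (auto simp: algebra_simps ivl_disj_un)
      have "F' absolutely_integrable_on {a + real k * h..a + real (Suc k) * h}"
        using le n(2)[folded h_def] mult_nonneg_nonneg[OF of_nat_0_le_iff[of k] le(2)]
        by (intro short) (simp_all add: algebra_simps)
      then show ?case
        unfolding eq using Suc by (intro set_integrable_Un) auto
    qed
    from this[of n] show ?thesis
      using n(1) by (simp add: h_def)
  qed simp
qed

section \<open>Approximation by continuous functions\<close>

lemma AE_lebesgue_on_iff_negligible: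
  assumes "S \<in> sets lebesgue"
  shows "(AE x in lebesgue_on S. P x) \<longleftrightarrow> negligible {x\<in>S. \<not> P x}"
proof -
  have "(AE x in lebesgue_on S. P x) \<longleftrightarrow> (AE x in lebesgue. x \<in> S \<longrightarrow> P x)"
    using assms by (intro AE_restrict_space_iff) auto
  also have "\<dots> \<longleftrightarrow> negligible {x. \<not> (x \<in> S \<longrightarrow> P x)}"
    unfolding eventually_ae_filter Bex_def negligible_iff_null_sets[symmetric]
    by (auto intro: negligible_subset)
  also have "{x. \<not> (x \<in> S \<longrightarrow> P x)} = {x\<in>S. \<not> P x}"
    by auto
  finally show ?thesis .
qed

text \<open>The projection \<open>P n\<close> onto a ball truncates values, and the truncations of
  \<open>f\<close> tend to \<open>f\<close> in L1. A measurable \<open>f\<close> is almost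
  everywhere a limit of continuous functions; nothing dominates these, but after applying
  \<open>P n\<close> they are bounded, and dominated convergence applies since \<open>S\<close> has
  finite measure.\<close>

lemma integrable_approx_continuous:
  fixes f :: "'a::euclidean_space \<Rightarrow> 'b::euclidean_space"
  assumes S: "S \<in> lmeasurable" and f: "integrable (lebesgue_on S) f" and e: "e > 0"
  obtains g where "continuous_on UNIV g" "integrable (lebesgue_on S) g"
    "(\<integral>x. norm (f x - g x) \<partial>lebesgue_on S) < e"
proof -
  let ?M = "lebesgue_on S"
  have Sm: "S \<in> sets lebesgue"
    using S by blast
  interpret finite_measure ?M
    using S by (intro finite_measureI) (simp add: emeasure_restrict_space fmeasurableD2 del: emeasure_completion)
  define P where "P n = closest_point (cball (0::'b) (real n))" for n
  have Pcont: "continuous_on A (P n)" for A n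
    unfolding P_def by (rule continuous_on_closest_point) auto
  have Pmem: "norm (P n y) \<le> n" for n y
    using closest_point_in_set[of "cball (0::'b) (real n)" y] by (simp add: P_def)
  have Pid: "P n y = y" if "norm y \<le> n" for n y
    using that by (simp add: P_def closest_point_self)
  have Ple: "norm (P n y) \<le> norm y" for n y
    using Pid[of y n] Pmem[of n y] by (cases "norm y \<le> n") auto
  have Plim: "(\<lambda>n. P n y) \<longlonglongrightarrow> y" for y
  proof (rule tendsto_eventually)
    obtain n0 :: nat where "norm y \<le> n0"
      using real_arch_simple by blast
    then have "P n y = y" if "n \<ge> n0" for n
      using that by (intro Pid) (meson of_nat_mono order_trans)
    then show "\<forall>\<^sub>F n in sequentially. P n y = y"
      unfolding eventually_sequentially by blast
  qed
  have Pmeas: "P n \<in> borel_measurable borel" for n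
    using Pcont by (rule borel_measurable_continuous_onI)
  have fm: "f \<in> borel_measurable ?M"
    using f by (rule borel_measurable_integrable)
  have Pf: "(\<lambda>x. P n (f x)) \<in> borel_measurable ?M" for n
    by (rule measurable_compose[OF fm Pmeas])
  have "(\<lambda>n. \<integral>x. norm (f x - P n (f x)) \<partial>?M) \<longlonglongrightarrow> (\<integral>x. 0 \<partial>?M)"
  proof (rule integral_dominated_convergence[where w = "\<lambda>x. 2 * norm (f x)"])
    show "AE x in ?M. (\<lambda>n. norm (f x - P n (f x))) \<longlonglongrightarrow> 0"
      using Plim by (auto intro!: AE_I2 tendsto_eq_intros)
    show "AE x in ?M. norm (norm (f x - P n (f x))) \<le> 2 * norm (f x)" for n
    proof (rule AE_I2)
      fix x
      show "norm (norm (f x - P n (f x))) \<le> 2 * norm (f x)"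
        using Ple[of n "f x"] norm_triangle_ineq4[of "f x" "P n (f x)"] by simp
    qed
  qed (use f fm Pf in auto)
  then have "\<forall>\<^sub>F n in sequentially. (\<integral>x. norm (f x - P n (f x)) \<partial>?M) < e / 2"
    using e by (intro order_tendstoD(2)) auto
  then obtain n where n: "(\<integral>x. norm (f x - P n (f x)) \<partial>?M) < e / 2"
    unfolding eventually_sequentially by blast
  obtain N g where g: "negligible N" "\<And>k::nat. continuous_on UNIV (g k)"
    "\<And>x. x \<notin> N \<Longrightarrow> (\<lambda>k. g k x) \<longlonglongrightarrow> (if x \<in> S then f x else 0)"
    using fm unfolding measurable_on_iff_borel_measurable[OF Sm, symmetric] measurable_on_def by blast
  have gm: "(\<lambda>x. P n (g k x)) \<in> borel_measurable ?M" for k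
    using continuous_imp_measurable_on_sets_lebesgue[OF continuous_on_subset[OF g(2) subset_UNIV] Sm, of k]
    by (rule measurable_compose[OF _ Pmeas])
  have "(\<lambda>k. \<integral>x. norm (P n (f x) - P n (g k x)) \<partial>?M) \<longlonglongrightarrow> (\<integral>x. 0 \<partial>?M)"
  proof (rule integral_dominated_convergence[where w = "\<lambda>x. 2 * real n"])
    have "negligible {x\<in>S. \<not> (\<lambda>k. norm (P n (f x) - P n (g k x))) \<longlonglongrightarrow> 0}"
    proof (rule negligible_subset[OF g(1)], clarify, rule ccontr)
      fix x assume x: "x \<in> S" "x \<notin> N"
      have "(\<lambda>k. P n (g k x)) \<longlonglongrightarrow> P n (f x)"
        using g(3)[OF x(2)] x(1)
        by (intro continuous_on_tendsto_compose[OF Pcont[of UNIV]]) auto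
      then have "(\<lambda>k. norm (P n (f x) - P n (g k x))) \<longlonglongrightarrow> 0"
        by (auto intro!: tendsto_eq_intros)
      moreover assume "\<not> (\<lambda>k. norm (P n (f x) - P n (g k x))) \<longlonglongrightarrow> 0"
      ultimately show False by blast
    qed
    then show "AE x in ?M. (\<lambda>k. norm (P n (f x) - P n (g k x))) \<longlonglongrightarrow> 0"
      using AE_lebesgue_on_iff_negligible[OF Sm] by blast
    have "norm (P n (f x) - P n (g k x)) \<le> 2 * real n" for k x
      using norm_triangle_ineq4[of "P n (f x)" "P n (g k x)"] Pmem[of n "f x"] Pmem[of n "g k x"]
      by linarith
    then show "AE x in ?M. norm (norm (P n (f x) - P n (g k x))) \<le> 2 * real n" for k
      by (intro AE_I2) simp
    show "integrable ?M (\<lambda>x. 2 * real n)"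
      by simp
    show "(\<lambda>x. norm (P n (f x) - P n (g k x))) \<in> borel_measurable ?M" for k
      using Pf gm by measurable
  qed simp
  then have "\<forall>\<^sub>F k in sequentially. (\<integral>x. norm (P n (f x) - P n (g k x)) \<partial>?M) < e / 2"
    using e by (intro order_tendstoD(2)) auto
  then obtain k where k: "(\<integral>x. norm (P n (f x) - P n (g k x)) \<partial>?M) < e / 2"
    unfolding eventually_sequentially by blast
  have int: "integrable ?M (\<lambda>x. P n (g k x))" "integrable ?M (\<lambda>x. P n (f x))"
    using gm Pf Pmem by (auto intro!: integrable_const_bound[of _ "real n"])
  have "(\<integral>x. norm (f x - P n (g k x)) \<partial>?M) \<le>
      (\<integral>x. norm (f x - P n (f x)) + norm (P n (f x) - P n (g k x)) \<partial>?M)"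
    using f int norm_triangle_ineq[of "f x - P n (f x)" "P n (f x) - P n (g k x)" for x]
    by (intro integral_mono) (auto intro!: Bochner_Integration.integrable_add integrable_norm Bochner_Integration.integrable_diff)
  also have "\<dots> = (\<integral>x. norm (f x - P n (f x)) \<partial>?M) + (\<integral>x. norm (P n (f x) - P n (g k x)) \<partial>?M)"
    using f int by (intro Bochner_Integration.integral_add) auto
  also have "\<dots> < e"
    using n k by linarith
  finally show thesis
    using int(1) g(2) Pcont
    by (intro that[of "\<lambda>x. P n (g k x)"]) (auto intro: continuous_on_compose2[of UNIV "P n"])
qed

text \<open>The errors in \<open>L\<^sub>1\<close> are chosen summable, so \<open>|f| + (\<Sum>n. |f - g n|)\<close> is an integrable bound.\<close>

lemma integrable_approx_continuous_dominated:
  fixes f :: "'a::euclidean_space \<Rightarrow> 'b::euclidean_space"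
  assumes S: "S \<in> lmeasurable" and f: "integrable (lebesgue_on S) f"
  obtains g h where "\<And>n::nat. continuous_on UNIV (g n)" "integrable (lebesgue_on S) h"
    "AE x in lebesgue_on S. (\<forall>n. norm (g n x) \<le> h x) \<and> (\<lambda>n. g n x) \<longlonglongrightarrow> f x"
proof -
  let ?M = "lebesgue_on S"
  have "\<exists>g. continuous_on UNIV g \<and> integrable ?M g \<and> (\<integral>x. norm (f x - g x) \<partial>?M) < (1/2)^n" for n :: nat
    using integrable_approx_continuous[OF S f, of "(1/2)^n"] by (metis half_gt_zero_iff zero_less_one zero_less_power)
  then obtain g where g: "\<And>n. continuous_on UNIV (g n)" "\<And>n. integrable ?M (g n)"
    "\<And>n. (\<integral>x. norm (f x - g n x) \<partial>?M) < (1/2)^n"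
    by metis
  define H where "H x = (\<Sum>n. ennreal (norm (f x - g n x)))" for x
  have meas: "(\<lambda>x. ennreal (norm (f x - g n x))) \<in> borel_measurable ?M" for n
    using f g(2)[of n] by measurable
  have Hm: "H \<in> borel_measurable ?M"
    unfolding H_def using meas by measurable
  have "(\<integral>\<^sup>+x. H x \<partial>?M) = (\<Sum>n. \<integral>\<^sup>+x. ennreal (norm (f x - g n x)) \<partial>?M)"
    unfolding H_def by (rule nn_integral_suminf[OF meas])
  also have "\<dots> \<le> (\<Sum>n. ennreal ((1/2)^n))"
  proof (intro suminf_le summableI)
    fix n
    have "(\<integral>\<^sup>+x. ennreal (norm (f x - g n x)) \<partial>?M) = ennreal (\<integral>x. norm (f x - g n x) \<partial>?M)"
      using f g(2) by (intro nn_integral_eq_integral) auto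
    then show "(\<integral>\<^sup>+x. ennreal (norm (f x - g n x)) \<partial>?M) \<le> ennreal ((1/2)^n)"
      using g(3)[of n] by (simp add: ennreal_leI)
  qed
  also have "\<dots> = ennreal (\<Sum>n. (1/2)^n)"
    by (rule suminf_ennreal2) auto
  also have "\<dots> < \<infinity>"
    by simp
  finally have Hfin: "(\<integral>\<^sup>+x. H x \<partial>?M) < \<infinity>" .
  \<comment> \<open>\<open>enn2real\<close> sends an infinite sum to 0; this happens only on a null
    set, where no bound is claimed.\<close>
  define h where "h x = enn2real (H x) + norm (f x)" for x
  have "integrable ?M (\<lambda>x. enn2real (H x))"
  proof (rule integrableI_bounded)
    show "(\<lambda>x. enn2real (H x)) \<in> borel_measurable ?M"
      using Hm by measurable
    have "(\<integral>\<^sup>+x. ennreal (norm (enn2real (H x))) \<partial>?M) \<le> (\<integral>\<^sup>+x. H x \<partial>?M)"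
      by (intro nn_integral_mono) (simp add: ennreal_enn2real_if)
    then show "(\<integral>\<^sup>+x. ennreal (norm (enn2real (H x))) \<partial>?M) < \<infinity>"
      using Hfin by (rule le_less_trans)
  qed
  then have "integrable ?M h"
    unfolding h_def using f by auto
  moreover have "AE x in ?M. H x \<noteq> \<infinity>"
    using Hm Hfin by (intro nn_integral_PInf_AE) auto
  then have "AE x in ?M. (\<forall>n. norm (g n x) \<le> h x) \<and> (\<lambda>n. g n x) \<longlonglongrightarrow> f x"
  proof eventually_elim
    case (elim x)
    then have sum: "summable (\<lambda>n. norm (f x - g n x))"
      unfolding H_def by (intro summable_suminf_not_top) auto
    have Hx: "H x = ennreal (\<Sum>n. norm (f x - g n x))"
      unfolding H_def using sum by (intro suminf_ennreal2) auto
    have "norm (g n x) \<le> h x" for n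
    proof -
      have "norm (f x - g n x) \<le> (\<Sum>n. norm (f x - g n x))"
        using sum_le_suminf[OF sum, of "{n}"] by simp
      also have "\<dots> = enn2real (H x)"
        unfolding Hx by (simp add: suminf_nonneg[OF sum])
      finally show ?thesis
        using norm_triangle_ineq4[of "f x" "f x - g n x"] unfolding h_def by simp
    qed
    moreover have "(\<lambda>n. f x - g n x) \<longlonglongrightarrow> 0"
      using summable_LIMSEQ_zero[OF sum] by (rule tendsto_norm_zero_cancel)
    from tendsto_diff[OF tendsto_const[of "f x"] this] have "(\<lambda>n. g n x) \<longlonglongrightarrow> f x"
      by simp
    ultimately show ?case
      by simp
  qed
  ultimately show thesis
    using that g(1) by blast
qed

text \<open>Both parts have finite integrals, so the difference in \<open>ereal_integral\<close> is
  never \<open>\<infinity> - \<infinity>\<close>. The ordinary and the generalized cost both become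
  integrals of real functions in this way.\<close>

lemma ereal_integral_eq_integral:
  assumes h: "integrable M h" and ae: "AE x in M. h' x = ereal (h x)"
  shows "ereal_integral M h' = ereal (integral\<^sup>L M h)"
proof -
  have "(\<integral>\<^sup>+x. e2ennreal (h' x) \<partial>M) = (\<integral>\<^sup>+x. ennreal (h x) \<partial>M)"
    using ae by (intro nn_integral_cong_AE) (auto elim!: eventually_mono simp: ennreal_def)
  moreover have "(\<integral>\<^sup>+x. e2ennreal (- h' x) \<partial>M) = (\<integral>\<^sup>+x. ennreal (- h x) \<partial>M)"
    using ae by (intro nn_integral_cong_AE) (auto elim!: eventually_mono simp: ennreal_def)
  moreover have "(\<integral>\<^sup>+x. ennreal (h x) \<partial>M) \<noteq> \<infinity>" "(\<integral>\<^sup>+x. ennreal (- h x) \<partial>M) \<noteq> \<infinity>"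
    using h by (auto simp: real_integrable_def)
  ultimately show ?thesis
    unfolding ereal_integral_def real_lebesgue_integral_def[OF h]
    by (cases "\<integral>\<^sup>+x. ennreal (h x) \<partial>M"; cases "\<integral>\<^sup>+x. ennreal (- h x) \<partial>M") (auto simp: enn2ereal_ennreal)
qed

section \<open>Solutions near an approximate solution\<close>

text \<open>In the norm weighted with \<open>exp (- 2 \<integral> a)\<close> the Picard operator is a contraction with factor \<open>1/2\<close>.
  This gives existence and the distance to \<open>\<eta>\<close> at once, and the weight depends on the control
  only through its \<open>L\<^sub>1\<close> norm.\<close>

theorem Picard_near_approximate_solution:
  fixes H :: "real \<Rightarrow> 'a::euclidean_space \<Rightarrow> 'a"
  assumes S: "0 \<le> S"
    and Hc: "continuous_on ({0..S} \<times> UNIV) (\<lambda>(s, x). H s x)"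
    and lip: "\<And>s x y. s \<in> {0..S} \<Longrightarrow> norm (H s x - H s y) \<le> a s * norm (x - y)"
    and ac: "continuous_on {0..S} a" and a0: "\<And>s. s \<in> {0..S} \<Longrightarrow> 0 \<le> a s"
    and \<eta>c: "continuous_on {0..S} \<eta>"
    and res: "\<And>s. s \<in> {0..S} \<Longrightarrow> norm (\<eta> s - x0 - integral {0..s} (\<lambda>\<tau>. H \<tau> (\<eta> \<tau>))) \<le> \<epsilon>"
  obtains y where "y 0 = x0"
    "\<And>s. s \<in> {0..S} \<Longrightarrow> (y has_vector_derivative H s (y s)) (at s within {0..S})"
    "\<And>s. s \<in> {0..S} \<Longrightarrow> norm (y s - \<eta> s) \<le> 2 * \<epsilon> * exp (2 * integral {0..S} a)"
proof -
  \<comment> \<open>The 2 in the exponent of \<open>E\<close> yields the contraction factor: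
    \<open>E\<close> has derivative \<open>2 * a * E\<close>, so \<open>a * E\<close> integrates to
    \<open>(E s - 1) / 2\<close>, which is at most half of \<open>E s\<close>.\<close>
  define A where "A s = integral {0..s} a" for s
  define E where "E s = exp (2 * A s)" for s
  have dA: "(A has_vector_derivative a s) (at s within {0..S})" if "s \<in> {0..S}" for s
    unfolding A_def using integral_has_vector_derivative[OF ac that] .
  have dE: "(E has_vector_derivative 2 * a s * E s) (at s within {0..S})" if "s \<in> {0..S}" for s
    unfolding E_def using dA[OF that] unfolding has_real_derivative_iff_has_vector_derivative[symmetric]
    by (auto intro!: derivative_eq_intros)
  have Ec: "continuous_on {0..S} E"
    using dE by (meson continuous_on_eq_continuous_within has_vector_derivative_continuous)
  have A_int: "a integrable_on {0..s}" if "s \<in> {0..S}" for s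
    using that by (intro integrable_continuous_real continuous_on_subset[OF ac]) auto
  have A0: "0 \<le> A s" if "s \<in> {0..S}" for s
    unfolding A_def using that a0 A_int by (intro integral_nonneg) auto
  have AS: "A s \<le> A S" if "s \<in> {0..S}" for s
    unfolding A_def using that a0 A_int S by (intro integral_subset_le) auto
  have E1: "1 \<le> E s" if "s \<in> {0..S}" for s
    using A0[OF that] by (simp add: E_def)
  have ES: "E s \<le> E S" if "s \<in> {0..S}" for s
    using AS[OF that] by (simp add: E_def)
  have aE: "((\<lambda>\<tau>. a \<tau> * E \<tau>) has_integral (E s - 1) / 2) {0..s}" if "s \<in> {0..S}" for s
  proof -
    have "((\<lambda>\<tau>. 2 * a \<tau> * E \<tau>) has_integral E s - E 0) {0..s}"
      using that by (intro fundamental_theorem_of_calculus has_vector_derivative_within_subset[OF dE]) auto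
    from has_integral_mult_right[OF this, of "1/2"] show ?thesis
      by (simp add: E_def A_def)
  qed
  \<comment> \<open>The contraction acts on the complete space of bounded continuous functions on
    the whole line; clamping to \<open>{0..S}\<close> extends functions to it.\<close>
  define c where "c = clamp 0 S"
  have c: "c s \<in> {0..S}" for s
    using S clamp_in_interval[of 0 S s] by (simp add: c_def)
  have cid: "c s = s" if "s \<in> {0..S}" for s
    using that by (simp add: c_def)
  have Hcomp: "continuous_on {0..s} (\<lambda>\<tau>. H \<tau> (w \<tau>))" if "continuous_on {0..S} w" "s \<in> {0..S}" for s w
  proof -
    have "continuous_on {0..S} ((\<lambda>(s, x). H s x) \<circ> (\<lambda>\<tau>. (\<tau>, w \<tau>)))"
      using that(1) by (intro continuous_on_compose continuous_intros continuous_on_subset[OF Hc]) auto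
    then show ?thesis
      using that(2) by (auto simp: o_def intro: continuous_on_subset)
  qed
  define J where "J w s = x0 + integral {0..s} (\<lambda>\<tau>. H \<tau> (w \<tau>))" for w s
  have dJ: "(J w has_vector_derivative H s (w s)) (at s within {0..S})"
    if "continuous_on {0..S} w" "s \<in> {0..S}" for w s
    unfolding J_def using integral_has_vector_derivative[OF Hcomp[OF that(1), of S] that(2)] S
    by (auto intro!: derivative_eq_intros)
  have Jc: "continuous_on {0..S} (J w)" if "continuous_on {0..S} w" for w
    using dJ[OF that] by (meson continuous_on_eq_continuous_within has_vector_derivative_continuous)
  \<comment> \<open>The unknown is \<open>z\<close>, the trajectory divided by \<open>E\<close>, so
    that the plain supremum norm of \<open>z\<close> is the weighted norm of the trajectory.\<close>
  have "\<exists>z'. \<forall>s. apply_bcontfun z' s = J (\<lambda>\<tau>. E \<tau> *\<^sub>R apply_bcontfun z \<tau>) (c s) /\<^sub>R E (c s)"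
    for z :: "real \<Rightarrow>\<^sub>C 'a"
  proof -
    let ?g = "\<lambda>s. J (\<lambda>\<tau>. E \<tau> *\<^sub>R apply_bcontfun z \<tau>) s /\<^sub>R E s"
    have g: "continuous_on (cbox 0 S) ?g"
      using Ec by (auto intro!: continuous_intros Jc simp: E_def)
    obtain z' where "\<And>s. apply_bcontfun z' s = ?g (clamp 0 S s)"
      using continuous_on_cbox_bcontfunE[OF g] by blast
    then show ?thesis
      unfolding c_def by (intro exI[of _ z']) simp
  qed
  then have "\<exists>T. \<forall>z s. apply_bcontfun (T z) s = J (\<lambda>\<tau>. E \<tau> *\<^sub>R apply_bcontfun z \<tau>) (c s) /\<^sub>R E (c s)"
    by (intro choice allI)
  then obtain T where T: "\<And>z s. apply_bcontfun (T z) s = J (\<lambda>\<tau>. E \<tau> *\<^sub>R apply_bcontfun z \<tau>) (c s) /\<^sub>R E (c s)"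
    by blast
  have contr: "dist (T z) (T w) \<le> 1/2 * dist z w" for z w
  proof (rule dist_bound)
    fix s0
    define s where "s = c s0"
    have s: "s \<in> {0..S}"
      unfolding s_def by (rule c)
    let ?u = "\<lambda>(z :: real \<Rightarrow>\<^sub>C 'a) \<tau>. E \<tau> *\<^sub>R apply_bcontfun z \<tau>"
    have uc: "continuous_on {0..S} (?u z)" for z
      by (rule continuous_on_scaleR[OF Ec continuous_on_apply_bcontfun])
    have Hi: "(\<lambda>\<tau>. H \<tau> (?u z \<tau>)) integrable_on {0..s}" for z
      by (intro integrable_continuous_real Hcomp uc s)
    have "norm (J (?u z) s - J (?u w) s) = norm (integral {0..s} (\<lambda>\<tau>. H \<tau> (?u z \<tau>) - H \<tau> (?u w \<tau>)))"
      unfolding J_def using Hi by (simp add: Henstock_Kurzweil_Integration.integral_diff)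
    also have "\<dots> \<le> integral {0..s} (\<lambda>\<tau>. dist z w * (a \<tau> * E \<tau>))"
    proof (intro integral_norm_bound_integral)
      fix \<tau> assume "\<tau> \<in> {0..s}"
      then have \<tau>: "\<tau> \<in> {0..S}"
        using s by auto
      have "norm (H \<tau> (?u z \<tau>) - H \<tau> (?u w \<tau>)) \<le> a \<tau> * norm (?u z \<tau> - ?u w \<tau>)"
        by (rule lip[OF \<tau>])
      also have "norm (?u z \<tau> - ?u w \<tau>) = E \<tau> * dist (z \<tau>) (w \<tau>)"
        using E1[OF \<tau>] by (simp add: dist_norm flip: scaleR_diff_right)
      also have "a \<tau> * (E \<tau> * dist (z \<tau>) (w \<tau>)) \<le> a \<tau> * (E \<tau> * dist z w)"
        using a0[OF \<tau>] E1[OF \<tau>] by (intro mult_left_mono dist_bounded) auto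
      finally show "norm (H \<tau> (?u z \<tau>) - H \<tau> (?u w \<tau>)) \<le> dist z w * (a \<tau> * E \<tau>)"
        by (simp add: mult_ac)
    next
      show "(\<lambda>\<tau>. dist z w * (a \<tau> * E \<tau>)) integrable_on {0..s}"
        using has_integral_mult_right[OF aE[OF s], of "dist z w"] by blast
    qed (intro Henstock_Kurzweil_Integration.integrable_diff Hi)
    also have "\<dots> = dist z w * ((E s - 1) / 2)"
      using has_integral_mult_right[OF aE[OF s], of "dist z w"] by (rule integral_unique)
    also have "\<dots> \<le> dist z w * (E s / 2)"
      by (intro mult_left_mono) auto
    finally have "norm (J (?u z) s - J (?u w) s) / E s \<le> 1/2 * dist z w"
      using E1[OF s] by (simp add: field_simps)
    moreover have "dist (T z s0) (T w s0) = norm (J (?u z) s - J (?u w) s) / E s"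
      using E1[OF s] unfolding T s_def[symmetric]
      by (simp add: dist_norm divide_inverse mult.commute flip: scaleR_diff_right)
    ultimately show "dist (T z s0) (T w s0) \<le> 1/2 * dist z w"
      by simp
  qed
  then obtain z where z: "T z = z"
    using banach_fix_type[of "1/2" T] by auto
  define y where "y s = E s *\<^sub>R apply_bcontfun z s" for s
  have yc: "continuous_on {0..S} y"
    unfolding y_def by (rule continuous_on_scaleR[OF Ec continuous_on_apply_bcontfun])
  have yJ: "y s = J y s" if "s \<in> {0..S}" for s
  proof -
    have "y s = E s *\<^sub>R apply_bcontfun (T z) s"
      unfolding z y_def ..
    then show ?thesis
      using E1[OF that] unfolding T cid[OF that] y_def[abs_def] by simp
  qed
  show thesis
  proof
    show "y 0 = x0"
      using yJ[of 0] S by (simp add: J_def)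
    show "(y has_vector_derivative H s (y s)) (at s within {0..S})" if "s \<in> {0..S}" for s
      using dJ[OF yc that] by (rule has_vector_derivative_transform[OF that yJ, rotated -1]) auto
    \<comment> \<open>The approximate solution in the same coordinates. As \<open>E\<close> is at
      least 1, one application of \<open>T\<close> moves it by at most \<epsilon>, so its distance
      \<open>d\<close> to the fixed point satisfies
      \<open>d \<le> d / 2 + \<epsilon>\<close>.\<close>
    have g: "continuous_on (cbox 0 S) (\<lambda>s. \<eta> s /\<^sub>R E s)"
      using Ec \<eta>c by (auto intro!: continuous_intros simp: E_def)
    obtain \<zeta> :: "real \<Rightarrow>\<^sub>C 'a" where \<zeta>': "\<And>s. s \<in> cbox 0 S \<Longrightarrow> \<zeta> s = \<eta> s /\<^sub>R E s"
        "\<And>s. \<zeta> s = \<eta> (clamp 0 S s) /\<^sub>R E (clamp 0 S s)"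
      using continuous_on_cbox_bcontfunE[OF g] by blast
    have \<zeta>: "\<And>s. s \<in> {0..S} \<Longrightarrow> \<zeta> s = \<eta> s /\<^sub>R E s" "\<And>s. \<zeta> s = \<eta> (c s) /\<^sub>R E (c s)"
      using \<zeta>' by (simp_all add: c_def)
    have "dist (T \<zeta>) \<zeta> \<le> \<epsilon>"
    proof (rule dist_bound)
      fix s0
      define s where "s = c s0"
      have s: "s \<in> {0..S}"
        unfolding s_def by (rule c)
      have "E \<tau> *\<^sub>R apply_bcontfun \<zeta> \<tau> = \<eta> \<tau>" if "\<tau> \<in> {0..s}" for \<tau>
        using \<zeta>(1)[of \<tau>] E1[of \<tau>] s that by auto
      then have "J (\<lambda>\<tau>. E \<tau> *\<^sub>R apply_bcontfun \<zeta> \<tau>) s = J \<eta> s"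
        unfolding J_def by (intro arg_cong2[of _ _ _ _ plus] Henstock_Kurzweil_Integration.integral_cong) auto
      then have "dist (T \<zeta> s0) (\<zeta> s0) = norm (\<eta> s - J \<eta> s) / E s"
        using E1[OF s] unfolding T \<zeta>(2) s_def[symmetric]
        by (simp add: dist_norm norm_minus_commute divide_inverse mult.commute flip: scaleR_diff_right)
      also have "\<dots> \<le> norm (\<eta> s - J \<eta> s)"
        using E1[OF s] by (simp add: divide_le_eq mult_left_le mult_le_cancel_left1)
      also have "\<dots> \<le> \<epsilon>"
        using res[OF s] by (simp add: J_def diff_diff_eq)
      finally show "dist (T \<zeta> s0) (\<zeta> s0) \<le> \<epsilon>" .
    qed
    moreover have "dist z \<zeta> \<le> dist (T z) (T \<zeta>) + dist (T \<zeta>) \<zeta>"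
      unfolding z by (rule dist_triangle)
    ultimately have d: "dist z \<zeta> \<le> 2 * \<epsilon>"
      using contr[of z \<zeta>] by simp
    show "norm (y s - \<eta> s) \<le> 2 * \<epsilon> * exp (2 * integral {0..S} a)" if s: "s \<in> {0..S}" for s
    proof -
      have "norm (y s - \<eta> s) = norm (E s *\<^sub>R (z s - \<zeta> s))"
        using E1[OF s] unfolding y_def \<zeta>(1)[OF s] by (simp add: scaleR_diff_right)
      also have "\<dots> = E s * dist (z s) (\<zeta> s)"
        using E1[OF s] by (simp add: dist_norm)
      also have "\<dots> \<le> E S * (2 * \<epsilon>)"
        using d dist_bounded[of z s \<zeta>] E1[OF s] ES[OF s] by (intro mult_mono) auto
      finally show ?thesis
        by (simp add: E_def A_def mult_ac)
    qed
  qed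
qed

section \<open>The auxiliary Lagrangian\<close>

lemma half_ball_eq: "half_ball = {z. 0 \<le> fst z \<and> norm z \<le> 1}"
  unfolding half_ball_def norm_prod_def by auto

text \<open>The perspective of \<open>L y\<close> along \<open>w\<close>. For convex
  \<open>L y\<close> its limit as \<eta> tends to 0 from the right is the recession function of
  \<open>L y\<close>.\<close>

definition perspective_slope :: "('a \<Rightarrow> 'b::real_vector \<Rightarrow> real) \<Rightarrow> 'a \<Rightarrow> 'b \<Rightarrow> real \<Rightarrow> ereal" where
  "perspective_slope L y w \<eta> = ereal (L y (w /\<^sub>R \<eta>) * \<eta>)"

lemma aux_lagrangian_pos: "v > 0 \<Longrightarrow> aux_lagrangian L y v w = ereal (L y (w /\<^sub>R v) * v)"
  by (simp add: aux_lagrangian_def)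

text \<open>Substitution in the limit: the slope at \<open>r *\<^sub>R w\<close> and \<eta> is
  \<open>r\<close> times the slope at \<open>w\<close> and \<open>\<eta> / r\<close>.\<close>

lemma perspective_slope_scaleR:
  assumes "(perspective_slope L y w \<longlongrightarrow> l) (at_right 0)" "r > 0"
  shows "(perspective_slope L y (r *\<^sub>R w) \<longlongrightarrow> ereal r * l) (at_right 0)"
proof -
  have "filterlim (\<lambda>\<eta>. \<eta> / r) (at_right 0) (at_right (0::real))"
    using \<open>r > 0\<close> unfolding filterlim_at_right_to_0[symmetric]
    by (auto simp: filterlim_at eventually_at_right_less intro!: tendsto_eq_intros
        eventually_mono[OF eventually_at_right_less])
  then have "((\<lambda>\<eta>. ereal r * perspective_slope L y w (\<eta> / r)) \<longlongrightarrow> ereal r * l) (at_right 0)"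
    by (intro tendsto_cmult_ereal filterlim_compose[OF assms(1)]) auto
  moreover have "ereal r * perspective_slope L y w (\<eta> / r) = perspective_slope L y (r *\<^sub>R w) \<eta>" for \<eta>
    using \<open>r > 0\<close> by (simp add: perspective_slope_def divide_inverse mult_ac)
  ultimately show ?thesis
    by simp
qed

locale continuous_aux_lagrangian =
  fixes L :: "'a::metric_space \<Rightarrow> 'b::euclidean_space \<Rightarrow> real"
  assumes cont: "continuous_on (UNIV \<times> half_ball) (\<lambda>(y, v, w). aux_lagrangian L y v w)"
begin

text \<open>At \<open>v = 0\<close> the function is given by \<open>Lim\<close>, which says nothing
  unless the limit exists. Continuity at \<open>(y, 0, w)\<close>, used along the points
  \<open>(y, \<eta>, w)\<close>, provides the limit, whatever its value. These points stay in
  \<open>half_ball\<close> for small \<eta> only when \<open>norm w < 1\<close>; other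
  \<open>w\<close> are reduced to this case by scaling.\<close>

lemma aux_lagrangian_tendsto: "(perspective_slope L y w \<longlongrightarrow> aux_lagrangian L y 0 w) (at_right 0)"
proof -
  have small: "(perspective_slope L y w \<longlongrightarrow> aux_lagrangian L y 0 w) (at_right 0)" if w: "norm w < 1" for w
  proof -
    let ?X = "UNIV \<times> half_ball :: ('a \<times> real \<times> 'b) set"
    have "(y, 0, w) \<in> ?X"
      using w by (simp add: half_ball_eq norm_Pair)
    then have 1: "((\<lambda>(y, v, w). aux_lagrangian L y v w) \<longlongrightarrow> aux_lagrangian L y 0 w) (at (y, 0, w) within ?X)"
      using cont unfolding continuous_on_def by fastforce
    have "((\<lambda>\<eta>::real. norm (\<eta>, w)) \<longlongrightarrow> norm (0::real, w)) (at_right 0)"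
      by (intro tendsto_intros)
    then have "\<forall>\<^sub>F \<eta> in at_right (0::real). norm (\<eta>, w) < 1"
      using w by (intro order_tendstoD(2)) (auto simp: norm_Pair)
    then have "\<forall>\<^sub>F \<eta> in at_right (0::real). (y, \<eta>, w) \<in> ?X \<and> (y, \<eta>, w) \<noteq> (y, 0, w)"
      using eventually_at_right_less[of "0::real"] by eventually_elim (auto simp: half_ball_eq)
    moreover have "((\<lambda>\<eta>. (y, \<eta>, w)) \<longlongrightarrow> (y, 0, w)) (at_right (0::real))"
      by (intro tendsto_intros)
    ultimately have "filterlim (\<lambda>\<eta>. (y, \<eta>, w)) (at (y, 0, w) within ?X) (at_right (0::real))"
      unfolding filterlim_at by (simp add: eventually_conj_iff)
    from filterlim_compose[OF 1 this]
    have "((\<lambda>\<eta>. aux_lagrangian L y \<eta> w) \<longlongrightarrow> aux_lagrangian L y 0 w) (at_right 0)"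
      by simp
    moreover have "\<forall>\<^sub>F \<eta> in at_right 0. aux_lagrangian L y \<eta> w = perspective_slope L y w \<eta>"
      using eventually_at_right_less[of "0::real"]
      by eventually_elim (simp add: aux_lagrangian_pos perspective_slope_def)
    ultimately show ?thesis
      using tendsto_cong by force
  qed
  define r where "r = 1 + norm w"
  have r: "r > 0"
    by (simp add: r_def add_pos_nonneg)
  have "norm (w /\<^sub>R r) < 1"
    using r by (simp add: r_def divide_simps add_pos_nonneg)
  from perspective_slope_scaleR[OF small[OF this] r]
  have lim: "(perspective_slope L y w \<longlongrightarrow> ereal r * aux_lagrangian L y 0 (w /\<^sub>R r)) (at_right 0)"
    using r by simp
  then have "Lim (at_right 0) (perspective_slope L y w) = ereal r * aux_lagrangian L y 0 (w /\<^sub>R r)"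
    by (intro tendsto_Lim) auto
  then show ?thesis
    using lim by (simp add: aux_lagrangian_def perspective_slope_def[abs_def])
qed

lemma aux_lagrangian_scaleR:
  assumes "r > 0" "v \<ge> 0"
  shows "aux_lagrangian L y (r * v) (r *\<^sub>R w) = ereal r * aux_lagrangian L y v w"
proof (cases "v = 0")
  case True
  then show ?thesis
    using tendsto_unique[OF _ aux_lagrangian_tendsto perspective_slope_scaleR[OF aux_lagrangian_tendsto assms(1)]]
    by simp
next
  case False
  then have "v > 0" "r * v > 0"
    using assms by auto
  have eq: "(r *\<^sub>R w) /\<^sub>R (r * v) = w /\<^sub>R v"
    using assms(1) by simp
  show ?thesis
    unfolding aux_lagrangian_pos[OF \<open>r * v > 0\<close>] aux_lagrangian_pos[OF \<open>v > 0\<close>] eq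
    by (simp add: mult_ac)
qed

lemma aux_lagrangian_0: "aux_lagrangian L y 0 0 = 0"
proof -
  have "(perspective_slope L y 0 \<longlongrightarrow> ereal (L y 0 * 0)) (at_right 0)"
    unfolding perspective_slope_def scaleR_zero_right by (intro tendsto_intros)
  then show ?thesis
    using tendsto_unique[OF _ aux_lagrangian_tendsto] by (simp add: zero_ereal_def)
qed

text \<open>An infinite value would, by homogeneity, be attained arbitrarily close to the origin.\<close>

lemma aux_lagrangian_finite:
  assumes "v \<ge> 0"
  shows "\<bar>aux_lagrangian L y v w\<bar> \<noteq> \<infinity>"
proof (cases "v = 0")
  case True
  have inf: "aux_lagrangian L y 0 w \<noteq> c" if c: "c = \<infinity> \<or> c = - \<infinity>" for c
  proof
    assume eq: "aux_lagrangian L y 0 w = c"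
    let ?X = "UNIV \<times> half_ball :: ('a \<times> real \<times> 'b) set"
    let ?p = "\<lambda>r::real. (y, 0::real, r *\<^sub>R w)"
    \<comment> \<open>The range of \<open>r\<close> is short enough for \<open>r *\<^sub>R w\<close>
      to stay in the unit ball, where continuity is assumed.\<close>
    have "continuous_on {0..1 / (1 + norm w)} (\<lambda>r. aux_lagrangian L y 0 (r *\<^sub>R w))"
    proof -
      have "continuous_on {0..1 / (1 + norm w)} ((\<lambda>(y, v, w). aux_lagrangian L y v w) \<circ> ?p)"
      proof (intro continuous_on_compose continuous_intros continuous_on_subset[OF cont] image_subsetI)
        fix r assume "r \<in> {0..1 / (1 + norm w)}"
        then have "r \<le> 1 / (1 + norm w)" "0 \<le> r"
          by auto
        from mult_right_mono[OF this(1) norm_ge_zero]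
        have "r * norm w \<le> 1 / (1 + norm w) * norm w" .
        also have "1 / (1 + norm w) * norm w \<le> 1"
          using norm_ge_zero[of w] by (simp add: divide_le_eq_1 add_pos_nonneg)
        finally show "?p r \<in> ?X"
          using \<open>0 \<le> r\<close> by (simp add: half_ball_eq norm_Pair)
      qed
      then show ?thesis
        by (simp add: o_def)
    qed
    then have "((\<lambda>r. aux_lagrangian L y 0 (r *\<^sub>R w)) \<longlongrightarrow> aux_lagrangian L y 0 (0 *\<^sub>R w)) (at_right 0)"
      by (rule continuous_on_Icc_at_rightD) (simp add: add_pos_nonneg)
    moreover have "\<forall>\<^sub>F r in at_right 0. aux_lagrangian L y 0 (r *\<^sub>R w) = c"
      using eventually_at_right_less[of "0::real"]
    proof eventually_elim
      case (elim r)
      then show ?case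
        using aux_lagrangian_scaleR[of r 0 y w] eq c by auto
    qed
    ultimately have "((\<lambda>r::real. c) \<longlongrightarrow> aux_lagrangian L y 0 (0 *\<^sub>R w)) (at_right 0)"
      using tendsto_cong by force
    then have "c = aux_lagrangian L y 0 (0 *\<^sub>R w)"
      by (simp add: tendsto_const_iff)
    then show False
      using c aux_lagrangian_0 by auto
  qed
  then show ?thesis
    using True by (cases "aux_lagrangian L y 0 w") auto
next
  case False
  then show ?thesis
    using assms by (simp add: aux_lagrangian_pos)
qed

definition real_lagrangian :: "'a \<Rightarrow> real \<times> 'b \<Rightarrow> real" where
  "real_lagrangian y z = real_of_ereal (aux_lagrangian L y (fst z) (snd z))"

lemma ereal_real_lagrangian:
  "0 \<le> fst z \<Longrightarrow> ereal (real_lagrangian y z) = aux_lagrangian L y (fst z) (snd z)"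
  unfolding real_lagrangian_def using aux_lagrangian_finite by (intro ereal_real') auto

lemma real_lagrangian_pos: "0 < fst z \<Longrightarrow> real_lagrangian y z = L y (snd z /\<^sub>R fst z) * fst z"
  by (simp add: real_lagrangian_def aux_lagrangian_pos)

lemma real_lagrangian_scaleR:
  assumes "0 < r" "0 \<le> fst z"
  shows "real_lagrangian y (r *\<^sub>R z) = r * real_lagrangian y z"
  using assms by (simp add: real_lagrangian_def aux_lagrangian_scaleR)

text \<open>Where \<open>norm z < R\<close>, the value at \<open>z\<close> is \<open>R\<close> times
  the value at \<open>z /\<^sub>R R\<close>, which lies in \<open>half_ball\<close>. The strict
  inequality makes this region open, so continuity on it is continuity at each of its
  points.\<close>

lemma continuous_on_real_lagrangian:
  "continuous_on (UNIV \<times> {z. 0 \<le> fst z}) (\<lambda>(y, z). real_lagrangian y z)"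
proof -
  have unit: "continuous_on (UNIV \<times> half_ball) (\<lambda>(y, z). real_lagrangian y z)"
  proof -
    have "continuous_on (UNIV \<times> half_ball) (\<lambda>p. ereal (case p of (y, z) \<Rightarrow> real_lagrangian y z))"
      by (rule continuous_on_eq[OF cont]) (auto simp: half_ball_eq ereal_real_lagrangian)
    then show ?thesis
      unfolding continuous_on_def lim_ereal .
  qed
  show ?thesis
    unfolding continuous_on_eq_continuous_within
  proof
    fix p :: "'a \<times> real \<times> 'b" assume p: "p \<in> UNIV \<times> {z. 0 \<le> fst z}"
    define R where "R = norm (snd p) + 1"
    have R: "R > 0"
      by (simp add: R_def add_nonneg_pos)
    let ?X = "UNIV \<times> {z. 0 \<le> fst z} :: ('a \<times> real \<times> 'b) set"
    let ?Y = "UNIV \<times> {z. 0 \<le> fst z \<and> norm z < R} :: ('a \<times> real \<times> 'b) set"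
    let ?U = "UNIV \<times> ball 0 R :: ('a \<times> real \<times> 'b) set"
    have "(fst q, snd q /\<^sub>R R) \<in> UNIV \<times> half_ball" if "q \<in> ?Y" for q
      using R that by (simp add: half_ball_eq mem_Times_iff divide_simps)
    then have "continuous_on ?Y (\<lambda>q. R * (case (fst q, snd q /\<^sub>R R) of (y, z) \<Rightarrow> real_lagrangian y z))"
      by (intro continuous_intros continuous_on_compose2[OF unit] image_subsetI)
    then have "continuous_on ?Y (\<lambda>(y, z). real_lagrangian y z)"
    proof (rule continuous_on_eq)
      fix q assume "q \<in> ?Y"
      then show "R * (case (fst q, snd q /\<^sub>R R) of (y, z) \<Rightarrow> real_lagrangian y z)
          = (case q of (y, z) \<Rightarrow> real_lagrangian y z)"
        using R real_lagrangian_scaleR[of R "snd q /\<^sub>R R" "fst q"] by (auto simp: case_prod_unfold)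
    qed
    then have "continuous (at p within ?Y) (\<lambda>(y, z). real_lagrangian y z)"
      using p by (auto simp: continuous_on_eq_continuous_within R_def)
    moreover have "at p within ?X = at p within ?Y"
    proof (rule at_within_nhd)
      show "p \<in> ?U"
        by (cases p) (simp add: R_def)
      show "open ?U"
        by (intro open_Times) auto
      show "?X \<inter> ?U - {p} = ?Y \<inter> ?U - {p}"
        by auto
    qed
    ultimately show "continuous (at p within ?X) (\<lambda>(y, z). real_lagrangian y z)"
      by simp
  qed
qed

text \<open>On controls of norm at most 1 compactness gives a bound, and homogeneity turns it into
  linear growth. This carries domination over from the controls to the cost integrands.\<close>

lemma real_lagrangian_bound:
  assumes "compact K"
  obtains C where "C \<ge> 0" "\<And>y z. y \<in> K \<Longrightarrow> 0 \<le> fst z \<Longrightarrow> \<bar>real_lagrangian y z\<bar> \<le> C * norm z"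
proof -
  have eq: "{z :: real \<times> 'b. 0 \<le> fst z \<and> norm z \<le> 1} = {z. 0 \<le> fst z} \<inter> cball 0 1"
    by auto
  have "closed {z :: real \<times> 'b. 0 \<le> fst z}"
    by (intro closed_Collect_le continuous_intros)
  then have "compact {z :: real \<times> 'b. 0 \<le> fst z \<and> norm z \<le> 1}"
    unfolding eq by (intro closed_Int_compact) auto
  then have "compact (K \<times> {z :: real \<times> 'b. 0 \<le> fst z \<and> norm z \<le> 1})"
    by (rule compact_Times[OF assms])
  moreover have "continuous_on (K \<times> {z. 0 \<le> fst z \<and> norm z \<le> 1}) (\<lambda>(y, z). real_lagrangian y z)"
    by (rule continuous_on_subset[OF continuous_on_real_lagrangian]) auto
  ultimately have "bounded ((\<lambda>(y, z). real_lagrangian y z) ` (K \<times> {z. 0 \<le> fst z \<and> norm z \<le> 1}))"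
    by (intro compact_imp_bounded compact_continuous_image)
  then obtain C where C: "C > 0"
    "\<And>y z. y \<in> K \<Longrightarrow> 0 \<le> fst z \<Longrightarrow> norm z \<le> 1 \<Longrightarrow> \<bar>real_lagrangian y z\<bar> \<le> C"
    unfolding bounded_pos by fastforce
  have "\<bar>real_lagrangian y z\<bar> \<le> C * norm z" if yz: "y \<in> K" "0 \<le> fst z" for y z
  proof (cases "z = 0")
    case True
    then show ?thesis
      by (simp add: real_lagrangian_def aux_lagrangian_0)
  next
    case False
    then have n: "norm z > 0"
      by simp
    have "real_lagrangian y z = norm z * real_lagrangian y (z /\<^sub>R norm z)"
      using real_lagrangian_scaleR[OF n, of "z /\<^sub>R norm z" y] yz(2) n by simp
    moreover have "\<bar>real_lagrangian y (z /\<^sub>R norm z)\<bar> \<le> C"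
      using n yz by (intro C(2)) auto
    ultimately show ?thesis
      using n by (simp add: abs_mult mult.commute mult_left_mono)
  qed
  then show thesis
    using that[of C] C(1) by simp
qed

end

section \<open>From generalized to ordinary controls\<close>

lemma Lipschitz_imp_abs_continuous_on:
  assumes "\<And>s t. s \<in> S \<Longrightarrow> t \<in> S \<Longrightarrow> norm (F s - F t) \<le> B * \<bar>s - t\<bar>"
  shows "abs_continuous_on S F"
  unfolding abs_continuous_on_def
proof (intro allI impI)
  fix \<epsilon> :: real assume "\<epsilon> > 0"
  \<comment> \<open>\<open>B\<close> may be zero or negative; a positive constant is needed as
    divisor.\<close>
  define C where "C = \<bar>B\<bar> + 1"
  have C: "C > 0" "B \<le> C"
    by (auto simp: C_def)
  show "\<exists>\<delta>>0. \<forall>D. D division_of \<Union>D \<and> \<Union>D \<subseteq> S \<and> (\<Sum>K\<in>D. measure lborel K) < \<delta> \<longrightarrow>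
      (\<Sum>K\<in>D. norm (F (Sup K) - F (Inf K))) < \<epsilon>"
  proof (intro exI[of _ "\<epsilon> / C"] conjI allI impI)
    fix D assume D: "D division_of \<Union>D \<and> \<Union>D \<subseteq> S \<and> (\<Sum>K\<in>D. measure lborel K) < \<epsilon> / C"
    have "(\<Sum>K\<in>D. norm (F (Sup K) - F (Inf K))) \<le> (\<Sum>K\<in>D. C * measure lborel K)"
    proof (rule sum_mono)
      fix K assume K: "K \<in> D"
      obtain u v where uv: "K = cbox u v" "K \<noteq> {}" "K \<subseteq> \<Union>D"
        using cbox_division_memE[OF K] D by blast
      then have "u \<le> v" "cbox u v \<subseteq> S"
        using D by auto
      then have "u \<in> S" "v \<in> S"
        by auto
      then have "norm (F v - F u) \<le> B * \<bar>v - u\<bar>"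
        by (intro assms)
      also have "\<dots> \<le> C * \<bar>v - u\<bar>"
        using C by (intro mult_right_mono) auto
      finally show "norm (F (Sup K) - F (Inf K)) \<le> C * measure lborel K"
        using uv(1) \<open>u \<le> v\<close> by simp
    qed
    also have "\<dots> < \<epsilon>"
      using D C by (simp add: pos_less_divide_eq mult.commute flip: sum_distrib_left)
    finally show "(\<Sum>K\<in>D. norm (F (Sup K) - F (Inf K))) < \<epsilon>" .
  qed (use C \<open>\<epsilon> > 0\<close> in auto)
qed

lemma control_field_scaleR: "control_field g x (r *\<^sub>R u) = r *\<^sub>R control_field g x u"
  by (simp add: control_field_def scaleR_sum_right)

definition velocity :: "(real^'n \<Rightarrow> real^'n) \<Rightarrow> ('k::finite \<Rightarrow> real^'n \<Rightarrow> real^'n) \<Rightarrow>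
    real \<times> (real^'k) \<Rightarrow> real^'n \<Rightarrow> real^'n" where
  "velocity f g z x = fst z *\<^sub>R f x + control_field g x (snd z)"

lemma continuous_on_velocity [continuous_intros]:
  assumes "continuous_on UNIV f" "\<And>i. continuous_on UNIV (g i)"
    and "continuous_on X z" "continuous_on X y"
  shows "continuous_on X (\<lambda>s. velocity f g (z s) (y s))"
  unfolding velocity_def control_field_def
  by (intro continuous_intros assms(3) continuous_on_compose2[OF assms(1,4)] continuous_on_compose2[OF assms(2,4)] subset_UNIV)

text \<open>The change of time \<open>t = V s\<close>. As \<open>z\<close> is continuous,
  \<open>V\<close> is continuously differentiable with derivative bounded below, so its inverse
  \<theta> is Lipschitz and \<open>u\<close> is continuous. The derivative of \<theta> cancels the
  speed in the velocity, and substitution does the same in the cost.\<close>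

theorem ordinary_control_of_positive_speed:
  fixes f :: "real^'n \<Rightarrow> real^'n" and g :: "'k::finite \<Rightarrow> real^'n \<Rightarrow> real^'n"
  assumes fc: "continuous_on UNIV f" and gc: "\<And>i. continuous_on UNIV (g i)"
    and Lc: "continuous_on UNIV (\<lambda>(y, u). L y u)"
    and S: "0 < S" and zc: "continuous_on {0..S} z" and zpos: "\<And>s. s \<in> {0..S} \<Longrightarrow> 0 < fst (z s)"
    and z1: "integral {0..S} (\<lambda>s. fst (z s)) = 1"
    and y0: "y 0 = x0"
    and dy: "\<And>s. s \<in> {0..S} \<Longrightarrow> (y has_vector_derivative velocity f g (z s) (y s)) (at s within {0..S})"
  obtains x u where "u absolutely_integrable_on {0..1}"
    "caratheodory_solution (\<lambda>t x. f x + control_field g x (u t)) x0 1 x" "x 1 = y S"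
    "ordinary_cost L x u = ereal (integral {0..S} (\<lambda>s. L (y s) (snd (z s) /\<^sub>R fst (z s)) * fst (z s)))"
proof -
  define V where "V s = integral {0..s} (\<lambda>s. fst (z s))" for s
  have fzc: "continuous_on {0..S} (\<lambda>s. fst (z s))"
    using zc by (intro continuous_intros)
  have dV: "(V has_field_derivative fst (z s)) (at s within {0..S})" if "s \<in> {0..S}" for s
    using integral_has_vector_derivative[OF fzc that]
    unfolding V_def has_real_derivative_iff_has_vector_derivative .
  have Vc: "continuous_on {0..S} V"
    using dV by (meson DERIV_continuous_on)
  have V0: "V 0 = 0" and V1: "V S = 1"
    using z1 by (auto simp: V_def)
  \<comment> \<open>Compactness makes the speed uniformly positive; \<open>1 / m\<close> becomes the
    Lipschitz constant of \<theta>, hence \<open>B / m\<close> that of \<open>x\<close>.\<close>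
  obtain m where m: "m > 0" "\<And>s. s \<in> {0..S} \<Longrightarrow> m \<le> fst (z s)"
  proof -
    obtain s0 where "s0 \<in> {0..S}" "\<And>s. s \<in> {0..S} \<Longrightarrow> fst (z s0) \<le> fst (z s)"
      using continuous_attains_inf[OF compact_Icc _ fzc] S by auto
    then show thesis
      using that zpos by blast
  qed
  have Vinc: "m * (t - s) \<le> V t - V s" if "s \<in> {0..S}" "t \<in> {0..S}" "s \<le> t" for s t
  proof -
    have "((\<lambda>s. fst (z s)) has_integral V t - V s) {s..t}"
      using that by (intro fundamental_theorem_of_calculus)
        (auto intro!: has_vector_derivative_within_subset[OF dV[unfolded has_real_derivative_iff_has_vector_derivative]])
    moreover have "((\<lambda>_. m) has_integral m * (t - s)) {s..t}"
      using has_integral_const_real[of m s t] that(3) by (simp add: mult.commute)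
    ultimately show ?thesis
      using that m(2) by (elim has_integral_le[rotated]) auto
  qed
  have Vinj: "inj_on V {0..S}"
  proof (rule linorder_inj_onI)
    fix s t assume "s < t" "s \<in> {0..S}" "t \<in> {0..S}"
    then have "0 < m * (t - s)" "m * (t - s) \<le> V t - V s"
      using m(1) Vinc by auto
    then show "V s \<noteq> V t"
      by linarith
  qed auto
  have Vimg: "V ` {0..S} = {0..1}"
  proof
    show "V ` {0..S} \<subseteq> {0..1}"
    proof
      fix t assume "t \<in> V ` {0..S}"
      then obtain s where s: "s \<in> {0..S}" "t = V s"
        by blast
      have "0 \<le> m * (s - 0)" "m * (s - 0) \<le> V s - V 0" "0 \<le> m * (S - s)" "m * (S - s) \<le> V S - V s"
        using s m(1) S Vinc[of 0 s] Vinc[of s S] by auto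
      then show "t \<in> {0..1}"
        using s(2) V0 V1 by auto
    qed
    show "{0..1} \<subseteq> V ` {0..S}"
    proof
      fix t :: real assume "t \<in> {0..1}"
      then show "t \<in> V ` {0..S}"
        using IVT'[of V 0 t S] Vc S V0 V1 by auto
    qed
  qed
  define \<theta> where "\<theta> = inv_into {0..S} V"
  have \<theta>: "\<theta> t \<in> {0..S}" "V (\<theta> t) = t" if "t \<in> {0..1}" for t
  proof -
    have "t \<in> V ` {0..S}"
      using that Vimg by simp
    then show "\<theta> t \<in> {0..S}" "V (\<theta> t) = t"
      unfolding \<theta>_def by (rule inv_into_into, rule f_inv_into_f)
  qed
  have \<theta>V: "\<theta> (V s) = s" if "s \<in> {0..S}" for s
    unfolding \<theta>_def by (rule inv_into_f_f[OF Vinj that])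
  have \<theta>lip: "\<bar>\<theta> t - \<theta> t'\<bar> \<le> (1 / m) * \<bar>t - t'\<bar>" if "t \<in> {0..1}" "t' \<in> {0..1}" for t t'
    using Vinc[of "\<theta> t" "\<theta> t'"] Vinc[of "\<theta> t'" "\<theta> t"] \<theta>[OF that(1)] \<theta>[OF that(2)] m(1)
    by (cases "\<theta> t \<le> \<theta> t'") (auto simp: field_simps abs_if)
  have \<theta>c: "continuous_on {0..1} \<theta>"
    using continuous_on_inv[OF Vc compact_Icc, of \<theta>] \<theta>V unfolding Vimg by simp
  define x where "x t = y (\<theta> t)" for t
  define u where "u t = snd (z (\<theta> t)) /\<^sub>R fst (z (\<theta> t))" for t
  have yc: "continuous_on {0..S} y"
    using dy by (meson continuous_on_eq_continuous_within has_vector_derivative_continuous)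
  have z\<theta>: "continuous_on {0..1} (\<lambda>t. z (\<theta> t))" and xc: "continuous_on {0..1} x"
    unfolding x_def using \<theta> by (auto intro!: continuous_on_compose2[OF zc \<theta>c] continuous_on_compose2[OF yc \<theta>c])
  have uc: "continuous_on {0..1} u"
    unfolding u_def using zpos \<theta>(1) by (intro continuous_intros z\<theta>) force
  have u_int: "u absolutely_integrable_on {0..1}"
    using uc by (rule absolutely_integrable_continuous_real)
  have "bounded ((\<lambda>s. velocity f g (z s) (y s)) ` {0..S})"
    by (intro compact_imp_bounded compact_continuous_image continuous_on_velocity fc gc zc yc compact_Icc)
  then obtain B where B: "B > 0" "\<And>s. s \<in> {0..S} \<Longrightarrow> norm (velocity f g (z s) (y s)) \<le> B"
    unfolding bounded_pos by auto
  have yle: "norm (y t - y s) \<le> B * (t - s)" if "s \<in> {0..S}" "t \<in> {0..S}" "s \<le> t" for s t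
  proof -
    have "((\<lambda>r. velocity f g (z r) (y r)) has_integral y t - y s) (cbox s t)"
      unfolding box_real using that
      by (intro fundamental_theorem_of_calculus) (auto intro!: has_vector_derivative_within_subset[OF dy])
    then have "norm (y t - y s) \<le> B * measure lborel (cbox s t)"
      using B that by (intro has_integral_bound) auto
    then show ?thesis
      using that(3) by simp
  qed
  have ylip: "norm (y s - y t) \<le> B * \<bar>s - t\<bar>" if "s \<in> {0..S}" "t \<in> {0..S}" for s t
    using yle[of s t] yle[of t s] that by (cases "s \<le> t") (auto simp: norm_minus_commute)
  have "abs_continuous_on {0..1} x"
  proof (rule Lipschitz_imp_abs_continuous_on)
    fix s t :: real assume st: "s \<in> {0..1}" "t \<in> {0..1}"
    have "norm (x s - x t) \<le> B * \<bar>\<theta> s - \<theta> t\<bar>"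
      unfolding x_def using st \<theta> by (intro ylip) auto
    also have "\<dots> \<le> B * ((1 / m) * \<bar>s - t\<bar>)"
      using B(1) st by (intro mult_left_mono \<theta>lip) auto
    finally show "norm (x s - x t) \<le> (B / m) * \<bar>s - t\<bar>"
      by simp
  qed
  \<comment> \<open>Only interior times: there \<theta> takes values in \<open>{0<..<S}\<close>, so
    one-sided restrictions disappear and the inverse function and chain rules apply. The two
    endpoints form a null set.\<close>
  moreover have dx: "(x has_vector_derivative f (x t) + control_field g (x t) (u t)) (at t within {0..1})"
    if t: "t \<in> {0<..<1}" for t
  proof -
    have t01: "t \<in> {0..1}"
      using t by auto
    have "\<theta> t \<noteq> 0" "\<theta> t \<noteq> S"
      using \<theta>(2)[OF t01] V0 V1 t by auto
    then have \<theta>t: "\<theta> t \<in> {0<..<S}"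
      using \<theta>(1)[OF t01] by auto
    have at: "at (\<theta> t) within {0..S} = at (\<theta> t)"
      using \<theta>t by (intro at_within_interior) auto
    have z_pos: "0 < fst (z (\<theta> t))"
      using zpos[OF \<theta>(1)[OF t01]] .
    have "(\<theta> has_field_derivative inverse (fst (z (\<theta> t)))) (at t)"
    proof (rule DERIV_inverse_function[where f = V and a = 0 and b = 1])
      show "(V has_field_derivative fst (z (\<theta> t))) (at (\<theta> t))"
        using dV[OF \<theta>(1)[OF t01]] unfolding at .
      show "isCont \<theta> t"
        using \<theta>c t by (intro continuous_on_interior[of "{0..1}"]) auto
    qed (use z_pos t \<theta> in auto)
    then have "(\<theta> has_vector_derivative inverse (fst (z (\<theta> t)))) (at t)"
      by (simp add: has_real_derivative_iff_has_vector_derivative)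
    moreover have "(y has_vector_derivative velocity f g (z (\<theta> t)) (y (\<theta> t))) (at (\<theta> t))"
      using dy[OF \<theta>(1)[OF t01]] unfolding at .
    ultimately have "(y \<circ> \<theta> has_vector_derivative inverse (fst (z (\<theta> t))) *\<^sub>R velocity f g (z (\<theta> t)) (y (\<theta> t))) (at t)"
      by (rule vector_diff_chain_at)
    moreover have "inverse (fst (z (\<theta> t))) *\<^sub>R velocity f g (z (\<theta> t)) (y (\<theta> t)) = f (x t) + control_field g (x t) (u t)"
      using z_pos unfolding velocity_def u_def x_def control_field_scaleR by (simp add: scaleR_add_right)
    ultimately show ?thesis
      unfolding x_def[abs_def] o_def by (auto intro: has_vector_derivative_at_within)
  qed
  have "{t\<in>{0..1}. \<not> (x has_vector_derivative f (x t) + control_field g (x t) (u t)) (at t within {0..1})}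
      \<subseteq> {0, 1}"
  proof
    fix t assume t: "t \<in> {t\<in>{0..1}.
      \<not> (x has_vector_derivative f (x t) + control_field g (x t) (u t)) (at t within {0..1})}"
    show "t \<in> {0, 1}"
    proof (rule ccontr)
      assume "t \<notin> {0, 1}"
      then have "t \<in> {0<..<1}"
        using t by auto
      then show False
        using dx[of t] t by blast
    qed
  qed
  then have "negligible {t\<in>{0..1}.
      \<not> (x has_vector_derivative f (x t) + control_field g (x t) (u t)) (at t within {0..1})}"
    by (rule negligible_subset[rotated]) simp
  then have "AE t in lebesgue_on {0..1}.
      (x has_vector_derivative f (x t) + control_field g (x t) (u t)) (at t within {0..1})"
    by (subst AE_lebesgue_on_iff_negligible) simp_all
  moreover have x0: "x 0 = x0"
    using \<theta>V[of 0] S V0 y0 by (simp add: x_def)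
  ultimately have sol: "caratheodory_solution (\<lambda>t x. f x + control_field g x (u t)) x0 1 x"
    unfolding caratheodory_solution_def by (intro conjI)
  have x1: "x 1 = y S"
    using \<theta>V[of S] S V1 by (simp add: x_def)
  have Lxu: "continuous_on {0..1} (\<lambda>t. L (x t) (u t))"
    using continuous_on_compose2[OF Lc, of "{0..1}" "\<lambda>t. (x t, u t)"] xc uc by (auto intro: continuous_intros)
  then have "(\<lambda>t. L (x t) (u t)) absolutely_integrable_on {0..1}"
    by (rule absolutely_integrable_continuous_real)
  then have Lint: "integrable (lebesgue_on {0..1}) (\<lambda>t. L (x t) (u t))"
    by (simp add: set_integrable_def integrable_restrict_space)
  have "ordinary_cost L x u = ereal (integral {0..1} (\<lambda>t. L (x t) (u t)))"
    unfolding ordinary_cost_def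
    using ereal_integral_eq_integral[OF Lint AE_I2] lebesgue_integral_eq_integral[OF Lint] by simp
  also have "((\<lambda>s. fst (z s) *\<^sub>R L (x (V s)) (u (V s))) has_integral integral {V 0..V S} (\<lambda>t. L (x t) (u t))) {0..S}"
    using S Vimg V0 V1 by (intro has_integral_substitution[OF _ _ _ Lxu dV]) auto
  then have "((\<lambda>s. L (y s) (snd (z s) /\<^sub>R fst (z s)) * fst (z s)) has_integral integral {0..1} (\<lambda>t. L (x t) (u t))) {0..S}"
    unfolding V0 V1 by (rule has_integral_eq[rotated]) (simp add: x_def u_def \<theta>V)
  then have "integral {0..1} (\<lambda>t. L (x t) (u t)) = integral {0..S} (\<lambda>s. L (y s) (snd (z s) /\<^sub>R fst (z s)) * fst (z s))"
    by (simp add: integral_unique)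
  finally show thesis
    using that u_int sol x1 by blast
qed

section \<open>Generalized controls up to the final parameter\<close>

text \<open>Extracts from the definition of a generalized control what the approximation needs.
  \<open>V\<close> is continuous, nondecreasing and exceeds 1 somewhere, so there is a last
  parameter with \<open>V \<le> 1\<close>, and \<open>V\<close> equals 1 there.\<close>

lemma gen_control_curve_final:
  fixes Z :: "real \<Rightarrow> real \<times> 'b::euclidean_space"
  assumes Z: "Z \<in> gen_control_curves"
  defines "z \<equiv> \<lambda>t. vector_derivative Z (at t)"
  shows "0 < final_param Z" "z absolutely_integrable_on {0..final_param Z}"
    "integral {0..final_param Z} (\<lambda>t. fst (z t)) = 1"
    "AE t in lebesgue_on {0..final_param Z}. 0 \<le> fst (z t)"
proof -
  have AC: "loc_abs_continuous Z" and Z0: "Z 0 = (0, 0)"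
    and ae: "AE t in lebesgue_on {0..}. dot_v Z t \<ge> 0"
    and lim: "Lim at_top (\<lambda>t. ereal (fst (Z t))) > 1"
    using Z unfolding gen_control_curves_def by auto
  have neg: "negligible {t\<in>{0..}. fst (z t) < 0}"
    using ae AE_lebesgue_on_iff_negligible[of "{0..}" "\<lambda>t. dot_v Z t \<ge> 0"]
    by (simp add: dot_v_def z_def not_le)
  \<comment> \<open>\<open>vector_derivative\<close> is meaningful only where \<open>Z\<close> is
    differentiable. This is known almost everywhere in the open interval, so the endpoints join the
    exceptional set.\<close>
  have deriv: "\<exists>N. negligible N \<and>
      (\<forall>t\<in>{0..T} - N. (Z has_vector_derivative z t) (at t within {0..T}))" if "0 \<le> T" for T
  proof -
    have ac: "abs_continuous_on {0..T} Z"
      using AC that unfolding loc_abs_continuous_def by blast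
    define N where "N = {t\<in>{0<..<T}. \<not> Z differentiable (at t)} \<union> {0, T}"
    have "negligible N"
      unfolding N_def by (intro negligible_Un abs_continuous_differentiable[OF ac] negligible_finite) auto
    moreover have "(Z has_vector_derivative z t) (at t within {0..T})" if "t \<in> {0..T} - N" for t
    proof -
      have "Z differentiable (at t)"
        using that unfolding N_def by auto
      then show ?thesis
        unfolding z_def vector_derivative_works by (rule has_vector_derivative_at_within)
    qed
    ultimately show ?thesis
      by blast
  qed
  have z_int: "z absolutely_integrable_on {0..T}" and zZ: "(z has_integral Z T) {0..T}" if "0 \<le> T" for T
  proof -
    have ac: "abs_continuous_on {0..T} Z"
      using AC that unfolding loc_abs_continuous_def by blast
    obtain N where N: "negligible N"
      "\<And>t. t \<in> {0..T} - N \<Longrightarrow> (Z has_vector_derivative z t) (at t within {0..T})"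
      using deriv[OF \<open>0 \<le> T\<close>] by blast
    show "z absolutely_integrable_on {0..T}"
      by (rule absolutely_integrable_abs_continuous_derivative[OF ac N])
    show "(z has_integral Z T) {0..T}"
      using fundamental_theorem_of_calculus_abs_continuous[OF ac \<open>0 \<le> T\<close> N] by (simp add: Z0 flip: zero_prod_def)
  qed
  define V where "V t = fst (Z t)" for t
  have vV: "((\<lambda>t. fst (z t)) has_integral V T) {0..T}" if "0 \<le> T" for T
    using has_integral_linear[OF zZ[OF that] bounded_linear_fst] by (simp add: o_def V_def)
  have Vmono: "V s \<le> V t" if "0 \<le> s" "s \<le> t" for s t
  proof -
    have "((\<lambda>t. fst (z t)) has_integral (V t - V s)) {s..t}"
    proof -
      have st: "0 \<le> s" "0 \<le> t"
        using that by auto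
      have int: "(\<lambda>t. fst (z t)) integrable_on {0..t}"
        using vV[OF st(2)] by (rule has_integral_integrable)
      then have "(\<lambda>t. fst (z t)) integrable_on {s..t}"
        by (rule integrable_on_subinterval) (use st in auto)
      moreover have "integral {0..s} (\<lambda>t. fst (z t)) + integral {s..t} (\<lambda>t. fst (z t)) = integral {0..t} (\<lambda>t. fst (z t))"
        by (rule Henstock_Kurzweil_Integration.integral_combine[OF that int])
      ultimately show ?thesis
        using integral_unique[OF vV[OF st(1)]] integral_unique[OF vV[OF st(2)]] unfolding has_integral_iff by simp
    qed
    \<comment> \<open>The speed may be negative on a null set; clipping it at 0 leaves the integral
      unchanged and makes the integrand nonnegative everywhere.\<close>
    then have "((\<lambda>t. max 0 (fst (z t))) has_integral (V t - V s)) {s..t}"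
      by (rule has_integral_spike[OF neg, rotated]) (use that in auto)
    then have "0 \<le> V t - V s"
      by (rule has_integral_nonneg) auto
    then show ?thesis by simp
  qed
  have "\<exists>t\<ge>0. V t > 1"
  proof (rule ccontr)
    assume "\<not> ?thesis"
    then have le1: "V t \<le> 1" if "0 \<le> t" for t
      using that by force
    \<comment> \<open>The hypothesis on \<open>Lim\<close> becomes usable only once convergence is
      known: the monotone \<open>V\<close> tends to its supremum.\<close>
    let ?l = "SUP t\<in>{0..}. ereal (V t)"
    have "((\<lambda>t. ereal (V t)) \<longlongrightarrow> ?l) at_top"
    proof (rule order_tendstoI)
      fix a assume "a < ?l"
      then obtain t where t: "t \<ge> 0" "a < ereal (V t)"
        unfolding less_SUP_iff by auto
      show "\<forall>\<^sub>F s in at_top. a < ereal (V s)"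
        using eventually_ge_at_top[of t]
      proof eventually_elim
        case (elim s)
        then have "ereal (V t) \<le> ereal (V s)"
          using Vmono t(1) by simp
        then show ?case
          using t(2) by (rule less_le_trans[rotated])
      qed
    next
      fix a assume a: "?l < a"
      show "\<forall>\<^sub>F s in at_top. ereal (V s) < a"
        using eventually_ge_at_top[of "0::real"]
      proof eventually_elim
        case (elim s)
        then have "ereal (V s) \<le> ?l"
          by (intro SUP_upper) auto
        then show ?case
          using a by (rule le_less_trans)
      qed
    qed
    then have "Lim at_top (\<lambda>t. ereal (V t)) = ?l"
      by (intro tendsto_Lim) auto
    moreover have "?l \<le> 1"
      using le1 by (intro SUP_least) (auto simp: one_ereal_def)
    ultimately show False
      using lim unfolding V_def by auto
  qed
  then obtain t1 where t1: "t1 \<ge> 0" "V t1 > 1"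
    by blast
  have Vc: "continuous_on {0..T} V" if "0 \<le> T" for T
  proof (rule continuous_on_eq)
    show "continuous_on {0..T} (\<lambda>t. integral {0..t} (\<lambda>t. fst (z t)))"
      using vV[OF that] by (intro indefinite_integral_continuous_1) blast
    show "integral {0..t} (\<lambda>t. fst (z t)) = V t" if "t \<in> {0..T}" for t
      using that by (intro integral_unique vV) auto
  qed
  define A where "A = {s. s \<ge> 0 \<and> fst (Z s) \<le> 1}"
  define S where "S = final_param Z"
  have S_Sup: "S = Sup A"
    by (simp add: S_def final_param_def A_def)
  have A0: "0 \<in> A"
    by (simp add: A_def Z0)
  have At1: "s \<le> t1" if "s \<in> A" for s
    using that Vmono[OF t1(1), of s] t1(2) unfolding A_def V_def by force
  then have bdd: "bdd_above A"
    by (auto simp: bdd_above_def)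
  have S0: "0 \<le> S"
    unfolding S_Sup by (rule cSup_upper[OF A0 bdd])
  have St1: "S \<le> t1"
    unfolding S_Sup using A0 At1 by (intro cSup_least) auto
  have A_eq: "A = {s\<in>{0..t1}. V s \<le> 1}"
    using At1 by (auto simp: A_def V_def)
  have "closed A"
    unfolding A_eq using Vc[OF t1(1)] by (intro continuous_on_closed_Collect_le) auto
  then have "S \<in> A"
    unfolding S_Sup using A0 bdd by (intro closed_contains_Sup) auto
  then have "V S \<le> 1"
    unfolding A_eq by simp
  \<comment> \<open>The intermediate value theorem gives a parameter beyond or at \<open>S\<close>
    where \<open>V\<close> equals 1. It belongs to \<open>A\<close>, hence coincides with the
    supremum \<open>S\<close>.\<close>
  then obtain s where s: "S \<le> s" "s \<le> t1" "V s = 1"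
    using IVT'[of V S 1 t1] continuous_on_subset[OF Vc[OF t1(1)], of "{S..t1}"] S0 St1 t1(2) by auto
  then have "s \<in> A"
    unfolding A_eq using S0 by auto
  then have "s \<le> S"
    unfolding S_Sup by (rule cSup_upper[OF _ bdd])
  then have VS: "V S = 1"
    using s by simp
  have "V 0 = 0"
    by (simp add: V_def Z0)
  then show "0 < final_param Z"
    using VS S0 unfolding S_def[symmetric] by (cases "S = 0") auto
  show "z absolutely_integrable_on {0..final_param Z}"
    using z_int[OF S0] unfolding S_def .
  show "integral {0..final_param Z} (\<lambda>t. fst (z t)) = 1"
    using integral_unique[OF vV[OF S0]] VS unfolding S_def by simp
  show "AE t in lebesgue_on {0..final_param Z}. 0 \<le> fst (z t)"
    by (subst AE_lebesgue_on_iff_negligible) (auto intro!: negligible_subset[OF neg] simp: not_le)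
qed

section \<open>Comparison of trajectories\<close>

text \<open>A difference of velocities in the state is itself a velocity, for constant fields and
  the dummy state \<open>0\<close>. The single bound \<open>norm_velocity_le\<close> then yields
  both linear growth in the control and the Lipschitz constant in the state.\<close>

lemma velocity_diff_state:
  "velocity f g z x - velocity f g z x' = velocity (\<lambda>_. f x - f x') (\<lambda>i _. g i x - g i x') z 0"
  unfolding velocity_def control_field_def scaleR_diff_right sum_subtractf by (rule add_diff_add)

lemma velocity_diff_control: "velocity f g z x - velocity f g z' x = velocity f g (z - z') x"
  unfolding velocity_def control_field_def fst_diff snd_diff vector_minus_component
    scaleR_diff_left sum_subtractf by (rule add_diff_add)

lemma norm_velocity_le:
  fixes f :: "real^'n \<Rightarrow> real^'n" and g :: "'k::finite \<Rightarrow> real^'n \<Rightarrow> real^'n"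
  assumes "norm (f x) \<le> a" "\<And>i. norm (g i x) \<le> b i"
  shows "norm (velocity f g z x) \<le> (a + (\<Sum>i\<in>UNIV. b i)) * norm z"
proof -
  have "norm (velocity f g z x) \<le> \<bar>fst z\<bar> * norm (f x) + (\<Sum>i\<in>UNIV. \<bar>snd z $ i\<bar> * norm (g i x))"
    unfolding velocity_def control_field_def
    by (rule order_trans[OF norm_triangle_ineq]) (auto intro!: add_mono order_trans[OF norm_sum])
  also have "\<dots> \<le> norm z * a + (\<Sum>i\<in>UNIV. norm z * b i)"
  proof (intro add_mono mult_mono sum_mono assms)
    show "\<bar>fst z\<bar> \<le> norm z"
      using norm_fst_le[of "fst z" "snd z"] by simp
    show "\<bar>snd z $ i\<bar> \<le> norm z" for i
      using component_le_norm_cart[of "snd z" i] norm_snd_le[of "snd z" "fst z"] by simp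
  qed auto
  finally show ?thesis
    by (simp add: algebra_simps sum_distrib_left)
qed

lemma local_lipschitz_imp_continuous:
  fixes f :: "'a::euclidean_space \<Rightarrow> 'b::real_normed_vector"
  assumes "local_lipschitz (UNIV :: real set) UNIV (\<lambda>_. f)"
  shows "continuous_on UNIV f"
  using local_lipschitz_continuous_on[OF assms UNIV_I] .

lemma local_lipschitz_imp_lipschitz_on_compact:
  fixes f :: "'a::euclidean_space \<Rightarrow> 'b::real_normed_vector"
  assumes "local_lipschitz (UNIV :: real set) UNIV (\<lambda>_. f)" "compact K"
  obtains C where "C-lipschitz_on K f"
proof -
  have "local_lipschitz {0::real} K (\<lambda>_. f)"
    by (rule local_lipschitz_subset[OF assms(1)]) auto
  then obtain C where "\<And>t. t \<in> {0::real} \<Longrightarrow> C-lipschitz_on K f"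
    using local_lipschitz_compact_implies_lipschitz[of "{0::real}" K "\<lambda>_. f"] assms(2) by auto
  then show thesis
    using that by blast
qed

text \<open>The fields are only locally Lipschitz; precomposing them with the projection onto a ball
  that contains the given curve in its interior makes them globally Lipschitz.\<close>

lemma trajectory_near_curve:
  fixes f :: "real^'n \<Rightarrow> real^'n" and g :: "'k::finite \<Rightarrow> real^'n \<Rightarrow> real^'n"
  assumes f: "local_lipschitz (UNIV :: real set) UNIV (\<lambda>_. f)"
    and g: "\<And>i. local_lipschitz (UNIV :: real set) UNIV (\<lambda>_. g i)"
    and S: "0 \<le> S" and yc: "continuous_on {0..S} y"
  obtains C where "0 \<le> C"
    "\<forall>\<zeta> e. continuous_on {0..S} \<zeta> \<longrightarrow>
      (\<forall>s\<in>{0..S}. norm (y s - x0 - integral {0..s} (\<lambda>\<tau>. velocity f g (\<zeta> \<tau>) (y \<tau>))) \<le> e) \<longrightarrow>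
      2 * e * exp (2 * (C * integral {0..S} (\<lambda>s. norm (\<zeta> s)))) \<le> 1 \<longrightarrow>
      (\<exists>y'. y' 0 = x0 \<and>
        (\<forall>s\<in>{0..S}. (y' has_vector_derivative velocity f g (\<zeta> s) (y' s)) (at s within {0..S}) \<and>
          norm (y' s - y s) \<le> 2 * e * exp (2 * (C * integral {0..S} (\<lambda>s. norm (\<zeta> s))))))"
proof -
  have "bounded (y ` {0..S})"
    by (intro compact_imp_bounded compact_continuous_image yc compact_Icc)
  then obtain r where "\<forall>x\<in>y ` {0..S}. norm x \<le> r"
    unfolding bounded_iff by blast
  then have r: "\<And>s. s \<in> {0..S} \<Longrightarrow> norm (y s) \<le> r"
    by blast
  \<comment> \<open>A margin of 1 around the curve: the smallness assumption on the error keeps the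
    new trajectory within it, where the projection is the identity.\<close>
  define R where "R = r + 1"
  have R: "0 \<le> R"
    using order_trans[OF norm_ge_zero r[of 0]] S by (simp add: R_def)
  define P where "P = closest_point (cball (0::real^'n) R)"
  have ne: "cball (0::real^'n) R \<noteq> {}"
    using R by simp
  have Pc: "continuous_on X P" for X
    unfolding P_def by (rule continuous_on_closest_point) (use ne in auto)
  have Pmem: "P x \<in> cball 0 R" for x
    unfolding P_def using closest_point_in_set[OF closed_cball ne] .
  have Pid: "P x = x" if "norm x \<le> R" for x
    using that by (simp add: P_def closest_point_self)
  have Plip: "dist (P x) (P x') \<le> dist x x'" for x x'
    unfolding P_def by (rule closest_point_lipschitz) (use ne in auto)
  obtain Cf where Cf: "Cf-lipschitz_on (cball 0 R) f"
    using local_lipschitz_imp_lipschitz_on_compact[OF f compact_cball] .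
  have "\<exists>C. C-lipschitz_on (cball 0 R) (g i)" for i
    using local_lipschitz_imp_lipschitz_on_compact[OF g compact_cball] by metis
  then obtain Cg where Cg: "\<And>i. (Cg i)-lipschitz_on (cball 0 R) (g i)"
    by metis
  have lip: "norm (h (P x) - h (P x')) \<le> D * norm (x - x')" if "D-lipschitz_on (cball 0 R) h"
    for D and h :: "real^'n \<Rightarrow> real^'n" and x x'
  proof -
    have "dist (h (P x)) (h (P x')) \<le> D * dist (P x) (P x')"
      by (rule lipschitz_onD[OF that Pmem Pmem])
    also have "\<dots> \<le> D * dist x x'"
      by (intro mult_left_mono Plip lipschitz_on_nonneg[OF that])
    finally show ?thesis
      by (simp add: dist_norm)
  qed
  \<comment> \<open>Determined by the fields and the ball, not by the control: at time
    \<open>s\<close> the Lipschitz constant is \<open>C * norm (\<zeta> s)\<close>, so controls with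
    bounded L1 norms share one exponential bound.\<close>
  define C where "C = Cf + (\<Sum>i\<in>UNIV. Cg i)"
  have C: "0 \<le> C"
    unfolding C_def by (intro add_nonneg_nonneg sum_nonneg lipschitz_on_nonneg[OF Cf] lipschitz_on_nonneg[OF Cg])
  define H where "H = velocity (\<lambda>x. f (P x)) (\<lambda>i x. g i (P x))"
  have H_lip: "norm (H z x - H z x') \<le> C * norm z * norm (x - x')" for z x x'
  proof -
    have "norm (H z x - H z x') \<le> (Cf * norm (x - x') + (\<Sum>i\<in>UNIV. Cg i * norm (x - x'))) * norm z"
      unfolding H_def velocity_diff_state by (rule norm_velocity_le; rule lip; rule Cf Cg)
    also have "\<dots> = C * norm z * norm (x - x')"
      unfolding C_def sum_distrib_right[symmetric] by (simp add: algebra_simps)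
    finally show ?thesis .
  qed
  have H_eq: "H z x = velocity f g z x" if "norm x \<le> R" for z x
    using Pid[OF that] by (simp add: H_def velocity_def control_field_def)
  have fPc: "continuous_on UNIV (\<lambda>x. f (P x))" and gPc: "\<And>i. continuous_on UNIV (\<lambda>x. g i (P x))"
    by (auto intro!: continuous_on_compose2[OF local_lipschitz_imp_continuous[OF f] Pc]
        continuous_on_compose2[OF local_lipschitz_imp_continuous[OF g] Pc])
  show thesis
  proof (rule that[OF C], intro allI impI)
    fix \<zeta> e
    assume \<zeta>c: "continuous_on {0..S} \<zeta>"
      and "\<forall>s\<in>{0..S}. norm (y s - x0 - integral {0..s} (\<lambda>\<tau>. velocity f g (\<zeta> \<tau>) (y \<tau>))) \<le> e"
      and small: "2 * e * exp (2 * (C * integral {0..S} (\<lambda>s. norm (\<zeta> s)))) \<le> 1"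
    then have res: "\<And>s. s \<in> {0..S} \<Longrightarrow> norm (y s - x0 - integral {0..s} (\<lambda>\<tau>. velocity f g (\<zeta> \<tau>) (y \<tau>))) \<le> e"
      by blast
    have int: "integral {0..S} (\<lambda>s. C * norm (\<zeta> s)) = C * integral {0..S} (\<lambda>s. norm (\<zeta> s))"
      by simp
    obtain y' where y': "y' 0 = x0"
      "\<And>s. s \<in> {0..S} \<Longrightarrow> (y' has_vector_derivative H (\<zeta> s) (y' s)) (at s within {0..S})"
      "\<And>s. s \<in> {0..S} \<Longrightarrow> norm (y' s - y s) \<le> 2 * e * exp (2 * (C * integral {0..S} (\<lambda>s. norm (\<zeta> s))))"
    proof (rule Picard_near_approximate_solution[of S "\<lambda>s. H (\<zeta> s)" "\<lambda>s. C * norm (\<zeta> s)" y x0 e, unfolded int])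
      have "continuous_on ({0..S} \<times> UNIV) (\<lambda>p. H (\<zeta> (fst p)) (snd p))"
        unfolding H_def
        by (intro continuous_on_velocity[OF fPc gPc] continuous_on_compose2[OF \<zeta>c] continuous_intros) auto
      then show "continuous_on ({0..S} \<times> UNIV) (\<lambda>(s, x). H (\<zeta> s) x)"
        by (simp add: case_prod_unfold)
      fix s assume s: "s \<in> {0..S}"
      have "integral {0..s} (\<lambda>\<tau>. H (\<zeta> \<tau>) (y \<tau>)) = integral {0..s} (\<lambda>\<tau>. velocity f g (\<zeta> \<tau>) (y \<tau>))"
        using s r by (intro Henstock_Kurzweil_Integration.integral_cong H_eq) (force simp: R_def)
      then show "norm (y s - x0 - integral {0..s} (\<lambda>\<tau>. H (\<zeta> \<tau>) (y \<tau>))) \<le> e"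
        using res[OF s] by simp
    qed (use S C yc \<zeta>c H_lip in \<open>auto intro!: continuous_intros\<close>)
    have "(y' has_vector_derivative velocity f g (\<zeta> s) (y' s)) (at s within {0..S})" if s: "s \<in> {0..S}" for s
    proof -
      have "norm (y' s) \<le> norm (y s) + norm (y' s - y s)"
        by norm
      also have "\<dots> \<le> R"
        using r[OF s] y'(3)[OF s] small unfolding R_def by linarith
      finally show ?thesis
        using y'(2)[OF s] H_eq by simp
    qed
    then show "\<exists>y'. y' 0 = x0 \<and>
        (\<forall>s\<in>{0..S}. (y' has_vector_derivative velocity f g (\<zeta> s) (y' s)) (at s within {0..S}) \<and>
          norm (y' s - y s) \<le> 2 * e * exp (2 * (C * integral {0..S} (\<lambda>s. norm (\<zeta> s)))))"
      using y'(1,3) by blast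
  qed
qed

section \<open>Approximation by controls of positive speed\<close>

text \<open>Clipping the first component at 0 and adding \<open>1 / Suc n\<close> makes the speed
  positive without disturbing the limit, which is nonnegative almost everywhere. Dividing the speed
  by its integral restores total time 1.\<close>

lemma positive_speed_approximation:
  fixes z :: "real \<Rightarrow> real \<times> 'b::euclidean_space"
  defines "M \<equiv> \<lambda>S. lebesgue_on {0..S}"
  assumes S: "0 < S" and z: "integrable (M S) z" and z0: "AE s in M S. 0 \<le> fst (z s)"
    and z1: "(\<integral>s. fst (z s) \<partial>M S) = 1"
  obtains \<zeta> h where "\<And>j::nat. continuous_on UNIV (\<zeta> j)" "\<And>j s. 0 < fst (\<zeta> j s)"
    "\<And>j. (\<integral>s. fst (\<zeta> j s) \<partial>M S) = 1" "integrable (M S) h"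
    "AE s in M S. (\<forall>j. norm (\<zeta> j s) \<le> h s) \<and> (\<lambda>j. \<zeta> j s) \<longlonglongrightarrow> z s"
proof -
  let ?M = "M S"
  have fin: "finite_measure ?M"
    unfolding M_def using S by (intro finite_measureI) (simp add: emeasure_restrict_space)
  have cm: "k \<in> borel_measurable ?M" if "continuous_on UNIV k" for k :: "real \<Rightarrow> real"
    unfolding M_def using that by (intro continuous_imp_measurable_on_sets_lebesgue) (auto intro: continuous_on_subset)
  obtain G h where G: "\<And>n::nat. continuous_on UNIV (G n)" "integrable ?M h"
    "AE s in ?M. (\<forall>n. norm (G n s) \<le> h s) \<and> (\<lambda>n. G n s) \<longlonglongrightarrow> z s"
    unfolding M_def using integrable_approx_continuous_dominated[OF lmeasurable_cbox[of 0 S, unfolded box_real] z[unfolded M_def]]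
    by blast
  define p where "p n s = max (fst (G n s)) 0 + 1 / real (Suc n)" for n s
  have p0: "0 < p n s" for n s
    unfolding p_def by (intro add_nonneg_pos) auto
  have pc: "continuous_on UNIV (p n)" for n
    unfolding p_def using G(1) by (intro continuous_intros)
  have pae: "AE s in ?M. (\<forall>n. p n s \<le> h s + 1) \<and> (\<lambda>n. p n s) \<longlonglongrightarrow> fst (z s)"
    using G(3) z0
  proof eventually_elim
    case (elim s)
    have "p n s \<le> h s + 1" for n
    proof -
      have "fst (G n s) \<le> norm (G n s)" "0 \<le> norm (G n s)"
        using norm_fst_le[of "fst (G n s)" "snd (G n s)"] by auto
      then have "max (fst (G n s)) 0 \<le> h s"
        using elim(1) by (meson max.boundedI order_trans)
      then show ?thesis
        unfolding p_def by (intro add_mono) (auto simp: divide_simps)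
    qed
    moreover have "(\<lambda>n. p n s) \<longlonglongrightarrow> max (fst (z s)) 0 + 0"
      unfolding p_def using elim(1) lim_inverse_n'[THEN LIMSEQ_Suc]
      by (intro tendsto_add tendsto_max tendsto_fst tendsto_const) auto
    ultimately show ?case
      using elim(2) by simp
  qed
  define c where "c n = (\<integral>s. p n s \<partial>?M)" for n
  have "c \<longlonglongrightarrow> (\<integral>s. fst (z s) \<partial>?M)"
    unfolding c_def
  proof (rule integral_dominated_convergence[where w = "\<lambda>s. h s + 1"])
    show "integrable ?M (\<lambda>s. h s + 1)"
      by (intro Bochner_Integration.integrable_add G(2) finite_measure.integrable_const[OF fin])
    show "AE s in ?M. norm (p n s) \<le> h s + 1" for n
      using pae by eventually_elim (use p0 in \<open>auto simp: less_imp_le\<close>)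
    show "AE s in ?M. (\<lambda>n. p n s) \<longlonglongrightarrow> fst (z s)"
      using pae by eventually_elim auto
    show "(\<lambda>s. fst (z s)) \<in> borel_measurable ?M"
      by (rule measurable_compose[OF borel_measurable_integrable[OF z] borel_measurable_continuous_onI[OF continuous_on_fst[OF continuous_on_id]]])
  qed (rule cm[OF pc])
  then have c1: "c \<longlonglongrightarrow> 1"
    using z1 by simp
  then have "\<forall>\<^sub>F n in sequentially. 1 / 2 < c n"
    by (intro order_tendstoD(1)) auto
  then obtain n0 where n0: "\<And>n. n \<ge> n0 \<Longrightarrow> 1 / 2 < c n"
    unfolding eventually_sequentially by blast
  \<comment> \<open>Past \<open>n0\<close> the divisor exceeds \<open>1 / 2\<close>, so
    normalisation at most doubles the speed; the index shift makes this hold for every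
    \<open>j\<close>. In the dominating function, \<open>2 * (h s + 1)\<close> bounds the speed and
    \<open>h s\<close> the second component.\<close>
  define \<zeta> where "\<zeta> j s = (p (j + n0) s / c (j + n0), snd (G (j + n0) s))" for j s
  have cpos: "1 / 2 < c (j + n0)" for j
    by (rule n0) simp
  show thesis
  proof (rule that[of \<zeta> "\<lambda>s. 2 * (h s + 1) + h s"])
    show "continuous_on UNIV (\<zeta> j)" for j
      unfolding \<zeta>_def using pc G(1) cpos[of j] by (intro continuous_intros) auto
    show "0 < fst (\<zeta> j s)" for j s
      unfolding \<zeta>_def using p0[of "j + n0" s] cpos[of j] by simp
    show "(\<integral>s. fst (\<zeta> j s) \<partial>?M) = 1" for j
      unfolding \<zeta>_def using cpos[of j] by (simp add: c_def[symmetric])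
    show "integrable ?M (\<lambda>s. 2 * (h s + 1) + h s)"
      by (intro Bochner_Integration.integrable_add integrable_mult_right G(2) finite_measure.integrable_const[OF fin])
    show "AE s in ?M. (\<forall>j. norm (\<zeta> j s) \<le> 2 * (h s + 1) + h s) \<and> (\<lambda>j. \<zeta> j s) \<longlonglongrightarrow> z s"
      using G(3) pae
    proof eventually_elim
      case (elim s)
      have "norm (\<zeta> j s) \<le> 2 * (h s + 1) + h s" for j
      proof -
        have "norm (\<zeta> j s) \<le> \<bar>p (j + n0) s / c (j + n0)\<bar> + norm (snd (G (j + n0) s))"
          unfolding \<zeta>_def using norm_Pair_le[of "p (j + n0) s / c (j + n0)" "snd (G (j + n0) s)"] by simp
        also have "\<bar>p (j + n0) s / c (j + n0)\<bar> = p (j + n0) s / c (j + n0)"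
          using p0[of "j + n0" s] cpos[of j] by simp
        also have "\<dots> \<le> p (j + n0) s / (1 / 2)"
          using p0[of "j + n0" s] cpos[of j] by (intro divide_left_mono) auto
        also have "\<dots> \<le> 2 * (h s + 1)"
          using conjunct1[OF elim(2), rule_format, of "j + n0"] by simp
        also have "norm (snd (G (j + n0) s)) \<le> h s"
          using elim(1) norm_snd_le[of "snd (G (j + n0) s)" "fst (G (j + n0) s)"]
          by (simp add: order_trans)
        finally show ?thesis
          by simp
      qed
      moreover have "(\<lambda>n. (p n s / c n, snd (G n s))) \<longlonglongrightarrow> (fst (z s) / 1, snd (z s))"
        using elim c1 by (intro tendsto_intros) auto
      from LIMSEQ_ignore_initial_segment[OF this, of n0]
      have "(\<lambda>j. \<zeta> j s) \<longlonglongrightarrow> z s"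
        unfolding \<zeta>_def by simp
      ultimately show ?case by blast
    qed
  qed
qed

section \<open>Convergence of costs and the limit in the tolerance\<close>

text \<open>For each tolerance, a tail of the approximating ordinary controls is admissible, so the
  ordinary infimum lies below all their costs and hence below the limit of these costs, which is the
  generalized cost.\<close>

theorem ordinary_inf_le_gen_cost:
  fixes f :: "real^'n \<Rightarrow> real^'n" and g :: "'k::finite \<Rightarrow> real^'n \<Rightarrow> real^'n"
    and L :: "real^'n \<Rightarrow> real^'k \<Rightarrow> real"
  assumes f: "local_lipschitz (UNIV :: real set) UNIV (\<lambda>_. f)"
    and g: "\<And>i. local_lipschitz (UNIV :: real set) UNIV (\<lambda>_. g i)"
    and L: "continuous_on UNIV (\<lambda>(y, u). L y u)"
    and \<lambda>: "continuous_on (UNIV \<times> half_ball) (\<lambda>(y, v, w). aux_lagrangian L y v w)"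
    and Z: "Z \<in> gen_control_curves"
    and sol: "caratheodory_solution
      (\<lambda>t y. dot_v Z t *\<^sub>R f y + control_field g y (dot_w Z t)) x0 (final_param Z) y"
    and \<epsilon>: "0 < \<epsilon>"
  shows "ordinary_inf f g L x0 (y (final_param Z)) \<epsilon> \<le> gen_cost L y Z"
proof -
  interpret continuous_aux_lagrangian L
    by unfold_locales (rule \<lambda>)
  note fc = local_lipschitz_imp_continuous[OF f] and gc = local_lipschitz_imp_continuous[OF g]
  define S where "S = final_param Z"
  let ?M = "lebesgue_on {0..S}"
  define z where "z t = vector_derivative Z (at t)" for t
  have S: "0 < S" and z_abs: "z absolutely_integrable_on {0..S}"
    and z1: "integral {0..S} (\<lambda>t. fst (z t)) = 1" and z0: "AE t in ?M. 0 \<le> fst (z t)"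
    using gen_control_curve_final[OF Z] unfolding S_def z_def[abs_def] by auto
  have S0: "0 \<le> S"
    using S by simp
  have abs_iff: "integrable ?M k \<longleftrightarrow> k absolutely_integrable_on {0..S}" for k :: "real \<Rightarrow> 'c::euclidean_space"
    by (simp add: set_integrable_def integrable_restrict_space)
  have LINT: "integral\<^sup>L ?M k = integral {0..S} k" if "integrable ?M k" for k :: "real \<Rightarrow> real"
    using lebesgue_integral_eq_integral[OF that] by simp
  have cint: "integrable ?M k" if "continuous_on {0..S} k" for k :: "real \<Rightarrow> 'c::euclidean_space"
    unfolding abs_iff by (rule absolutely_integrable_continuous_real[OF that])
  have z_int: "integrable ?M z"
    using z_abs unfolding abs_iff .
  have fz_int: "integrable ?M (\<lambda>t. fst (z t))"
    using integrable_bounded_linear[OF bounded_linear_fst z_int] .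
  have z1': "(\<integral>t. fst (z t) \<partial>?M) = 1"
    using LINT[OF fz_int] z1 by simp
  have vel: "dot_v Z t *\<^sub>R f x + control_field g x (dot_w Z t) = velocity f g (z t) x" for t x
    by (simp add: velocity_def dot_v_def dot_w_def z_def)
  have y_ac: "abs_continuous_on {0..S} y" and y0: "y 0 = x0"
    and y_ae: "AE t in ?M. (y has_vector_derivative velocity f g (z t) (y t)) (at t within {0..S})"
    using sol unfolding caratheodory_solution_def S_def[symmetric] vel by auto
  define N where "N = {t\<in>{0..S}. \<not> (y has_vector_derivative velocity f g (z t) (y t)) (at t within {0..S})}"
  have N: "negligible N"
    using y_ae unfolding N_def by (subst (asm) AE_lebesgue_on_iff_negligible) auto
  have y_int: "((\<lambda>\<tau>. velocity f g (z \<tau>) (y \<tau>)) has_integral y s - x0) {0..s}" if s: "s \<in> {0..S}" for s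
    unfolding y0[symmetric]
  proof (rule fundamental_theorem_of_calculus_abs_continuous[OF _ _ N])
    show "abs_continuous_on {0..s} y"
      using s by (intro abs_continuous_on_subset[OF y_ac]) auto
    fix t assume "t \<in> {0..s} - N"
    then have "(y has_vector_derivative velocity f g (z t) (y t)) (at t within {0..S})"
      using s unfolding N_def by auto
    then show "(y has_vector_derivative velocity f g (z t) (y t)) (at t within {0..s})"
      by (rule has_vector_derivative_within_subset) (use s in auto)
  qed (use s in auto)
  have yc: "continuous_on {0..S} y"
  proof (rule continuous_on_eq)
    show "continuous_on {0..S} (\<lambda>s. x0 + integral {0..s} (\<lambda>\<tau>. velocity f g (z \<tau>) (y \<tau>)))"
      using has_integral_integrable[OF y_int[of S]] S0
      by (intro continuous_intros indefinite_integral_continuous_1) auto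
    show "x0 + integral {0..s} (\<lambda>\<tau>. velocity f g (z \<tau>) (y \<tau>)) = y s" if "s \<in> {0..S}" for s
      using integral_unique[OF y_int[OF that]] by simp
  qed
  have bdd: "\<exists>b. \<forall>s\<in>{0..S}. norm (k s) \<le> b" if "continuous_on {0..S} k" for k :: "real \<Rightarrow> real^'n"
    using compact_imp_bounded[OF compact_continuous_image[OF that compact_Icc]] unfolding bounded_iff by auto
  obtain r where r: "\<And>s. s \<in> {0..S} \<Longrightarrow> norm (y s) \<le> r"
    using bdd[OF yc] by blast
  \<comment> \<open>Bounds the fields along the curve \<open>y\<close> alone; it is later applied to
    the difference of \<open>z\<close> and its approximants.\<close>
  have "\<exists>m\<ge>0. \<forall>s\<in>{0..S}. \<forall>\<zeta>. norm (velocity f g \<zeta> (y s)) \<le> m * norm \<zeta>"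
  proof -
    have cf: "continuous_on {0..S} (\<lambda>s. f (y s))" and cg: "\<And>i. continuous_on {0..S} (\<lambda>s. g i (y s))"
      by (auto intro!: continuous_on_compose2[OF fc yc] continuous_on_compose2[OF gc yc])
    obtain a where a: "\<And>s. s \<in> {0..S} \<Longrightarrow> norm (f (y s)) \<le> a"
      using bdd[OF cf] by blast
    obtain b where b: "\<And>i s. s \<in> {0..S} \<Longrightarrow> norm (g i (y s)) \<le> b i"
      using bdd[OF cg] by metis
    have "0 \<le> a" "\<And>i. 0 \<le> b i"
      using order_trans[OF norm_ge_zero a[of 0]] order_trans[OF norm_ge_zero b[of 0]] S0 by auto
    then have "0 \<le> a + (\<Sum>i\<in>UNIV. b i)"
      by (intro add_nonneg_nonneg sum_nonneg)
    then show ?thesis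
      using norm_velocity_le[where f = f and g = g, OF a b] by blast
  qed
  then obtain m where m: "0 \<le> m" "\<And>s \<zeta>. s \<in> {0..S} \<Longrightarrow> norm (velocity f g \<zeta> (y s)) \<le> m * norm \<zeta>"
    by blast
  obtain C where C: "0 \<le> C"
    "\<forall>\<zeta> e. continuous_on {0..S} \<zeta> \<longrightarrow>
      (\<forall>s\<in>{0..S}. norm (y s - x0 - integral {0..s} (\<lambda>\<tau>. velocity f g (\<zeta> \<tau>) (y \<tau>))) \<le> e) \<longrightarrow>
      2 * e * exp (2 * (C * integral {0..S} (\<lambda>s. norm (\<zeta> s)))) \<le> 1 \<longrightarrow>
      (\<exists>y'. y' 0 = x0 \<and>
        (\<forall>s\<in>{0..S}. (y' has_vector_derivative velocity f g (\<zeta> s) (y' s)) (at s within {0..S}) \<and>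
          norm (y' s - y s) \<le> 2 * e * exp (2 * (C * integral {0..S} (\<lambda>s. norm (\<zeta> s))))))"
    by (rule trajectory_near_curve[where g = g and ?x0.0 = x0, OF f g S0 yc])
  obtain \<zeta> h where \<zeta>: "\<And>j::nat. continuous_on UNIV (\<zeta> j)" "\<And>j s. 0 < fst (\<zeta> j s)"
    "\<And>j. (\<integral>s. fst (\<zeta> j s) \<partial>?M) = 1" "integrable ?M h"
    "AE s in ?M. (\<forall>j. norm (\<zeta> j s) \<le> h s) \<and> (\<lambda>j. \<zeta> j s) \<longlonglongrightarrow> z s"
  proof (rule positive_speed_approximation[OF S z_int z0 z1'], goal_cases)
    case (1 \<zeta> h)
    show thesis
      by (rule 1(1)[OF 1(2-)])
  qed
  have \<zeta>c: "continuous_on {0..S} (\<zeta> j)" for j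
    using \<zeta>(1) by (rule continuous_on_subset) auto
  have \<zeta>_int: "integrable ?M (\<zeta> j)" for j
    by (rule cint[OF \<zeta>c])
  \<comment> \<open>Residual of \<open>y\<close> in the equation with control
    \<open>\<zeta> j\<close>: \<open>y\<close> solves the equation with \<open>z\<close>, and the
    velocity is linear in the control.\<close>
  define e where "e j = m * (\<integral>s. norm (z s - \<zeta> j s) \<partial>?M)" for j
  have e0: "0 \<le> e j" for j
    unfolding e_def using m(1) by (intro mult_nonneg_nonneg integral_nonneg_AE) auto
  have res: "norm (y s - x0 - integral {0..s} (\<lambda>\<tau>. velocity f g (\<zeta> j \<tau>) (y \<tau>))) \<le> e j"
    if s: "s \<in> {0..S}" for s j
  proof -
    have sub: "{0..s} \<subseteq> {0..S}"
      using s by auto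
    have vc: "(\<lambda>\<tau>. velocity f g (\<zeta> j \<tau>) (y \<tau>)) integrable_on {0..s}"
      using sub by (intro integrable_continuous_real continuous_on_velocity[where g = g, OF fc gc]
          continuous_on_subset[OF \<zeta>c] continuous_on_subset[OF yc])
    have "y s - x0 - integral {0..s} (\<lambda>\<tau>. velocity f g (\<zeta> j \<tau>) (y \<tau>))
        = integral {0..s} (\<lambda>\<tau>. velocity f g (z \<tau> - \<zeta> j \<tau>) (y \<tau>))"
      using Henstock_Kurzweil_Integration.integral_diff[OF has_integral_integrable[OF y_int[OF s]] vc]
        integral_unique[OF y_int[OF s]]
      unfolding velocity_diff_control by simp
    moreover have ni: "(\<lambda>\<tau>. norm (z \<tau> - \<zeta> j \<tau>)) absolutely_integrable_on {0..S}"
      using z_int \<zeta>_int unfolding abs_iff[symmetric] by (intro integrable_norm Bochner_Integration.integrable_diff)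
    then have "(\<lambda>\<tau>. m * norm (z \<tau> - \<zeta> j \<tau>)) integrable_on {0..S}"
      by (intro integrable_on_mult_right) (auto simp: absolutely_integrable_on_def)
    then have mi: "(\<lambda>\<tau>. m * norm (z \<tau> - \<zeta> j \<tau>)) integrable_on {0..S}" "(\<lambda>\<tau>. m * norm (z \<tau> - \<zeta> j \<tau>)) integrable_on {0..s}"
      using sub by (auto intro: integrable_on_subinterval)
    have "(\<lambda>\<tau>. velocity f g (z \<tau> - \<zeta> j \<tau>) (y \<tau>)) integrable_on {0..s}"
      using Henstock_Kurzweil_Integration.integrable_diff[OF has_integral_integrable[OF y_int[OF s]] vc]
      unfolding velocity_diff_control .
    then have "norm (integral {0..s} (\<lambda>\<tau>. velocity f g (z \<tau> - \<zeta> j \<tau>) (y \<tau>))) \<le> integral {0..s} (\<lambda>\<tau>. m * norm (z \<tau> - \<zeta> j \<tau>))"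
      using mi sub m(2) by (intro integral_norm_bound_integral) auto
    moreover have "\<dots> \<le> integral {0..S} (\<lambda>\<tau>. m * norm (z \<tau> - \<zeta> j \<tau>))"
      using mi sub m(1) by (intro integral_subset_le) auto
    moreover have "\<dots> = e j"
      unfolding e_def LINT[OF iffD2[OF abs_iff ni]] by simp
    ultimately show ?thesis
      by simp
  qed
  have "(\<lambda>j. \<integral>s. norm (z s - \<zeta> j s) \<partial>?M) \<longlonglongrightarrow> (\<integral>s. 0 \<partial>?M)"
  proof (rule integral_dominated_convergence[where w = "\<lambda>s. norm (z s) + h s"])
    show "AE s in ?M. (\<lambda>j. norm (z s - \<zeta> j s)) \<longlonglongrightarrow> 0"
      using \<zeta>(5)
    proof eventually_elim
      case (elim s)
      then have "(\<lambda>j. norm (z s - \<zeta> j s)) \<longlonglongrightarrow> norm (z s - z s)"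
        by (intro tendsto_intros) auto
      then show ?case by simp
    qed
    show "AE s in ?M. norm (norm (z s - \<zeta> j s)) \<le> norm (z s) + h s" for j
      using \<zeta>(5)
    proof eventually_elim
      case (elim s)
      then have "norm (\<zeta> j s) \<le> h s"
        by blast
      then show ?case
        using norm_triangle_ineq4[of "z s" "\<zeta> j s"] by simp
    qed
    show "(\<lambda>s. norm (z s - \<zeta> j s)) \<in> borel_measurable ?M" for j
      using z_int \<zeta>_int[of j] by measurable
  qed (use z_int \<zeta>(4) in auto)
  then have e_lim: "e \<longlonglongrightarrow> 0"
    unfolding e_def by (auto intro!: tendsto_eq_intros)
  \<comment> \<open>The L1 norm of \<open>\<zeta> j\<close> is replaced by the integral of
    \<open>h\<close>, so the exponential no longer depends on \<open>j\<close> and \<open>B\<close>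
    tends to 0 with \<open>e\<close>.\<close>
  define B where "B j = 2 * e j * exp (2 * (C * (\<integral>s. h s \<partial>?M)))" for j
  have B_lim: "B \<longlonglongrightarrow> 0"
    unfolding B_def by (auto intro!: tendsto_eq_intros e_lim)
  have B: "2 * e j * exp (2 * (C * integral {0..S} (\<lambda>s. norm (\<zeta> j s)))) \<le> B j" for j
  proof -
    have "AE s in ?M. norm (\<zeta> j s) \<le> h s"
      using \<zeta>(5) by eventually_elim auto
    then have "(\<integral>s. norm (\<zeta> j s) \<partial>?M) \<le> (\<integral>s. h s \<partial>?M)"
      by (intro integral_mono_AE integrable_norm \<zeta>_int \<zeta>(4))
    then have "integral {0..S} (\<lambda>s. norm (\<zeta> j s)) \<le> (\<integral>s. h s \<partial>?M)"
      using LINT[OF integrable_norm[OF \<zeta>_int]] by simp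
    then show ?thesis
      unfolding B_def using e0[of j] C(1) by (intro mult_left_mono) (auto intro: mult_left_mono)
  qed
  have "\<forall>\<^sub>F j in sequentially. B j < min 1 \<epsilon>"
    using \<epsilon> by (intro order_tendstoD(2)[OF B_lim]) auto
  \<comment> \<open>From \<open>j0\<close> on, the bound 1 meets the smallness condition of
    \<open>trajectory_near_curve\<close>, and the bound \<epsilon> makes the endpoint
    admissible.\<close>
  then obtain j0 where j0: "\<And>j. j \<ge> j0 \<Longrightarrow> B j < min 1 \<epsilon>"
    unfolding eventually_sequentially by blast
  define \<xi> where "\<xi> j = \<zeta> (j + j0)" for j
  have Bj: "B (j + j0) < 1" "B (j + j0) < \<epsilon>" for j
    using j0[of "j + j0"] by auto
  have "\<exists>y'. y' 0 = x0 \<and>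
      (\<forall>s\<in>{0..S}. (y' has_vector_derivative velocity f g (\<xi> j s) (y' s)) (at s within {0..S}) \<and>
        norm (y' s - y s) \<le> B (j + j0))" for j
  proof -
    have "2 * e (j + j0) * exp (2 * (C * integral {0..S} (\<lambda>s. norm (\<zeta> (j + j0) s)))) \<le> 1"
      using B[of "j + j0"] Bj(1)[of j] by linarith
    from C(2)[rule_format, OF \<zeta>c res this]
    show ?thesis
      using B[of "j + j0"] unfolding \<xi>_def by (meson order_trans)
  qed
  then obtain Y where Y: "\<And>j. Y j 0 = x0"
    "\<And>j s. s \<in> {0..S} \<Longrightarrow> (Y j has_vector_derivative velocity f g (\<xi> j s) (Y j s)) (at s within {0..S})"
    "\<And>j s. s \<in> {0..S} \<Longrightarrow> norm (Y j s - y s) \<le> B (j + j0)"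
    by metis
  have Yc: "continuous_on {0..S} (Y j)" for j
    using Y(2) by (meson continuous_on_eq_continuous_within has_vector_derivative_continuous)
  \<comment> \<open>The speed of \<open>z\<close> is nonnegative only almost everywhere. Clipping it
    extends the Lagrangian continuously to all arguments, which gives measurability along
    \<open>z\<close> and pointwise limits at once.\<close>
  define \<Lambda> where "\<Lambda> p = real_lagrangian (fst p) (max (fst (snd p)) 0, snd (snd p))" for p
  have \<Lambda>c: "continuous_on UNIV \<Lambda>"
  proof -
    have "continuous_on UNIV (\<lambda>p::(real^'n) \<times> real \<times> (real^'k). (fst p, max (fst (snd p)) 0, snd (snd p)))"
      by (intro continuous_intros)
    from continuous_on_compose2[OF continuous_on_real_lagrangian this] show ?thesis
      by (simp add: \<Lambda>_def[abs_def] image_subset_iff)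
  qed
  have \<Lambda>_eq: "\<Lambda> (x, \<omega>) = real_lagrangian x \<omega>" if "0 \<le> fst \<omega>" for x \<omega>
    using that by (cases \<omega>) (simp add: \<Lambda>_def max_def)
  have \<xi>c: "continuous_on {0..S} (\<xi> j)" for j
    unfolding \<xi>_def by (rule \<zeta>c)
  define c where "c j = (\<integral>s. \<Lambda> (Y j s, \<xi> j s) \<partial>?M)" for j
  have \<Lambda>Y: "continuous_on {0..S} (\<lambda>s. \<Lambda> (Y j s, \<xi> j s))" for j
    by (intro continuous_on_compose2[OF \<Lambda>c] continuous_on_Pair Yc \<xi>c) auto
  have \<xi>pos: "0 < fst (\<xi> j s)" for j s
    unfolding \<xi>_def by (rule \<zeta>(2))
  have ord: "ordinary_inf f g L x0 (y S) \<epsilon> \<le> ereal (c j)" for j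
  proof -
    have \<xi>1: "integral {0..S} (\<lambda>s. fst (\<xi> j s)) = 1"
      using \<zeta>(3)[of "j + j0"] LINT[of "\<lambda>s. fst (\<xi> j s)"] cint[of "\<lambda>s. fst (\<xi> j s)"] \<xi>c[of j]
      unfolding \<xi>_def by (simp add: continuous_on_fst)
    obtain x u where xu: "u absolutely_integrable_on {0..1}"
      "caratheodory_solution (\<lambda>t x. f x + control_field g x (u t)) x0 1 x" "x 1 = Y j S"
      "ordinary_cost L x u = ereal (integral {0..S} (\<lambda>s. L (Y j s) (snd (\<xi> j s) /\<^sub>R fst (\<xi> j s)) * fst (\<xi> j s)))"
      by (rule ordinary_control_of_positive_speed[where g = g, OF fc gc L S \<xi>c[of j] \<xi>pos \<xi>1 Y(1)[of j] Y(2)[of _ j]])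
    have "L (Y j s) (snd (\<xi> j s) /\<^sub>R fst (\<xi> j s)) * fst (\<xi> j s) = \<Lambda> (Y j s, \<xi> j s)" for s
      using \<zeta>(2)[of "j + j0" s] unfolding \<xi>_def by (simp add: \<Lambda>_eq less_imp_le real_lagrangian_pos)
    then have "ordinary_cost L x u = ereal (c j)"
      unfolding xu(4) c_def LINT[OF cint[OF \<Lambda>Y]] by simp
    moreover have "norm (x 1 - y S) \<le> \<epsilon>"
      unfolding xu(3) using Y(3)[of S j] Bj(2)[of j] S0 by simp
    ultimately show ?thesis
      unfolding ordinary_inf_def using xu(1,2) by (intro Inf_lower) (auto intro!: exI[of _ x] exI[of _ u])
  qed
  \<comment> \<open>All \<open>Y j\<close> stay within distance 1 of \<open>y\<close>, hence in this
    ball, and one growth constant serves every \<open>j\<close>.\<close>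
  obtain D where D: "0 \<le> D"
    "\<And>x \<omega>. x \<in> cball 0 (r + 1) \<Longrightarrow> 0 \<le> fst \<omega> \<Longrightarrow> \<bar>real_lagrangian x \<omega>\<bar> \<le> D * norm \<omega>"
    using real_lagrangian_bound[OF compact_cball] by blast
  have Yr: "Y j s \<in> cball 0 (r + 1)" if "s \<in> {0..S}" for j s
  proof -
    have "norm (Y j s) \<le> norm (y s) + norm (Y j s - y s)"
      by norm
    then show ?thesis
      using r[OF that] Y(3)[OF that, of j] Bj(1)[of j] by simp
  qed
  have \<Lambda>z_meas: "(\<lambda>s. \<Lambda> (y s, z s)) \<in> borel_measurable ?M"
    using borel_measurable_integrable[OF z_int] borel_measurable_integrable[OF cint[OF yc]]
    by (intro measurable_compose[OF borel_measurable_Pair borel_measurable_continuous_onI[OF \<Lambda>c]])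
  have Dh: "integrable ?M (\<lambda>s. D * h s)"
    using \<zeta>(4) by (rule integrable_mult_right)
  have dom: "AE s in ?M. norm (\<Lambda> (Y j s, \<xi> j s)) \<le> D * h s" for j
    using \<zeta>(5) AE_space
  proof eventually_elim
    case (elim s)
    then have "norm (\<xi> j s) \<le> h s" and s: "s \<in> {0..S}"
      unfolding \<xi>_def by auto
    then have "D * norm (\<xi> j s) \<le> D * h s"
      using D(1) by (intro mult_left_mono)
    moreover have "0 \<le> fst (\<xi> j s)"
      using \<zeta>(2) unfolding \<xi>_def by (simp add: less_imp_le)
    ultimately show ?case
      using D(2)[OF Yr[OF s, of j], of "\<xi> j s"] by (simp add: \<Lambda>_eq)
  qed
  have conv: "AE s in ?M. (\<lambda>j. \<Lambda> (Y j s, \<xi> j s)) \<longlonglongrightarrow> \<Lambda> (y s, z s)"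
    using \<zeta>(5) AE_space
  proof eventually_elim
    case (elim s)
    have s: "s \<in> {0..S}"
      using elim(2) by simp
    have "(\<lambda>j. \<xi> j s) \<longlonglongrightarrow> z s"
      unfolding \<xi>_def using elim(1) by (intro LIMSEQ_ignore_initial_segment) auto
    moreover have "(\<lambda>j. Y j s - y s) \<longlonglongrightarrow> 0"
      by (rule Lim_null_comparison[OF _ LIMSEQ_ignore_initial_segment[OF B_lim, of j0]]) (use Y(3)[OF s] in auto)
    then have "(\<lambda>j. Y j s) \<longlonglongrightarrow> y s"
      unfolding LIM_zero_iff .
    ultimately show ?case
      by (intro continuous_on_tendsto_compose[OF \<Lambda>c] tendsto_Pair) auto
  qed
  have \<Lambda>Y_meas: "(\<lambda>s. \<Lambda> (Y j s, \<xi> j s)) \<in> borel_measurable ?M" for j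
    using cint[OF \<Lambda>Y] by (rule borel_measurable_integrable)
  have c_lim: "c \<longlonglongrightarrow> (\<integral>s. \<Lambda> (y s, z s) \<partial>?M)"
    unfolding c_def by (rule integral_dominated_convergence[OF \<Lambda>z_meas \<Lambda>Y_meas Dh conv dom])
  have \<Lambda>z_int: "integrable ?M (\<lambda>s. \<Lambda> (y s, z s))"
    by (rule integrable_dominated_convergence[OF \<Lambda>z_meas \<Lambda>Y_meas Dh conv dom])
  have "AE s in ?M. aux_lagrangian L (y s) (dot_v Z s) (dot_w Z s) = ereal (\<Lambda> (y s, z s))"
    using z0
  proof eventually_elim
    case (elim s)
    then show ?case
      by (simp add: \<Lambda>_eq ereal_real_lagrangian dot_v_def dot_w_def z_def)
  qed
  then have "gen_cost L y Z = ereal (\<integral>s. \<Lambda> (y s, z s) \<partial>?M)"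
    unfolding gen_cost_def S_def[symmetric] by (rule ereal_integral_eq_integral[OF \<Lambda>z_int])
  moreover have "(\<lambda>j. ereal (c j)) \<longlonglongrightarrow> ereal (\<integral>s. \<Lambda> (y s, z s) \<partial>?M)"
    using c_lim by simp
  then have "ordinary_inf f g L x0 (y S) \<epsilon> \<le> ereal (\<integral>s. \<Lambda> (y s, z s) \<partial>?M)"
    by (rule tendsto_lowerbound) (auto simp: ord)
  ultimately show ?thesis
    unfolding S_def by simp
qed

text \<open>\<open>Lim\<close> is informative only for a convergent function; an antimonotone one
  converges at 0 from the right to its supremum over positive arguments.\<close>

lemma Lim_at_right_antimono_le:
  fixes \<phi> :: "real \<Rightarrow> 'a::{complete_linorder, linorder_topology}"
  assumes anti: "\<And>s t. 0 < s \<Longrightarrow> s \<le> t \<Longrightarrow> \<phi> t \<le> \<phi> s" and le: "\<And>t. 0 < t \<Longrightarrow> \<phi> t \<le> b"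
  shows "Lim (at_right 0) \<phi> \<le> b"
proof -
  have "(\<phi> \<longlongrightarrow> (SUP t\<in>{0<..}. \<phi> t)) (at_right 0)"
  proof (rule order_tendstoI)
    fix a assume "a < (SUP t\<in>{0<..}. \<phi> t)"
    then obtain t where t: "0 < t" "a < \<phi> t"
      unfolding less_SUP_iff by auto
    show "\<forall>\<^sub>F s in at_right 0. a < \<phi> s"
      using eventually_at_right_less[of "0::real"] eventually_at_right_real[OF t(1)]
      by eventually_elim (use anti t in \<open>force intro: less_le_trans\<close>)
  next
    fix a assume a: "(SUP t\<in>{0<..}. \<phi> t) < a"
    show "\<forall>\<^sub>F s in at_right 0. \<phi> s < a"
      using eventually_at_right_less[of "0::real"]
      by eventually_elim (auto intro: le_less_trans[OF SUP_upper a])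
  qed
  then have "Lim (at_right 0) \<phi> = (SUP t\<in>{0<..}. \<phi> t)"
    by (intro tendsto_Lim) auto
  then show ?thesis
    using le by (auto intro: SUP_least)
qed

theorem proposition36:
  fixes f :: "real^'n \<Rightarrow> real^'n"
    and g :: "'k::finite \<Rightarrow> real^'n \<Rightarrow> real^'n"
    and L :: "real^'n \<Rightarrow> real^'k \<Rightarrow> real"
    and x0 x1 :: "real^'n"
  assumes "local_lipschitz (UNIV :: real set) UNIV (\<lambda>_. f)"
    and "\<And>i. local_lipschitz (UNIV :: real set) UNIV (\<lambda>_. g i)"
    and "continuous_on UNIV (\<lambda>(y, u). L y u)"
    and "\<And>y. convex_on UNIV (L y)"
    and "continuous_on (UNIV \<times> half_ball) (\<lambda>(y, v, w). aux_lagrangian L y v w)"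
  shows "\<not> lavrentiev_gap f g L x0 x1"
proof
  assume "lavrentiev_gap f g L x0 x1"
  \<comment> \<open>The infimum need not be attained, but since it is strictly below the limit, some
    admissible curve already has cost below the limit.\<close>
  then obtain y Z C where yZ: "gen_cost L y Z < Lim (at_right 0) (ordinary_inf f g L x0 x1)"
    "C \<in> gen_controls" "Z \<in> C" "y (final_param Z) = x1"
    "caratheodory_solution (\<lambda>t y. dot_v Z t *\<^sub>R f y + control_field g y (dot_w Z t)) x0 (final_param Z) y"
    unfolding lavrentiev_gap_def generalized_inf_def Inf_less_iff by blast
  have "Z \<in> gen_control_curves"
    using yZ(2,3) unfolding gen_controls_def by (auto elim!: quotientE)
  then have "ordinary_inf f g L x0 x1 \<epsilon> \<le> gen_cost L y Z" if "0 < \<epsilon>" for \<epsilon>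
    using ordinary_inf_le_gen_cost[OF assms(1-3,5) _ yZ(5) that] yZ(4) by simp
  \<comment> \<open>A larger tolerance admits more trajectories.\<close>
  moreover have "ordinary_inf f g L x0 x1 t \<le> ordinary_inf f g L x0 x1 s" if "s \<le> t" for s t
    unfolding ordinary_inf_def using that by (intro Inf_superset_mono) force
  ultimately have "Lim (at_right 0) (ordinary_inf f g L x0 x1) \<le> gen_cost L y Z"
    by (intro Lim_at_right_antimono_le)
  then show False
    using yZ(1) by simp
qed

end
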